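(* Let $(X,\mu,T_1,\ldots,T_d)$ be an ergodic measure preserving system with commuting transformations and let $f_1,\ldots,f_d\in L^\infty(\mu)$. Then the average $$\frac{1}{N^{d+1}} \sum_{0\leq n_1,\ldots,n_d \leq N-1}\ \sum_{0\leq n\leq N-1} f_1\Bigl(T_1^n \prod_{j=1}^d T_j^{n_j}x\Bigr)f_2\Bigl(T_2^n \prod_{j=1}^d T_j^{n_j}x\Bigr)\cdots f_d\Bigl(T_d^n \prod_{j=1}^d T_j^{n_j}x\Bigr)$$ converges for $\mu$-a.e. $x\in X$ as $N\to\infty$.
   Context: A measure preserving system with commuting transformations $(X,\mu,T_1,\ldots,T_d)$ is a probability space $(X,\mathcal X,\mu)$ with $d$ commuting invertible measure preserving transformations $T_1,\ldots,T_d$ of it. It is ergodic if every $A\in\mathcal X$ invariant under all of $T_1,\ldots,T_d$ satisfies $\mu(A)\in\{0,1\}$ (ergodicity of the joint $\mathbb Z^d$-action, not of the individual $T_i$). $\prod_{j=1}^d T_j^{n_j}$ denotes composition. *)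

theory Defs
  imports "HOL-Probability.Probability"
begin

text \<open>Points outside \<^term>\<open>space M\<close> are irrelevant: \<^term>\<open>T\<close> is only required to be a bijection
  of \<^term>\<open>space M\<close>, with measurable inverse.\<close>

definition invertible_mpt :: "'a measure \<Rightarrow> ('a \<Rightarrow> 'a) \<Rightarrow> bool" where
  "invertible_mpt M T \<longleftrightarrow>
     T \<in> measurable M M \<and> distr M M T = M \<and>
     bij_betw T (space M) (space M) \<and> inv_into (space M) T \<in> measurable M M"

text \<open>The transformations are \<^term>\<open>T i\<close> for \<^term>\<open>i \<in> {1..d}\<close>; other values of \<^term>\<open>T\<close> play no role.\<close>

locale commuting_system = prob_space M
  for M :: "'a measure" and d :: nat and T :: "nat \<Rightarrow> 'a \<Rightarrow> 'a" +
  assumes mpt: "i \<in> {1..d} \<Longrightarrow> invertible_mpt M (T i)"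
    and commute: "\<lbrakk>i \<in> {1..d}; j \<in> {1..d}; x \<in> space M\<rbrakk> \<Longrightarrow> T i (T j x) = T j (T i x)"

locale ergodic_commuting_system = commuting_system +
  assumes ergodic:
    "\<lbrakk>A \<in> sets M; \<And>i. i \<in> {1..d} \<Longrightarrow> T i -` A \<inter> space M = A\<rbrakk> \<Longrightarrow> measure M A \<in> {0, 1}"

text \<open>Representatives of elements of $L^\infty(\mu)$, complex-valued.\<close>

definition L_infty :: "'a measure \<Rightarrow> ('a \<Rightarrow> complex) set" where
  "L_infty M = {f \<in> borel_measurable M. \<exists>C. AE x in M. norm (f x) \<le> C}"

text \<open>\<^term>\<open>compose_powers T m d\<close> is $T_1^{m_1} \circ \cdots \circ T_d^{m_d}$.\<close>

primrec compose_powers :: "(nat \<Rightarrow> 'a \<Rightarrow> 'a) \<Rightarrow> (nat \<Rightarrow> nat) \<Rightarrow> nat \<Rightarrow> 'a \<Rightarrow> 'a" where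
  "compose_powers T m 0 = id"
| "compose_powers T m (Suc k) = compose_powers T m k \<circ> (T (Suc k) ^^ m (Suc k))"

text \<open>The multi-index $(n_1, \ldots, n_d)$ is an extensional function \<^term>\<open>m\<close> on \<^term>\<open>{1..d}\<close>,
  so that each tuple is counted exactly once.\<close>

definition cube_average ::
    "(nat \<Rightarrow> 'a \<Rightarrow> 'a) \<Rightarrow> (nat \<Rightarrow> 'a \<Rightarrow> complex) \<Rightarrow> nat \<Rightarrow> nat \<Rightarrow> 'a \<Rightarrow> complex" where
  "cube_average T f d N x =
     1 / of_nat N ^ (d + 1) *
     (\<Sum>m \<in> {1..d} \<rightarrow>\<^sub>E {0..<N}. \<Sum>n = 0..<N.
        \<Prod>i = 1..d. f i ((T i ^^ n) (compose_powers T m d x)))"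

end

(* Multiple averages A_N(f_1,...,f_k) with k <= d functions are treated by induction on k, for
   arbitrary (not necessarily ergodic) systems. Fix f_1,...,f_(k-1) and let V be the space of
   bounded g for which A_N(f_1,...,f_(k-1),g) converges almost everywhere. Given f_k, choose C in V
   nearly minimising the L^2 distance; then u = f_k - C is almost orthogonal to every s in V with
   |s| <= 1.

   Choosing N(x) so that A_N(x)(...,u)(x) nearly attains its limsup, the integrated empirical
   measures of (T_1^n T^m x, ..., T_k^n T^m x) accumulate at a measure on X^k whose marginals are mu
   (by a Z^(d+1) pointwise ergodic theorem) and which is invariant under T_j x ... x T_j for all j
   and under T_1 x ... x T_k. Hence the integral of limsup A_N(...,u) is about the integral of u *
   s, where s is the conditional expectation of f_1 (x) ... (x) f_(k-1) given the last coordinate.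
   On X^k let T_j act diagonally for j <> k and T_k act as T_1 x ... x T_k. Then T_k and T_i agree
   on the i-th coordinate, so A_N(f_1,...,f_(k-1),s) is the conditional expectation of an average of
   only k - 1 functions over X^k. By induction s lies in V, so the limsup is small; the same bound
   for -u gives convergence.

   To have the limit measure on X^k countably additive, the system is first coded into the Cantor
   space nat => bool, which also contains a homeomorphic copy of each of its powers. *)

theory Submission
  imports Defs "HOL-Complex_Analysis.Great_Picard"
begin

section \<open>Pointwise ergodic theorems for bounded functions\<close>

text \<open>Because N depends on x, mean convergence says nothing about the average at N(x). A
  pointwise theorem does: a bounded sequence that converges almost everywhere has the same limiting
  integral along every random index tending to infinity. Invariance survives a random index because
  the telescoping error is at most 2B/N(x) at each point.

  The limit measure is controlled only on clopen sets, while the functions are merely measurable.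
  The marginals close this gap: replacing one function by a clopen step function costs an error
  depending on a single coordinate, and averages of such functions are known to converge for every
  bounded measurable function.

  Convergence is always expressed as the inequality that the integrals of limsup a and limsup (-a)
  add up to at most 0. In this form it passes through conditional expectations with a random index,
  and only upper bounds ever have to be proved. V is not known to be closed in L^2, so a
  near-minimiser takes the place of an orthogonal projection.\<close>

definition rlimsup :: "(nat \<Rightarrow> real) \<Rightarrow> real" where
  "rlimsup a = real_of_ereal (limsup (\<lambda>n. ereal (a n)))"

lemma rlimsup_ereal:
  assumes "\<And>n. \<bar>a n\<bar> \<le> B"
  shows "limsup (\<lambda>n. ereal (a n)) = ereal (rlimsup a)" "\<bar>rlimsup a\<bar> \<le> B"
proof -
  have u: "limsup (\<lambda>n. ereal (a n)) \<le> ereal B"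
    using assms by (intro Limsup_bounded always_eventually allI) (simp add: abs_le_iff)
  have "- B \<le> a n" for n using assms[of n] by linarith
  then have "ereal (- B) \<le> liminf (\<lambda>n. ereal (a n))"
    by (intro Liminf_bounded always_eventually allI) simp
  also have "\<dots> \<le> limsup (\<lambda>n. ereal (a n))" by (rule Liminf_le_Limsup) simp
  finally have l: "ereal (- B) \<le> limsup (\<lambda>n. ereal (a n))" .
  obtain r where r: "limsup (\<lambda>n. ereal (a n)) = ereal r"
    using u l by (cases "limsup (\<lambda>n. ereal (a n))") auto
  then show "limsup (\<lambda>n. ereal (a n)) = ereal (rlimsup a)" by (simp add: rlimsup_def)
  show "\<bar>rlimsup a\<bar> \<le> B" using u l r by (auto simp: rlimsup_def)
qed

lemma rlimsup_frequently:
  assumes "\<And>n. \<bar>a n\<bar> \<le> B" "\<epsilon> > 0"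
  shows "\<exists>n\<ge>L. a n > rlimsup a - \<epsilon>"
proof (rule ccontr)
  assume "\<not> ?thesis"
  then have "\<forall>\<^sub>F n in sequentially. ereal (a n) \<le> ereal (rlimsup a - \<epsilon>)"
    unfolding eventually_sequentially by (auto simp: not_less)
  then have "limsup (\<lambda>n. ereal (a n)) \<le> ereal (rlimsup a - \<epsilon>)" by (rule Limsup_bounded)
  then show False using rlimsup_ereal(1)[of a B, OF assms(1)] assms(2) by simp
qed

lemma rlimsup_eventually:
  assumes "\<And>n. \<bar>a n\<bar> \<le> B" "\<epsilon> > 0"
  shows "\<forall>\<^sub>F n in sequentially. a n < rlimsup a + \<epsilon>"
proof -
  have "limsup (\<lambda>n. ereal (a n)) < ereal (rlimsup a + \<epsilon>)"
    using rlimsup_ereal(1)[of a B, OF assms(1)] assms(2) by simp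
  then have "\<forall>\<^sub>F n in sequentially. ereal (a n) < ereal (rlimsup a + \<epsilon>)" by (rule Limsup_lessD)
  then show ?thesis by simp
qed

lemma rlimsup_le:
  assumes "\<And>n. \<bar>a n\<bar> \<le> B" "\<And>\<epsilon>. \<epsilon> > 0 \<Longrightarrow> \<forall>\<^sub>F n in sequentially. a n \<le> c + \<epsilon>"
  shows "rlimsup a \<le> c"
proof (rule field_le_epsilon)
  fix e :: real assume "e > 0"
  have "limsup (\<lambda>n. ereal (a n)) \<le> ereal (c + e)"
    using assms(2)[OF \<open>e > 0\<close>] by (intro Limsup_bounded) simp
  then show "rlimsup a \<le> c + e" using rlimsup_ereal(1)[of a B, OF assms(1)] by simp
qed

lemma rlimsup_add_le:
  assumes "\<And>n. \<bar>a n\<bar> \<le> B" "\<And>n. \<bar>b n\<bar> \<le> C"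
  shows "rlimsup (\<lambda>n. a n + b n) \<le> rlimsup a + rlimsup b"
proof (rule rlimsup_le)
  show "\<bar>a n + b n\<bar> \<le> B + C" for n using assms(1)[of n] assms(2)[of n] by linarith
  fix e :: real assume "e > 0"
  then have "\<forall>\<^sub>F n in sequentially. a n < rlimsup a + e/2" "\<forall>\<^sub>F n in sequentially. b n < rlimsup b + e/2"
    using rlimsup_eventually[of a B "e/2"] rlimsup_eventually[of b C "e/2"] assms by auto
  then show "\<forall>\<^sub>F n in sequentially. a n + b n \<le> rlimsup a + rlimsup b + e"
    by eventually_elim (simp add: field_simps)
qed

lemma rlimsup_lim:
  assumes "\<And>n. \<bar>a n\<bar> \<le> B" "a \<longlonglongrightarrow> l"
  shows "rlimsup a = l"
proof -
  have "(\<lambda>n. ereal (a n)) \<longlonglongrightarrow> ereal l" using assms(2) by simp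
  then have "limsup (\<lambda>n. ereal (a n)) = ereal l" by (intro lim_imp_Limsup) auto
  then show ?thesis by (simp add: rlimsup_def)
qed

lemma rlimsup_add_null:
  assumes "\<And>n. \<bar>a n\<bar> \<le> B" "\<And>n. \<bar>b n\<bar> \<le> B" "(\<lambda>n. a n - b n) \<longlonglongrightarrow> 0"
  shows "rlimsup a \<le> rlimsup b"
proof -
  have d: "\<bar>a n - b n\<bar> \<le> 2 * B" for n using assms(1)[of n] assms(2)[of n] by linarith
  have "rlimsup (\<lambda>n. (a n - b n) + b n) \<le> rlimsup (\<lambda>n. a n - b n) + rlimsup b"
    by (rule rlimsup_add_le[OF d assms(2)])
  then show ?thesis using rlimsup_lim[OF d assms(3)] by simp
qed

lemma rlimsup_pos:
  assumes "\<And>n. \<bar>a n\<bar> \<le> B"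
  shows "0 \<le> rlimsup a + rlimsup (\<lambda>n. - a n)"
proof -
  have "rlimsup (\<lambda>n. a n + - a n) \<le> rlimsup a + rlimsup (\<lambda>n. - a n)"
    using assms by (intro rlimsup_add_le[of a B _ B]) auto
  then show ?thesis using rlimsup_lim[of "\<lambda>n. 0" 0 0] by simp
qed

text \<open>The limsup of -a is minus the liminf of a, so the hypothesis says that limsup and liminf
  agree. This symmetric form allows an upper bound for limsups to be applied once to a and once to
  -a.\<close>

lemma convergent_rlimsup:
  assumes "\<And>n. \<bar>a n\<bar> \<le> B" "rlimsup a + rlimsup (\<lambda>n. - a n) = 0"
  shows "convergent a"
proof -
  have "a \<longlonglongrightarrow> rlimsup a"
  proof (rule LIMSEQ_I)
    fix e :: real assume "e > 0"
    then have "\<forall>\<^sub>F n in sequentially. a n < rlimsup a + e" "\<forall>\<^sub>F n in sequentially. - a n < rlimsup (\<lambda>n. - a n) + e"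
      using rlimsup_eventually[of a B e] rlimsup_eventually[of "\<lambda>n. - a n" B e] assms by auto
    then have "\<forall>\<^sub>F n in sequentially. norm (a n - rlimsup a) < e"
      by eventually_elim (use assms(2) in \<open>auto simp: abs_less_iff\<close>)
    then show "\<exists>no. \<forall>n\<ge>no. norm (a n - rlimsup a) < e" by (simp add: eventually_sequentially)
  qed
  then show ?thesis by (rule convergentI)
qed

lemma borel_measurable_rlimsup [measurable]:
  assumes "\<And>n. (\<lambda>x. a n x) \<in> borel_measurable M"
  shows "(\<lambda>x. rlimsup (\<lambda>n. a n x)) \<in> borel_measurable M"
  unfolding rlimsup_def using assms by measurable

section \<open>Measure preserving maps and bounded measurable functions\<close>

definition mpres :: "'a measure \<Rightarrow> ('a \<Rightarrow> 'a) \<Rightarrow> bool" where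
  "mpres M T \<longleftrightarrow> T \<in> measurable M M \<and> distr M M T = M"

text \<open>The bound holds at every point, also off the space, so it survives composition with any
  map and no null sets have to be tracked. Essentially bounded functions are reduced to this class
  at the very end.\<close>

definition bdd_meas :: "'a measure \<Rightarrow> ('a \<Rightarrow> real) set" where
  "bdd_meas M = {f \<in> borel_measurable M. \<exists>B. \<forall>x. \<bar>f x\<bar> \<le> B}"

lemma bdd_measI: "f \<in> borel_measurable M \<Longrightarrow> (\<And>x. \<bar>f x\<bar> \<le> B) \<Longrightarrow> f \<in> bdd_meas M"
  by (auto simp: bdd_meas_def)

lemma bdd_measD: "f \<in> bdd_meas M \<Longrightarrow> f \<in> borel_measurable M"
  by (auto simp: bdd_meas_def)

lemma bdd_meas_bound:
  assumes "f \<in> bdd_meas M"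
  obtains B where "B \<ge> 0" "\<And>x. \<bar>f x\<bar> \<le> B"
proof -
  obtain B where "\<And>x. \<bar>f x\<bar> \<le> B" using assms by (auto simp: bdd_meas_def)
  moreover from this[of undefined] have "B \<ge> 0" by linarith
  ultimately show ?thesis using that by blast
qed

lemma bdd_meas_comp: "f \<in> bdd_meas M \<Longrightarrow> T \<in> measurable N M \<Longrightarrow> (\<lambda>x. f (T x)) \<in> bdd_meas N"
  by (auto simp: bdd_meas_def intro: measurable_compose)

lemma bdd_meas_const [simp]: "(\<lambda>x. c) \<in> bdd_meas M"
  by (auto simp: bdd_meas_def)

lemma bdd_meas_add:
  assumes "f \<in> bdd_meas M" "g \<in> bdd_meas M" shows "(\<lambda>x. f x + g x) \<in> bdd_meas M"
proof -
  obtain B C where "\<And>x. \<bar>f x\<bar> \<le> B" "\<And>x. \<bar>g x\<bar> \<le> C" using assms bdd_meas_bound by metis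
  then have "\<bar>f x + g x\<bar> \<le> B + C" for x by (meson abs_triangle_ineq add_mono order_trans)
  then show ?thesis using assms by (intro bdd_measI[where B="B + C"] borel_measurable_add) (auto dest: bdd_measD)
qed

lemma bdd_meas_mult:
  assumes "f \<in> bdd_meas M" "g \<in> bdd_meas M" shows "(\<lambda>x. f x * g x) \<in> bdd_meas M"
proof -
  obtain B C where "\<And>x. \<bar>f x\<bar> \<le> B" "\<And>x. \<bar>g x\<bar> \<le> C" "B \<ge> 0" using assms bdd_meas_bound by metis
  then have "\<bar>f x * g x\<bar> \<le> B * C" for x by (simp add: abs_mult mult_mono)
  then show ?thesis using assms by (intro bdd_measI[where B="B * C"] borel_measurable_times) (auto dest: bdd_measD)
qed

lemma bdd_meas_cmult: "f \<in> bdd_meas M \<Longrightarrow> (\<lambda>x. c * f x) \<in> bdd_meas M"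
  using bdd_meas_mult[OF bdd_meas_const] .

lemma bdd_meas_uminus: "f \<in> bdd_meas M \<Longrightarrow> (\<lambda>x. - f x) \<in> bdd_meas M"
  using bdd_meas_cmult[of f M "-1"] by simp

lemma bdd_meas_diff: "f \<in> bdd_meas M \<Longrightarrow> g \<in> bdd_meas M \<Longrightarrow> (\<lambda>x. f x - g x) \<in> bdd_meas M"
  using bdd_meas_add[OF _ bdd_meas_uminus] by simp

lemma bdd_meas_sum: "(\<And>i. i \<in> I \<Longrightarrow> f i \<in> bdd_meas M) \<Longrightarrow> (\<lambda>x. \<Sum>i\<in>I. f i x) \<in> bdd_meas M"
  by (induction I rule: infinite_finite_induct) (auto intro: bdd_meas_add)

lemma bdd_meas_prod: "(\<And>i. i \<in> I \<Longrightarrow> f i \<in> bdd_meas M) \<Longrightarrow> (\<lambda>x. \<Prod>i\<in>I. f i x) \<in> bdd_meas M"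
  by (induction I rule: infinite_finite_induct) (auto intro: bdd_meas_mult)

lemma bdd_meas_divide: "f \<in> bdd_meas M \<Longrightarrow> (\<lambda>x. f x / c) \<in> bdd_meas M"
  using bdd_meas_cmult[of f M "1/c"] by simp

lemma bdd_meas_indicator: "A \<in> sets M \<Longrightarrow> indicator A \<in> bdd_meas M"
  by (intro bdd_measI[where B=1]) (auto simp: indicator_def)

lemma bdd_meas_abs: "f \<in> bdd_meas M \<Longrightarrow> (\<lambda>x. \<bar>f x\<bar>) \<in> bdd_meas M"
  by (auto simp: bdd_meas_def)

lemma (in finite_measure) integrable_bdd_meas: "f \<in> bdd_meas M \<Longrightarrow> integrable M f"
  by (metis AE_I2 bdd_measD bdd_meas_bound integrable_const_bound real_norm_def)

lemma mpres_measurable: "mpres M T \<Longrightarrow> T \<in> measurable M M"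
  by (simp add: mpres_def)

lemma mpres_id: "mpres M (\<lambda>x. x)"
  by (simp add: mpres_def distr_id)

lemma mpres_comp:
  assumes "mpres M T" "mpres M S" shows "mpres M (T \<circ> S)"
  using assms distr_distr[of T M M S M] by (auto simp: mpres_def)

lemma mpres_pow: "mpres M T \<Longrightarrow> mpres M (T ^^ n)"
  by (induction n) (auto simp: mpres_comp mpres_id id_def)

lemma mpres_integral:
  assumes "mpres M T" "f \<in> borel_measurable M"
  shows "(\<integral>x. f (T x) \<partial>M) = (\<integral>x. (f x :: real) \<partial>M)"
  using assms integral_distr[of T M M f] by (simp add: mpres_def)

lemma mpres_AE:
  assumes "mpres M T" "AE x in M. P x"
  shows "AE x in M. P (T x)"
proof -
  have "AE x in distr M M T. P x" using assms(2) by (subst conjunct2[OF assms(1)[unfolded mpres_def]])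
  then show ?thesis using AE_distrD[of T M M P] assms(1) by (simp add: mpres_def)
qed

section \<open>Cesaro averages along one transformation\<close>

definition cavg :: "('a \<Rightarrow> 'a) \<Rightarrow> nat \<Rightarrow> ('a \<Rightarrow> real) \<Rightarrow> 'a \<Rightarrow> real" where
  "cavg T N g x = (\<Sum>n<N. g ((T ^^ n) x)) / real N"

lemma bdd_meas_cavg:
  assumes "mpres M T" "g \<in> bdd_meas M" shows "cavg T N g \<in> bdd_meas M"
  unfolding cavg_def
  by (intro bdd_meas_divide bdd_meas_sum bdd_meas_comp[OF assms(2)] mpres_measurable mpres_pow assms)

lemma mean_bound:
  assumes "\<And>n. \<bar>a n\<bar> \<le> B"
  shows "\<bar>(\<Sum>n<N. a n) / real N\<bar> \<le> B"
proof (cases "N = 0")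
  case True then show ?thesis using assms[of 0] by simp
next
  case False
  have "\<bar>\<Sum>n<N. a n\<bar> \<le> (\<Sum>n<N. B)" using assms by (intro sum_norm_le[where 'a=real, simplified]) auto
  then show ?thesis using False by (simp add: field_simps)
qed

lemma cavg_bound: "(\<And>x. \<bar>g x\<bar> \<le> B) \<Longrightarrow> \<bar>cavg T N g x\<bar> \<le> B"
  unfolding cavg_def by (rule mean_bound) simp

lemma cavg_mono: "(\<And>x. g x \<le> h x) \<Longrightarrow> cavg T N g x \<le> cavg T N h x"
  unfolding cavg_def by (intro divide_right_mono sum_mono) auto

lemma cavg_shift:
  assumes "\<And>x. \<bar>g x\<bar> \<le> B"
  shows "\<bar>cavg T N g (T x) - cavg T N g x\<bar> \<le> 2 * B / real N"
proof -
  have "(\<Sum>n<N. g ((T ^^ n) (T x))) - (\<Sum>n<N. g ((T ^^ n) x)) = g ((T ^^ N) x) - g x"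
    unfolding sum_subtractf[symmetric] funpow_swap1[symmetric] 
    using sum_lessThan_telescope[of "\<lambda>n. g ((T ^^ n) x)" N] by simp
  then have "cavg T N g (T x) - cavg T N g x = (g ((T ^^ N) x) - g x) / real N"
    unfolding cavg_def diff_divide_distrib[symmetric] by simp
  moreover have "\<bar>g ((T ^^ N) x) - g x\<bar> \<le> 2 * B"
    using assms[of x] assms[of "(T ^^ N) x"] by linarith
  ultimately show ?thesis by (simp add: divide_right_mono)
qed

text \<open>Katznelson-Weiss argument: off a set \<^term>\<open>G\<close> of small measure every orbit can be cut into blocks of bounded
  length whose averages are at least the limsup minus \<^term>\<open>\<epsilon>\<close>; on \<^term>\<open>G\<close> the function is increased so that
  blocks of length one do.\<close>

lemma (in prob_space) integral_limsup_cavg_le: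
  assumes T: "mpres M T" and g: "g \<in> bdd_meas M"
  shows "(\<integral>x. rlimsup (\<lambda>N. cavg T N g x) \<partial>M) \<le> (\<integral>x. g x \<partial>M)"
proof -
  obtain B where B: "B \<ge> 0" "\<And>x. \<bar>g x\<bar> \<le> B" using bdd_meas_bound[OF g] by metis
  have bN: "\<bar>cavg T N g x\<bar> \<le> B" for N x using B by (intro cavg_bound)
  define \<gamma> where "\<gamma> = (\<lambda>x. rlimsup (\<lambda>N. cavg T N g x))"
  have m[measurable]: "g \<in> borel_measurable M" "\<And>N. cavg T N g \<in> borel_measurable M" "T \<in> measurable M M"
    using bdd_measD[OF bdd_meas_cavg[OF T g]] bdd_measD[OF g] T by (auto simp: mpres_def)
  have \<gamma>m[measurable]: "\<gamma> \<in> borel_measurable M" unfolding \<gamma>_def by measurable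
  have \<gamma>B: "\<bar>\<gamma> x\<bar> \<le> B" for x unfolding \<gamma>_def using bN by (intro rlimsup_ereal(2))
  have lim0: "(\<lambda>N. cavg T N g (T x) - cavg T N g x) \<longlonglongrightarrow> 0" for x
  proof (rule Lim_null_comparison)
    show "\<forall>\<^sub>F N in sequentially. norm (cavg T N g (T x) - cavg T N g x) \<le> 2 * B / real N"
      unfolding real_norm_def by (intro always_eventually allI cavg_shift B(2))
    show "(\<lambda>N. 2 * B / real N) \<longlonglongrightarrow> 0" by real_asymp
  qed
  have inv: "\<gamma> (T x) = \<gamma> x" for x
  proof (rule antisym)
    show "\<gamma> (T x) \<le> \<gamma> x" unfolding \<gamma>_def using bN lim0 by (intro rlimsup_add_null[where B=B]) auto
    show "\<gamma> x \<le> \<gamma> (T x)" unfolding \<gamma>_def using bN tendsto_minus[OF lim0[of x]]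
      by (intro rlimsup_add_null[where B=B]) auto
  qed
  have invn: "\<gamma> ((T ^^ n) x) = \<gamma> x" for n x by (induction n) (auto simp: inv)
  define S where "S = (\<lambda>n x. \<Sum>j<n. g ((T ^^ j) x))"
  have [measurable]: "S n \<in> borel_measurable M" for n unfolding S_def
    using mpres_measurable[OF mpres_pow[OF T]] by measurable
  have main: "(\<integral>x. \<gamma> x \<partial>M) \<le> (\<integral>x. g x \<partial>M) + (2 * B + 1) * \<epsilon>" if "\<epsilon> > 0" for \<epsilon>
  proof -
    \<comment> \<open>Every point starts some block with a good average (\<open>ex\<close>), so
      these sets decrease to the empty set and one of them has measure below \<epsilon>.\<close>
    define G where "G = (\<lambda>n. {x \<in> space M. \<forall>j\<in>{1..n}. S j x < real j * (\<gamma> x - \<epsilon>)})"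
    have [measurable]: "G n \<in> sets M" for n unfolding G_def by measurable
    have ex: "\<exists>n\<ge>1. S n x \<ge> real n * (\<gamma> x - \<epsilon>)" for x
    proof -
      obtain n where n: "n \<ge> 1" "cavg T n g x > \<gamma> x - \<epsilon>"
        unfolding \<gamma>_def using rlimsup_frequently[of "\<lambda>N. cavg T N g x" B \<epsilon> 1] bN \<open>\<epsilon> > 0\<close> by auto
      then have "S n x \<ge> real n * (\<gamma> x - \<epsilon>)" by (simp add: cavg_def S_def field_simps)
      with n show ?thesis by blast
    qed
    have "(\<lambda>n. measure M (G n)) \<longlonglongrightarrow> measure M (\<Inter>n. G n)"
    proof (rule finite_Lim_measure_decseq)
      show "decseq G" by (auto simp: decseq_def G_def)
    qed auto
    moreover have "(\<Inter>n. G n) = {}"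
    proof (rule equals0I)
      fix x assume x: "x \<in> (\<Inter>n. G n)"
      obtain n where n: "n \<ge> 1" "S n x \<ge> real n * (\<gamma> x - \<epsilon>)" using ex by blast
      have "x \<in> G n" using x by blast
      then have *: "\<forall>j\<in>{1..n}. S j x < real j * (\<gamma> x - \<epsilon>)" unfolding G_def by (rule CollectE) (rule conjunct2)
      have "n \<in> {1..n}" using n(1) by (simp only: atLeastAtMost_iff order_refl conj_absorb)
      with * have "S n x < real n * (\<gamma> x - \<epsilon>)" by (rule bspec)
      with n(2) show False by (rule leD[THEN notE])
    qed
    ultimately have "(\<lambda>n. measure M (G n)) \<longlonglongrightarrow> 0" by simp
    then have "\<forall>\<^sub>F n in sequentially. measure M (G n) < \<epsilon>" using order_tendstoD(2) \<open>\<epsilon> > 0\<close> by blast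
    then obtain K where K: "measure M (G K) < \<epsilon>" by (auto simp: eventually_sequentially)
    \<comment> \<open>The increment 2 * B suffices: on \<open>G K\<close> the new value is at least
      B, hence at least \<gamma>.\<close>
    define g' where "g' = (\<lambda>x. g x + 2 * B * indicator (G K) x)"
    have g'ge: "g x \<le> g' x" for x using B by (simp add: g'_def)
    have g'b: "g' \<in> bdd_meas M" unfolding g'_def
      by (intro bdd_meas_add g bdd_meas_cmult bdd_meas_indicator) simp
    have step: "\<exists>n\<ge>1. n \<le> Suc K \<and> (\<Sum>j<n. g' ((T ^^ j) x)) \<ge> real n * (\<gamma> x - \<epsilon>)" if x: "x \<in> space M" for x
    proof (cases "x \<in> G K")
      case True
      then have "g' x = g x + 2 * B" by (simp add: g'_def)
      then have "g' x \<ge> \<gamma> x - \<epsilon>" using B(2)[of x] \<gamma>B[of x] \<open>\<epsilon> > 0\<close> by linarith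
      then show ?thesis by (intro exI[of _ 1]) simp
    next
      case False
      then obtain j where j: "j \<in> {1..K}" "S j x \<ge> real j * (\<gamma> x - \<epsilon>)" using x by (auto simp: G_def not_less)
      have "S j x \<le> (\<Sum>j<j. g' ((T ^^ j) x))" unfolding S_def by (intro sum_mono g'ge)
      then show ?thesis using j by (intro exI[of _ j]) auto
    qed
    have Tsp: "(T ^^ n) x \<in> space M" if "x \<in> space M" for n x
      by (rule measurable_space[OF mpres_measurable[OF mpres_pow[OF T]] that])
    \<comment> \<open>Greedy cutting: after removing a block the rest of the orbit is treated in the
      same way, \<gamma> being constant along it. Only the last incomplete piece, shorter than
      \<open>Suc K\<close>, is lost; there the bounds - B and B show that the loss is at most 2 * B
      * \<open>Suc K\<close>.\<close>
    have cover: "x \<in> space M \<Longrightarrow> (\<Sum>j<L. g' ((T ^^ j) x)) \<ge> real L * (\<gamma> x - \<epsilon>) - 2 * B * real (Suc K)" for L x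
    proof (induction L arbitrary: x rule: less_induct)
      case (less L)
      obtain n where n: "n \<ge> 1" "n \<le> Suc K" "(\<Sum>j<n. g' ((T ^^ j) x)) \<ge> real n * (\<gamma> x - \<epsilon>)"
        using step[OF less.prems] by blast
      show ?case
      proof (cases "L < n")
        case True
        have "g' y \<ge> - B" for y using g'ge[of y] B(2)[of y] by linarith
        then have "(\<Sum>j<L. g' ((T ^^ j) x)) \<ge> (\<Sum>j<L. - B)" by (intro sum_mono)
        then have 1: "(\<Sum>j<L. g' ((T ^^ j) x)) \<ge> - (real L * B)" by simp
        have "real L * (\<gamma> x - \<epsilon>) \<le> real L * B" using \<gamma>B[of x] \<open>\<epsilon> > 0\<close> by (intro mult_left_mono) auto
        moreover have "real L * B \<le> real (Suc K) * B" using True n B by (intro mult_right_mono) auto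
        ultimately have "real L * (\<gamma> x - \<epsilon>) - 2 * B * real (Suc K) \<le> - (real L * B)"
          by (simp add: algebra_simps)
        then show ?thesis using 1 by linarith
      next
        case False
        then have L: "L = n + (L - n)" "L - n < L" using n by auto
        have "(\<Sum>j<L. g' ((T ^^ j) x)) = (\<Sum>j<n + (L - n). g' ((T ^^ j) x))" using L by simp
        also have "\<dots> = (\<Sum>j<n. g' ((T ^^ j) x)) + (\<Sum>j<L - n. g' ((T ^^ j) ((T ^^ n) x)))"
        proof -
          have "(\<Sum>j=n..<n + (L - n). g' ((T ^^ j) x)) = (\<Sum>j=0..<L - n. g' ((T ^^ (j + n)) x))"
            using sum.shift_bounds_nat_ivl[of "\<lambda>j. g' ((T ^^ j) x)" 0 n "L - n"] by (simp add: add.commute)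
          then show ?thesis
            using sum.atLeastLessThan_concat[of 0 n "n + (L - n)" "\<lambda>j. g' ((T ^^ j) x)"]
            by (simp add: funpow_add atLeast0LessThan)
        qed
        finally have e: "(\<Sum>j<L. g' ((T ^^ j) x)) = (\<Sum>j<n. g' ((T ^^ j) x)) + (\<Sum>j<L - n. g' ((T ^^ j) ((T ^^ n) x)))" .
        have r: "real L = real n + real (L - n)" using L by linarith
        have "(\<Sum>j<L - n. g' ((T ^^ j) ((T ^^ n) x))) \<ge> real (L - n) * (\<gamma> x - \<epsilon>) - 2 * B * real (Suc K)"
          using less.IH[OF L(2) Tsp[OF less.prems]] by (simp add: invn)
        then show ?thesis unfolding e r using n(3) by (simp add: algebra_simps)
      qed
    qed
    have int: "integrable M g'" "integrable M \<gamma>" "integrable M g"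
      using g'b g bdd_measI[OF \<gamma>m \<gamma>B] by (auto intro: integrable_bdd_meas)
    have L: "real L * ((\<integral>x. \<gamma> x \<partial>M) - \<epsilon>) - 2 * B * real (Suc K) \<le> real L * (\<integral>x. g' x \<partial>M)" for L
    proof -
      have i: "integrable M (\<lambda>x. g' ((T ^^ j) x))" for j
        by (intro integrable_bdd_meas bdd_meas_comp[OF g'b] mpres_measurable mpres_pow T)
      have "(\<integral>x. real L * (\<gamma> x - \<epsilon>) - 2 * B * real (Suc K) \<partial>M) \<le> (\<integral>x. (\<Sum>j<L. g' ((T ^^ j) x)) \<partial>M)"
        using int i cover by (intro integral_mono) auto
      also have "\<dots> = (\<Sum>j<L. \<integral>x. g' ((T ^^ j) x) \<partial>M)" using i by (intro Bochner_Integration.integral_sum) auto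
      also have "\<dots> = real L * (\<integral>x. g' x \<partial>M)"
        using mpres_integral[OF mpres_pow[OF T] bdd_measD[OF g'b]] by simp
      finally show ?thesis using int by (simp add: prob_space)
    qed
    \<comment> \<open>The loss at the end of the orbit does not grow with L, so a positive
      difference would be contradicted by a long orbit.\<close>
    have "(\<integral>x. \<gamma> x \<partial>M) - \<epsilon> - (\<integral>x. g' x \<partial>M) \<le> 0"
    proof (rule ccontr)
      assume "\<not> ?thesis"
      then have p: "(\<integral>x. \<gamma> x \<partial>M) - \<epsilon> - (\<integral>x. g' x \<partial>M) > 0" by simp
      obtain L where "real L * ((\<integral>x. \<gamma> x \<partial>M) - \<epsilon> - (\<integral>x. g' x \<partial>M)) > 2 * B * real (Suc K)"
        using reals_Archimedean3[OF p] by blast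
      then show False using L[of L] by (simp add: algebra_simps)
    qed
    also have "(\<integral>x. g' x \<partial>M) = (\<integral>x. g x \<partial>M) + 2 * B * measure M (G K)"
    proof -
      have "integrable M (\<lambda>x. indicator (G K) x :: real)" by (intro integrable_bdd_meas bdd_meas_indicator) simp
      then show ?thesis unfolding g'_def using int by (subst Bochner_Integration.integral_add) auto
    qed
    finally have "(\<integral>x. \<gamma> x \<partial>M) \<le> (\<integral>x. g x \<partial>M) + 2 * B * measure M (G K) + \<epsilon>" by linarith
    moreover have "2 * B * measure M (G K) \<le> 2 * B * \<epsilon>" using K B by (intro mult_left_mono) auto
    ultimately show ?thesis by (simp add: algebra_simps)
  qed
  have "(\<integral>x. \<gamma> x \<partial>M) \<le> (\<integral>x. g x \<partial>M) + e" if "e > 0" for e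
  proof -
    have "(2 * B + 1) * (e / (2 * B + 1)) = e" using B by (simp add: field_simps)
    then show ?thesis using main[of "e / (2 * B + 1)"] B that by simp
  qed
  then show ?thesis unfolding \<gamma>_def by (rule field_le_epsilon)
qed

text \<open>The difference of limsup and liminf is nonnegative, so a nonpositive integral forces it
  to vanish almost everywhere.\<close>

lemma (in prob_space) AE_convergent_integral_rlimsup:
  assumes a: "\<And>N. a N \<in> borel_measurable M" "\<And>N x. \<bar>a N x\<bar> \<le> (B::real)"
    and le: "(\<integral>x. rlimsup (\<lambda>N. a N x) \<partial>M) + (\<integral>x. rlimsup (\<lambda>N. - a N x) \<partial>M) \<le> 0"
  shows "AE x in M. convergent (\<lambda>N. a N x)"
proof -
  define s where "s = (\<lambda>x. rlimsup (\<lambda>N. a N x) + rlimsup (\<lambda>N. - a N x))"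
  have [measurable]: "a N \<in> borel_measurable M" for N by fact
  have "(\<lambda>x. rlimsup (\<lambda>N. a N x)) \<in> bdd_meas M" "(\<lambda>x. rlimsup (\<lambda>N. - a N x)) \<in> bdd_meas M"
    by (intro bdd_measI[where B=B] rlimsup_ereal(2); use a in simp; measurable)+
  note i = this[THEN integrable_bdd_meas]
  have s: "s x \<ge> 0" for x unfolding s_def using a by (intro rlimsup_pos) auto
  have ints: "integrable M s" unfolding s_def using i by simp
  have "(\<integral>x. s x \<partial>M) = 0" 
  proof (rule antisym)
    show "(\<integral>x. s x \<partial>M) \<le> 0" unfolding s_def using i le by simp
    show "0 \<le> (\<integral>x. s x \<partial>M)" using s by (simp add: Bochner_Integration.integral_nonneg)
  qed
  then have "AE x in M. s x = 0" using integral_nonneg_eq_0_iff_AE[OF ints] s by simp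
  then show ?thesis
    by eventually_elim (use a in \<open>auto simp: s_def intro!: convergent_rlimsup[where B=B]\<close>)
qed

lemma cavg_uminus: "cavg T N (\<lambda>x. - g x) x = - cavg T N g x"
  by (simp add: cavg_def sum_negf)

lemma (in prob_space) integral_cavg:
  assumes T: "mpres M T" and g: "g \<in> bdd_meas M" and "N \<ge> 1"
  shows "(\<integral>x. cavg T N g x \<partial>M) = (\<integral>x. g x \<partial>M)"
proof -
  have i: "integrable M (\<lambda>x. g ((T ^^ j) x))" for j
    by (intro integrable_bdd_meas bdd_meas_comp[OF g] mpres_measurable mpres_pow T)
  have "(\<integral>x. (\<Sum>j<N. g ((T ^^ j) x)) \<partial>M) = (\<Sum>j<N. \<integral>x. g ((T ^^ j) x) \<partial>M)"
    using i by (intro Bochner_Integration.integral_sum) auto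
  also have "\<dots> = real N * (\<integral>x. g x \<partial>M)"
    using mpres_integral[OF mpres_pow[OF T] bdd_measD[OF g]] by simp
  finally show ?thesis using \<open>N \<ge> 1\<close> unfolding cavg_def by simp
qed

text \<open>Maker's form of the ergodic theorem: the averaged function \<open>h N\<close> varies
  with N, as it does in iterated averages. For N \<ge> L it is at most the limsup H plus the tail
  oscillation \<open>r L\<close>. The bound for fixed functions applies to both, and the integral of
  \<open>r L\<close> tends to 0 by dominated convergence.\<close>

lemma (in prob_space) integral_limsup_cavg_seq_le:
  assumes T: "mpres M T" and h: "\<And>N. h N \<in> borel_measurable M" "\<And>N x. \<bar>h N x\<bar> \<le> B"
    and conv: "AE x in M. convergent (\<lambda>N. h N x)"
  shows "(\<integral>x. rlimsup (\<lambda>N. cavg T N (h N) x) \<partial>M) \<le> (\<integral>x. rlimsup (\<lambda>N. h N x) \<partial>M)"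
proof -
  have [measurable]: "h N \<in> borel_measurable M" for N by fact
  define H where "H = (\<lambda>x. rlimsup (\<lambda>N. h N x))"
  have HB: "\<bar>H x\<bar> \<le> B" for x unfolding H_def using h by (intro rlimsup_ereal(2))
  have Hb: "H \<in> bdd_meas M" using HB by (intro bdd_measI[where B=B]) (auto simp: H_def)
  have [measurable]: "H \<in> borel_measurable M" using Hb by (rule bdd_measD)
  define r where "r = (\<lambda>L x. SUP n. \<bar>h (n + L) x - H x\<bar>)"
  have dB: "\<bar>h n x - H x\<bar> \<le> 2 * B" for n x using h(2)[of n x] HB[of x] by linarith
  then have bdd: "bdd_above (range (\<lambda>n. \<bar>h (n + L) x - H x\<bar>))" for L x by (intro bdd_aboveI2)
  have rle: "\<bar>h n x - H x\<bar> \<le> r L x" if "n \<ge> L" for n L x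
  proof -
    have "\<bar>h (n - L + L) x - H x\<bar> \<le> r L x" unfolding r_def by (rule cSUP_upper[OF UNIV_I bdd])
    then show ?thesis using that by simp
  qed
  have r0: "0 \<le> r L x" for L x using rle[of L L x] by linarith
  have rB: "\<bar>r L x\<bar> \<le> 2 * B" for L x
    unfolding abs_of_nonneg[OF r0] unfolding r_def by (intro cSUP_least dB) auto
  have rb: "r L \<in> bdd_meas M" for L
  proof (rule bdd_measI[OF _ rB])
    show "r L \<in> borel_measurable M" unfolding r_def
      by (intro borel_measurable_cSUP) (use bdd in auto)
  qed
  have cB: "\<bar>cavg T N (h N) x\<bar> \<le> B" for N x using h by (intro cavg_bound)
  have cm[measurable]: "(\<lambda>x. cavg T N g x) \<in> borel_measurable M" if "g \<in> bdd_meas M" for N g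
    using bdd_measD[OF bdd_meas_cavg[OF T that]] by simp
  have hb: "h N \<in> bdd_meas M" for N using h by (intro bdd_measI)
  have le: "(\<integral>x. rlimsup (\<lambda>N. cavg T N (h N) x) \<partial>M) \<le> (\<integral>x. H x \<partial>M) + (\<integral>x. r L x \<partial>M)" for L
  proof -
    have cH: "\<bar>cavg T N H x\<bar> \<le> B" for N x by (intro cavg_bound HB)
    have cr: "\<bar>cavg T N (r L) x\<bar> \<le> 2 * B" for N x by (intro cavg_bound rB)
    have pt: "rlimsup (\<lambda>N. cavg T N (h N) x) \<le> rlimsup (\<lambda>N. cavg T N H x) + rlimsup (\<lambda>N. cavg T N (r L) x)" for x
    proof (rule rlimsup_le[OF cB])
      fix e :: real assume "e > 0"
      then have "\<forall>\<^sub>F N in sequentially. cavg T N H x < rlimsup (\<lambda>N. cavg T N H x) + e/2"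
        "\<forall>\<^sub>F N in sequentially. cavg T N (r L) x < rlimsup (\<lambda>N. cavg T N (r L) x) + e/2"
        using rlimsup_eventually[of "\<lambda>N. cavg T N H x" B "e/2"] rlimsup_eventually[of "\<lambda>N. cavg T N (r L) x" "2 * B" "e/2"] cH cr
        by auto
      moreover have "\<forall>\<^sub>F N in sequentially. cavg T N (h N) x \<le> cavg T N H x + cavg T N (r L) x"
        using eventually_ge_at_top[of L]
      proof eventually_elim
        case (elim N)
        have "h N y \<le> H y + r L y" for y using rle[OF elim, of y] by linarith
        then have "cavg T N (h N) x \<le> cavg T N (\<lambda>y. H y + r L y) x" by (rule cavg_mono)
        then show ?case by (simp add: cavg_def sum.distrib add_divide_distrib)
      qed
      ultimately show "\<forall>\<^sub>F N in sequentially. cavg T N (h N) x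
          \<le> rlimsup (\<lambda>N. cavg T N H x) + rlimsup (\<lambda>N. cavg T N (r L) x) + e"
        by eventually_elim (simp add: field_simps)
    qed
    have b: "(\<lambda>x. rlimsup (\<lambda>N. cavg T N (h N) x)) \<in> bdd_meas M" "(\<lambda>x. rlimsup (\<lambda>N. cavg T N H x)) \<in> bdd_meas M"
      "(\<lambda>x. rlimsup (\<lambda>N. cavg T N (r L) x)) \<in> bdd_meas M"
      by (rule bdd_measI[OF borel_measurable_rlimsup rlimsup_ereal(2)], rule cm, rule hb, rule cB,
          rule bdd_measI[OF borel_measurable_rlimsup rlimsup_ereal(2)], rule cm, rule Hb, rule cH,
          rule bdd_measI[OF borel_measurable_rlimsup rlimsup_ereal(2)], rule cm, rule rb, rule cr)
    note b = b[THEN integrable_bdd_meas]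
    have "(\<integral>x. rlimsup (\<lambda>N. cavg T N (h N) x) \<partial>M)
        \<le> (\<integral>x. rlimsup (\<lambda>N. cavg T N H x) + rlimsup (\<lambda>N. cavg T N (r L) x) \<partial>M)"
      using b pt by (intro integral_mono) auto
    also have "\<dots> \<le> (\<integral>x. H x \<partial>M) + (\<integral>x. r L x \<partial>M)"
      using b integral_limsup_cavg_le[OF T Hb] integral_limsup_cavg_le[OF T rb[of L]] by simp
    finally show ?thesis .
  qed
  have "(\<lambda>L. \<integral>x. r L x \<partial>M) \<longlonglongrightarrow> (\<integral>x. 0 \<partial>M)"
  proof (rule integral_dominated_convergence[where w="\<lambda>_. 2 * B"])
    show "AE x in M. (\<lambda>L. r L x) \<longlonglongrightarrow> 0"
      using conv
    proof eventually_elim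
      case (elim x)
      then obtain l where l: "(\<lambda>N. h N x) \<longlonglongrightarrow> l" by (auto simp: convergent_def)
      then have "H x = l" unfolding H_def using h by (intro rlimsup_lim)
      show ?case
      proof (rule LIMSEQ_I)
        fix e :: real assume "e > 0"
        then obtain L0 where L0: "\<And>n. n \<ge> L0 \<Longrightarrow> \<bar>h n x - l\<bar> < e/2"
          using LIMSEQ_D[OF l, of "e/2"] by auto
        have *: "r L x \<le> e/2" if "L \<ge> L0" for L unfolding r_def \<open>H x = l\<close>
          using that by (intro cSUP_least) (simp, rule less_imp_le, rule L0, simp)
        have "norm (r n x - 0) < e" if "n \<ge> L0" for n
          using *[OF that] r0[of n x] \<open>e > 0\<close> by simp
        then show "\<exists>no. \<forall>n\<ge>no. norm (r n x - 0) < e" by blast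
      qed
    qed
  qed (use rb rB in \<open>auto dest: bdd_measD\<close>)
  then have "(\<lambda>L. (\<integral>x. H x \<partial>M) + (\<integral>x. r L x \<partial>M)) \<longlonglongrightarrow> (\<integral>x. H x \<partial>M) + 0"
    by (intro tendsto_intros) simp
  then show ?thesis unfolding H_def[symmetric]
    using LIMSEQ_le_const[of _ _ "\<integral>x. rlimsup (\<lambda>N. cavg T N (h N) x) \<partial>M"] le by auto
qed

lemma AE_rlimsup_uminus:
  assumes "\<And>N x. \<bar>h N x\<bar> \<le> B" and "AE x in M. convergent (\<lambda>N. h N x)"
  shows "AE x in M. rlimsup (\<lambda>N. - h N x) = - rlimsup (\<lambda>N. h N x)"
  using assms(2)
proof eventually_elim
  case (elim x)
  then obtain l where l: "(\<lambda>N. h N x) \<longlonglongrightarrow> l" by (auto simp: convergent_def)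
  have "rlimsup (\<lambda>N. h N x) = l" using assms l by (intro rlimsup_lim[where B=B])
  moreover have "rlimsup (\<lambda>N. - h N x) = - l" using assms tendsto_minus[OF l] by (intro rlimsup_lim[where B=B]) auto
  ultimately show ?case by simp
qed

lemma (in prob_space) AE_convergent_cavg_seq:
  assumes T: "mpres M T" and h: "\<And>N. h N \<in> borel_measurable M" "\<And>N x. \<bar>h N x\<bar> \<le> B"
    and conv: "AE x in M. convergent (\<lambda>N. h N x)"
  shows "AE x in M. convergent (\<lambda>N. cavg T N (h N) x)"
proof (rule AE_convergent_integral_rlimsup)
  have [measurable]: "h N \<in> borel_measurable M" for N by fact
  show "cavg T N (h N) \<in> borel_measurable M" for N
    using h by (intro bdd_measD[OF bdd_meas_cavg[OF T]] bdd_measI)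
  show "\<bar>cavg T N (h N) x\<bar> \<le> B" for N x using h by (intro cavg_bound)
  have conv': "AE x in M. convergent (\<lambda>N. - h N x)" using conv by (simp add: convergent_minus_iff[symmetric])
  have "(\<integral>x. rlimsup (\<lambda>N. - cavg T N (h N) x) \<partial>M) \<le> (\<integral>x. rlimsup (\<lambda>N. - h N x) \<partial>M)"
    using integral_limsup_cavg_seq_le[OF T, of "\<lambda>N x. - h N x" B] h conv' by (simp add: cavg_uminus)
  also have "\<dots> = (\<integral>x. - rlimsup (\<lambda>N. h N x) \<partial>M)"
    using AE_rlimsup_uminus[OF h(2) conv] by (intro integral_cong_AE) auto
  finally show "(\<integral>x. rlimsup (\<lambda>N. cavg T N (h N) x) \<partial>M) + (\<integral>x. rlimsup (\<lambda>N. - cavg T N (h N) x) \<partial>M) \<le> 0"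
    using integral_limsup_cavg_seq_le[OF T h conv] by simp
qed

section \<open>Iterated averages over boxes\<close>

primrec mavg :: "(nat \<Rightarrow> 'a \<Rightarrow> 'a) \<Rightarrow> nat \<Rightarrow> nat \<Rightarrow> ('a \<Rightarrow> real) \<Rightarrow> 'a \<Rightarrow> real" where
  "mavg T 0 N g = g"
| "mavg T (Suc k) N g = cavg (T k) N (mavg T k N g)"

lemma bdd_meas_mavg:
  "(\<And>i. i < d \<Longrightarrow> mpres M (T i)) \<Longrightarrow> g \<in> bdd_meas M \<Longrightarrow> mavg T d N g \<in> bdd_meas M"
  by (induction d) (auto intro: bdd_meas_cavg)

lemma mavg_bound: "(\<And>x. \<bar>g x\<bar> \<le> B) \<Longrightarrow> \<bar>mavg T d N g x\<bar> \<le> B"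
  by (induction d arbitrary: x) (auto intro: cavg_bound)

lemma mavg_mono: "(\<And>x. g x \<le> h x) \<Longrightarrow> mavg T d N g x \<le> mavg T d N h x"
  by (induction d arbitrary: x) (auto intro: cavg_mono)

lemma mavg_add: "mavg T d N (\<lambda>x. g x + h x) = (\<lambda>x. mavg T d N g x + mavg T d N h x)"
  by (induction d) (auto simp: cavg_def sum.distrib add_divide_distrib)

lemma mavg_cmult: "mavg T d N (\<lambda>x. c * g x) = (\<lambda>x. c * mavg T d N g x)"
  by (induction d) (auto simp: cavg_def sum_distrib_left)

text \<open>All levels share the same N, so each level averages a function depending on N. The
  almost everywhere convergence of that function, given by induction, is just what
  \<open>AE_convergent_cavg_seq\<close> asks for.\<close>

lemma (in prob_space) AE_convergent_mavg:
  assumes "\<And>i. i < d \<Longrightarrow> mpres M (T i)" "g \<in> bdd_meas M"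
  shows "AE x in M. convergent (\<lambda>N. mavg T d N g x)"
  using assms(1)
proof (induction d)
  case 0
  then show ?case by (simp add: convergent_const)
next
  case (Suc d)
  obtain B where B: "\<And>x. \<bar>g x\<bar> \<le> B" using bdd_meas_bound[OF assms(2)] by metis
  show ?case unfolding mavg.simps
  proof (rule AE_convergent_cavg_seq)
    show "mavg T d N g \<in> borel_measurable M" for N
      using Suc.prems assms(2) by (intro bdd_measD[OF bdd_meas_mavg]) auto
    show "\<bar>mavg T d N g x\<bar> \<le> B" for N x by (intro mavg_bound B)
  qed (use Suc in auto)
qed

lemma (in prob_space) integral_mavg:
  assumes "\<And>i. i < d \<Longrightarrow> mpres M (T i)" "g \<in> bdd_meas M" "N \<ge> 1"
  shows "(\<integral>x. mavg T d N g x \<partial>M) = (\<integral>x. g x \<partial>M)"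
  using assms by (induction d) (simp_all add: integral_cavg bdd_meas_mavg)

section \<open>Measures on the Cantor space\<close>

text \<open>Gives \<open>nat => bool\<close> a countable basis, on which both the countability of
  the clopen algebra and the description of the Borel sets rest.\<close>

instance bool :: second_countable_topology
proof
  have "open = generate_topology (UNIV :: bool set set)"
    by (intro ext iffI Topological_Spaces.open_discrete generate_topology.Basis UNIV_I)
  then show "\<exists>B::bool set set. countable B \<and> open = generate_topology B"
    by (intro exI[of _ UNIV]) (auto intro: countable_finite)
qed

definition clopens :: "(nat \<Rightarrow> bool) set set" where
  "clopens = {E. open E \<and> closed E}"

lemma compact_UNIV_cantor: "compact (UNIV :: (nat \<Rightarrow> bool) set)"
proof -
  have "compactin euclidean (UNIV :: bool set)"
    by (simp add: finite_imp_compact)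
  then have "compact_space (euclidean :: bool topology)" by (simp add: compact_space_def)
  then have "compact_space (product_topology (\<lambda>_. euclidean :: bool topology) (UNIV :: nat set))"
    by (simp add: compact_space_product_topology)
  then show ?thesis by (simp add: euclidean_product_topology compact_space_def)
qed

lemma clopens_closed:
  "{} \<in> clopens" "UNIV \<in> clopens"
  "A \<in> clopens \<Longrightarrow> B \<in> clopens \<Longrightarrow> A \<inter> B \<in> clopens"
  "A \<in> clopens \<Longrightarrow> B \<in> clopens \<Longrightarrow> A \<union> B \<in> clopens"
  "A \<in> clopens \<Longrightarrow> B \<in> clopens \<Longrightarrow> A - B \<in> clopens"
  by (auto simp: clopens_def open_Diff closed_Diff)

lemma clopens_vimage:
  assumes "continuous_on UNIV f" "E \<in> clopens" shows "f -` E \<in> clopens"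
  using assms by (auto simp: clopens_def intro: open_vimage closed_vimage)

lemma clopen_coordinate: "(\<lambda>y. y n) -` X \<in> clopens"
proof -
  have c: "continuous_on UNIV (\<lambda>y :: nat \<Rightarrow> bool. y n)" by simp
  have "closed X" unfolding closed_def by (rule Topological_Spaces.open_discrete)
  then show ?thesis unfolding clopens_def
    using open_vimage[OF Topological_Spaces.open_discrete c] closed_vimage[OF _ c] by blast
qed

text \<open>A clopen set is compact, hence a finite union of members of a countable basis.\<close>

lemma countable_clopens: "countable clopens"
proof -
  obtain B :: "(nat \<Rightarrow> bool) set set" where B: "countable B" "topological_basis B"
    using ex_countable_basis by auto
  have "clopens \<subseteq> Union ` {F. finite F \<and> F \<subseteq> B}"
  proof
    fix E assume E: "E \<in> clopens"
    then have "compact E" using compact_Int_closed[OF compact_UNIV_cantor, of E] by (simp add: clopens_def)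
    obtain B' where B': "B' \<subseteq> B" "\<Union>B' = E" using B(2) E by (auto simp: topological_basis_def clopens_def)
    obtain D where "D \<subseteq> B'" "finite D" "E \<subseteq> \<Union>D"
      using compactE[OF \<open>compact E\<close>, of B'] B' B(2) by (metis order_refl subsetD topological_basis_open)
    then have "E = \<Union>D" "D \<subseteq> B" using B' by auto
    then show "E \<in> Union ` {F. finite F \<and> F \<subseteq> B}" using \<open>finite D\<close> by blast
  qed
  then show ?thesis
    by (rule countable_subset) (intro countable_image countable_Collect_finite_subset B(1))
qed

lemma clopens_borel: "E \<in> clopens \<Longrightarrow> E \<in> sets borel"
  by (simp add: clopens_def)

text \<open>Every set of bits is clopen in \<open>bool\<close>, so the basic open sets of the
  product topology are already clopen.\<close>

lemma sets_borel_cantor: "sets borel = sigma_sets UNIV clopens"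
proof
  obtain K :: "(nat \<Rightarrow> bool) set set" where K: "topological_basis K" "countable K"
    "\<forall>k\<in>K. \<exists>X. (k = Pi\<^sub>E UNIV X) \<and> (\<forall>i. open (X i)) \<and> finite {i. X i \<noteq> UNIV}"
    using product_topology_countable_basis by blast
  have "K \<subseteq> clopens"
  proof
    fix k assume k: "k \<in> K"
    then obtain X where X: "k = Pi\<^sub>E UNIV X" using K(3) by blast
    then have "k = (\<Inter>i. (\<lambda>y. y i) -` X i)" by (auto simp: PiE_def)
    moreover have "closed (\<Inter>i. (\<lambda>y :: nat \<Rightarrow> bool. y i) -` X i)"
      using clopen_coordinate by (intro closed_INT ballI) (auto simp: clopens_def)
    ultimately show "k \<in> clopens" using topological_basis_open[OF K(1) k] by (simp add: clopens_def)
  qed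
  moreover have "sets borel = sigma_sets UNIV K"
    unfolding borel_eq_countable_basis[OF K(2,1)] by (rule sets_measure_of) simp
  ultimately show "sets borel \<subseteq> sigma_sets UNIV clopens" by (simp add: sigma_sets_mono')
  show "sigma_sets UNIV clopens \<subseteq> sets borel"
    using sets.sigma_sets_subset[of clopens "borel :: (nat \<Rightarrow> bool) measure"]
    by (metis clopens_borel space_borel subsetI)
qed

lemma measure_eqI_clopens:
  assumes "finite_measure M" "finite_measure N" "sets M = sets borel" "sets N = sets borel"
    and "\<And>E. E \<in> clopens \<Longrightarrow> measure M E = measure N E"
  shows "M = N"
proof (rule measure_eqI_generator_eq[where E=clopens and A="\<lambda>_. UNIV"])
  interpret M: finite_measure M by fact
  interpret N: finite_measure N by fact
  show "Int_stable clopens" by (auto simp: Int_stable_def clopens_closed)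
  show "emeasure M X = emeasure N X" if "X \<in> clopens" for X
    using assms(5)[OF that] by (simp add: M.emeasure_eq_measure N.emeasure_eq_measure)
  show "emeasure M UNIV \<noteq> \<infinity>" by simp
qed (use assms in \<open>auto simp: sets_borel_cantor clopens_closed\<close>)

text \<open>By compactness a decreasing sequence of clopen sets with empty intersection is
  eventually empty. Finite additivity therefore already gives the continuity at the empty set that
  Caratheodory's theorem requires.\<close>

lemma clopen_content_extends:
  assumes p: "\<And>E. E \<in> clopens \<Longrightarrow> 0 \<le> p E" "p UNIV = (1::real)"
    and add: "\<And>E F. E \<in> clopens \<Longrightarrow> F \<in> clopens \<Longrightarrow> E \<inter> F = {} \<Longrightarrow> p (E \<union> F) = p E + p F"
  obtains M where "prob_space M" "sets M = sets borel" "\<And>E. E \<in> clopens \<Longrightarrow> measure M E = p E"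
proof -
  interpret ring_of_sets UNIV clopens
    by (rule ring_of_setsI) (auto simp: clopens_closed)
  have p0: "p {} = 0" using add[of "{}" "{}"] by (simp add: clopens_closed)
  have "\<exists>\<mu>. (\<forall>s\<in>clopens. \<mu> s = ennreal (p s)) \<and> measure_space UNIV (sigma_sets UNIV clopens) \<mu>"
  proof (rule caratheodory_empty_continuous)
    show "positive clopens (\<lambda>s. ennreal (p s))" by (simp add: positive_def p0)
    show "additive clopens (\<lambda>s. ennreal (p s))"
      by (auto simp: additive_def add ennreal_plus p)
    fix A :: "nat \<Rightarrow> (nat \<Rightarrow> bool) set" assume A: "range A \<subseteq> clopens" "decseq A" "(\<Inter>i. A i) = {}"
    have "\<exists>i. A i = {}"
    proof (rule ccontr)
      assume ne: "\<nexists>i. A i = {}"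
      have "UNIV \<inter> \<Inter> (range A) \<noteq> {}"
      proof (rule compact_imp_fip[OF compact_UNIV_cantor])
        show "closed T" if "T \<in> range A" for T using that A(1) by (auto simp: clopens_def)
        fix F assume F: "finite F" "F \<subseteq> range A"
        then obtain I where I: "finite I" "F = A ` I" by (meson finite_subset_image)
        have "A (Max (insert 0 I)) \<subseteq> A i" if "i \<in> I" for i
          by (rule decseqD[OF A(2) Max_ge]) (simp_all add: I that)
        then have "A (Max (insert 0 I)) \<subseteq> UNIV \<inter> \<Inter> F" unfolding I by blast
        then show "UNIV \<inter> \<Inter> F \<noteq> {}" using ne by blast
      qed
      then show False using A(3) by simp
    qed
    then obtain i where i: "A i = {}" by blast
    have "A j = {}" if "j \<ge> i" for j using decseqD[OF A(2) that] i by blast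
    then show "(\<lambda>i. ennreal (p (A i))) \<longlonglongrightarrow> 0"
      by (intro tendsto_eventually eventually_sequentiallyI[of i]) (simp add: p0)
  qed simp
  then obtain \<mu> where \<mu>: "\<And>s. s \<in> clopens \<Longrightarrow> \<mu> s = ennreal (p s)"
    "measure_space UNIV (sigma_sets UNIV clopens) \<mu>" by blast
  define M where "M = measure_of UNIV (sigma_sets UNIV clopens) \<mu>"
  have sa: "sigma_algebra UNIV (sigma_sets UNIV clopens)" by (rule sigma_algebra_sigma_sets) simp
  have em: "emeasure M E = \<mu> E" if "E \<in> sigma_sets UNIV clopens" for E
    unfolding M_def using \<mu>(2) that sa by (intro emeasure_measure_of_sigma) (auto simp: measure_space_def)
  have s: "sets M = sets borel" unfolding M_def sets_borel_cantor
    using sigma_algebra.sigma_sets_eq[OF sa] by simp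
  have pr: "prob_space M"
  proof
    have "space M = UNIV" using sets_eq_imp_space_eq[OF s] by simp
    then show "emeasure M (space M) = 1"
      using em[of UNIV] \<mu>(1)[OF clopens_closed(2)] p(2) by (simp add: sigma_sets_top)
  qed
  have "measure M E = p E" if "E \<in> clopens" for E
    using em[of E] \<mu>(1)[OF that] that p(1)[OF that] by (simp add: measure_def sigma_sets.Basic)
  with pr s show ?thesis using that by blast
qed

text \<open>Weak sequential compactness of probability measures. There are only countably many
  clopen sets, so a diagonal subsequence converges on all of them; additivity passes to the limit,
  and every such limit extends to a measure.\<close>

lemma clopen_content_compactness:
  assumes p: "\<And>L E. E \<in> clopens \<Longrightarrow> 0 \<le> p L E" "\<And>L. p L UNIV = (1::real)"
    and add: "\<And>L E F. E \<in> clopens \<Longrightarrow> F \<in> clopens \<Longrightarrow> E \<inter> F = {} \<Longrightarrow> p L (E \<union> F) = p L E + p L F"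
  obtains r M where "strict_mono (r :: nat \<Rightarrow> nat)" "prob_space M" "sets M = sets borel"
    "\<And>E. E \<in> clopens \<Longrightarrow> (\<lambda>j. p (r j) E) \<longlonglongrightarrow> measure M E"
proof -
  have "\<bar>p L E\<bar> \<le> 1" if E: "E \<in> clopens" for L E
  proof -
    have "UNIV - E \<in> clopens" using E clopens_closed by blast
    then have "p L (E \<union> (UNIV - E)) = p L E + p L (UNIV - E)" "p L (UNIV - E) \<ge> 0"
      using E by (intro add p(1); simp)+
    then show ?thesis using p(1)[OF E, of L] p(2)[of L] by simp
  qed
  then have b: "norm (p L E) \<le> 1" if "E \<in> clopens" for L E using that by simp
  obtain r where r: "strict_mono r" "\<And>E. E \<in> clopens \<Longrightarrow> \<exists>l. (\<lambda>n. p (r n) E) \<longlonglongrightarrow> l"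
    by (rule function_convergent_subsequence[OF countable_clopens, of p 1]) (simp only: b, blast)
  define q where "q = (\<lambda>E. lim (\<lambda>n. p (r n) E))"
  have q: "(\<lambda>n. p (r n) E) \<longlonglongrightarrow> q E" if "E \<in> clopens" for E
    using r(2)[OF that] by (auto simp: q_def limI)
  obtain M where "prob_space M" "sets M = sets borel" "\<And>E. E \<in> clopens \<Longrightarrow> measure M E = q E"
  proof (rule clopen_content_extends[of q])
    show "0 \<le> q E" if "E \<in> clopens" for E
      using q[OF that] p(1)[OF that] by (intro LIMSEQ_le_const) auto
    show "q UNIV = 1" using q[OF clopens_closed(2)] p(2) by (simp add: LIMSEQ_const_iff)
    fix E F assume EF: "E \<in> clopens" "F \<in> clopens" "E \<inter> F = {}"
    have "(\<lambda>n. p (r n) E + p (r n) F) \<longlonglongrightarrow> q E + q F" using EF by (intro tendsto_add q)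
    moreover have "(\<lambda>n. p (r n) E + p (r n) F) \<longlonglongrightarrow> q (E \<union> F)"
      using q[OF clopens_closed(4)[OF EF(1,2)]] add[OF EF] by simp
    ultimately show "q (E \<union> F) = q E + q F" using LIMSEQ_unique by blast
  qed blast
  then show ?thesis using that r(1) q by auto
qed

text \<open>The sets with this approximation property form a sigma-algebra: complements have the
  same symmetric difference, and a countable union is first truncated to a finite one.\<close>

lemma clopen_approx:
  assumes M: "finite_measure M" "sets M = sets borel" and A: "A \<in> sets borel" and "\<epsilon> > 0"
  shows "\<exists>E\<in>clopens. measure M ((A - E) \<union> (E - A)) < \<epsilon>"
proof -
  interpret finite_measure M by fact
  have sp: "space M = UNIV" using sets_eq_imp_space_eq[OF M(2)] by simp
  have "A \<in> sigma_sets UNIV clopens" using A by (simp add: sets_borel_cantor)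
  then have "\<forall>\<epsilon>>0. \<exists>E\<in>clopens. measure M ((A - E) \<union> (E - A)) < \<epsilon>"
  proof induction
    case (Basic a)
    then show ?case by force
  next
    case Empty
    then show ?case using clopens_closed(1) by force
  next
    case (Compl a)
    show ?case
    proof (intro allI impI)
      fix e :: real assume "e > 0"
      then obtain E where E: "E \<in> clopens" "measure M ((a - E) \<union> (E - a)) < e" using Compl.IH by blast
      have "((UNIV - a) - (UNIV - E)) \<union> ((UNIV - E) - (UNIV - a)) = (a - E) \<union> (E - a)" by auto
      then show "\<exists>E\<in>clopens. measure M (((UNIV - a) - E) \<union> (E - (UNIV - a))) < e"
        using E clopens_closed(2,5) by metis
    qed
  next
    case (Union a)
    show ?case
    proof (intro allI impI)
      fix e :: real assume "e > 0"
      have aS: "a i \<in> sets M" for i using Union.hyps M(2) by (simp add: sets_borel_cantor)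
      define U where "U = (\<lambda>n. \<Union>i<n. a i)"
      have [measurable]: "U n \<in> sets M" "a i \<in> sets M" for n i using aS by (auto simp: U_def)
      have "(\<lambda>n. measure M (U n)) \<longlonglongrightarrow> measure M (\<Union>n. U n)"
        by (rule finite_Lim_measure_incseq) (auto simp: incseq_def U_def intro: less_le_trans)
      moreover have "(\<Union>n. U n) = (\<Union>i. a i)" unfolding U_def by blast
      ultimately have "\<forall>\<^sub>F n in sequentially. measure M (U n) > measure M (\<Union>i. a i) - e/2"
        using \<open>e > 0\<close> by (intro order_tendstoD) auto
      then obtain n where n: "measure M (U n) > measure M (\<Union>i. a i) - e/2" by (auto simp: eventually_sequentially)
      have d: "measure M ((\<Union>i. a i) - U n) < e/2"
        using n by (subst finite_measure_Diff) (auto simp: U_def)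
      \<comment> \<open>The n approximations together cost at most e / 2; the added 1 keeps the
        denominator positive for n = 0.\<close>
      define e' where "e' = e / (2 * (real n + 1))"
      have "e' > 0" using \<open>e > 0\<close> by (simp add: e'_def)
      then have "\<forall>i. \<exists>E. E \<in> clopens \<and> measure M ((a i - E) \<union> (E - a i)) < e'"
        using Union.IH by blast
      then obtain E where "\<forall>i. E i \<in> clopens \<and> measure M ((a i - E i) \<union> (E i - a i)) < e'"
        by (rule choice[THEN exE])
      then have E: "\<And>i. E i \<in> clopens" "\<And>i. measure M ((a i - E i) \<union> (E i - a i)) < e'" by blast+
      define F where "F = (\<Union>i<n. E i)"
      have F: "F \<in> clopens" unfolding F_def by (induction n) (auto simp: lessThan_Suc clopens_closed E)
      have [measurable]: "E i \<in> sets M" "F \<in> sets M" for i using clopens_borel E F M(2) by auto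
      have "measure M (((\<Union>i. a i) - F) \<union> (F - (\<Union>i. a i))) \<le>
          measure M (((\<Union>i. a i) - U n) \<union> (\<Union>i<n. (a i - E i) \<union> (E i - a i)))"
        by (intro finite_measure_mono) (auto simp: U_def F_def)
      also have "\<dots> \<le> measure M ((\<Union>i. a i) - U n) + measure M (\<Union>i<n. (a i - E i) \<union> (E i - a i))"
        by (intro measure_Un_le) auto
      also have "measure M (\<Union>i<n. (a i - E i) \<union> (E i - a i)) \<le> (\<Sum>i<n. measure M ((a i - E i) \<union> (E i - a i)))"
        by (intro measure_UNION_le) auto
      also have "\<dots> \<le> (\<Sum>i<n. e')" using E(2) by (intro sum_mono less_imp_le) auto
      also have "(\<Sum>i<n. e') \<le> e/2" using \<open>e > 0\<close> by (simp add: e'_def field_simps)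
      finally have "measure M (((\<Union>i. a i) - F) \<union> (F - (\<Union>i. a i))) < e" using d by linarith
      then show "\<exists>E\<in>clopens. measure M (((\<Union>i. a i) - E) \<union> (E - (\<Union>i. a i))) < e" using F by blast
    qed
  qed
  then show ?thesis using \<open>\<epsilon> > 0\<close> by blast
qed

section \<open>Random times and conditional expectations\<close>

text \<open>Since \<open>\<nu> L x \<ge> L\<close>, the random index tends to infinity at every
  point, and the value there tends to the limit wherever one exists.\<close>

lemma (in prob_space) random_index_limit:
  assumes a: "\<And>N. a N \<in> borel_measurable M" "\<And>N x. \<bar>a N x\<bar> \<le> (B::real)"
    and conv: "AE x in M. convergent (\<lambda>N. a N x)"
    and \<nu>: "\<And>L. \<nu> L \<in> measurable M (count_space UNIV)" "\<And>L x. \<nu> L x \<ge> L"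
  shows "(\<lambda>L. \<integral>x. a (\<nu> L x) x \<partial>M) \<longlonglongrightarrow> (\<integral>x. rlimsup (\<lambda>N. a N x) \<partial>M)"
proof -
  have [measurable]: "a N \<in> borel_measurable M" "\<nu> N \<in> measurable M (count_space UNIV)" for N by fact+
  show ?thesis
  proof (rule integral_dominated_convergence[where w="\<lambda>_. B"])
    show "(\<lambda>x. a (\<nu> L x) x) \<in> borel_measurable M" for L
      by (rule measurable_compose_countable[where g="\<nu> L"]) auto
    show "AE x in M. (\<lambda>L. a (\<nu> L x) x) \<longlonglongrightarrow> rlimsup (\<lambda>N. a N x)"
      using conv
    proof eventually_elim
      case (elim x)
      then obtain l where l: "(\<lambda>N. a N x) \<longlonglongrightarrow> l" by (auto simp: convergent_def)
      then have "rlimsup (\<lambda>N. a N x) = l" using a by (intro rlimsup_lim)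
      moreover have "filterlim (\<lambda>L. \<nu> L x) at_top sequentially"
        using \<nu>(2) by (intro filterlim_at_top_mono[OF filterlim_ident]) auto
      ultimately show ?case using filterlim_compose[OF l] by blast
    qed
  qed (use a in auto)
qed

text \<open>For a single L the integral at the random index need not be c. Comparison with the
  constant index L shows that the limit function has integral c, and the random index leads to the
  same function.\<close>

lemma (in prob_space) integral_random_index:
  assumes a: "\<And>N. a N \<in> borel_measurable M" "\<And>N x. \<bar>a N x\<bar> \<le> (B::real)"
    and conv: "AE x in M. convergent (\<lambda>N. a N x)"
    and c: "\<And>N. N \<ge> 1 \<Longrightarrow> (\<integral>x. a N x \<partial>M) = c"
    and \<nu>: "\<And>L. \<nu> L \<in> measurable M (count_space UNIV)" "\<And>L x. \<nu> L x \<ge> L"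
  shows "(\<lambda>L. \<integral>x. a (\<nu> L x) x \<partial>M) \<longlonglongrightarrow> c"
proof -
  have "(\<lambda>N. \<integral>x. a N x \<partial>M) \<longlonglongrightarrow> (\<integral>x. rlimsup (\<lambda>N. a N x) \<partial>M)"
    using random_index_limit[OF a conv, of "\<lambda>L x. L"] by simp
  moreover have "(\<lambda>N. \<integral>x. a N x \<partial>M) \<longlonglongrightarrow> c"
    using c by (intro tendsto_eventually eventually_sequentiallyI[of 1])
  ultimately have "(\<integral>x. rlimsup (\<lambda>N. a N x) \<partial>M) = c" by (rule LIMSEQ_unique)
  then show ?thesis using random_index_limit[OF a conv \<nu>] by simp
qed

lemma limsup_selector:
  assumes [measurable]: "\<And>N. a N \<in> borel_measurable M" and b: "\<And>N x. \<bar>a N x\<bar> \<le> (B::real)" and "\<epsilon> > 0"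
  obtains \<nu> where "\<And>L. \<nu> L \<in> measurable M (count_space UNIV)" "\<And>L x. \<nu> L x \<ge> L" "\<And>L x. \<nu> L x \<ge> 1"
    "\<And>L x. a (\<nu> L x) x > rlimsup (\<lambda>N. a N x) - \<epsilon>"
proof -
  \<comment> \<open>The maximum with 1 makes the index positive, so that an average over this many
    terms is a genuine mean.\<close>
  define P where "P = (\<lambda>L n x. n \<ge> max 1 L \<and> a n x > rlimsup (\<lambda>N. a N x) - \<epsilon>)"
  define \<nu> where "\<nu> = (\<lambda>L x. LEAST n. P L n x)"
  have "\<exists>n. P L n x" for L x unfolding P_def
    using rlimsup_frequently[of "\<lambda>N. a N x" B \<epsilon> "max 1 L"] b \<open>\<epsilon> > 0\<close> by blast
  then have P: "P L (\<nu> L x) x" for L x unfolding \<nu>_def by (rule LeastI_ex)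
  show ?thesis
  proof (rule that[of \<nu>])
    show "\<nu> L \<in> measurable M (count_space UNIV)" for L unfolding \<nu>_def P_def by measurable
  qed (use P in \<open>auto simp: P_def\<close>)
qed

text \<open>Says that s \<circ> \<pi> is a version of the conditional expectation of G given \<pi>.
  The relation is tested against bounded functions on the factor, which avoids sub-sigma-algebras
  and makes linearity and shifts easy to verify.\<close>

definition condexp :: "'b measure \<Rightarrow> 'a measure \<Rightarrow> ('b \<Rightarrow> 'a) \<Rightarrow> ('b \<Rightarrow> real) \<Rightarrow> ('a \<Rightarrow> real) \<Rightarrow> bool" where
  "condexp N M \<pi> G s \<longleftrightarrow> G \<in> bdd_meas N \<and> s \<in> bdd_meas M \<and>
     (\<forall>\<phi>\<in>bdd_meas M. (\<integral>y. \<phi> (\<pi> y) * G y \<partial>N) = (\<integral>x. \<phi> x * s x \<partial>M))"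

text \<open>Adding 1 makes G the density of a positive measure that is at most twice N. Its image
  under \<pi> is then at most twice M and has a Radon-Nikodym density between 0 and 2; subtracting 1
  gives s.\<close>

lemma condexp_exists:
  assumes "prob_space M" "prob_space N" and \<pi>: "\<pi> \<in> measurable N M" "distr N M \<pi> = M"
    and G: "G \<in> bdd_meas N" "\<And>y. \<bar>G y\<bar> \<le> 1"
  obtains s where "condexp N M \<pi> G s" "\<And>x. \<bar>s x\<bar> \<le> 1"
proof -
  interpret M: prob_space M by fact
  interpret N: prob_space N by fact
  have [measurable]: "G \<in> borel_measurable N" "\<pi> \<in> measurable N M" using G \<pi> bdd_measD by auto
  have G1: "0 \<le> G y + 1" "G y + 1 \<le> 2" for y using G(2)[of y] by linarith+
  define R where "R = distr (density N (\<lambda>y. ennreal (G y + 1))) M \<pi>"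
  have sR: "sets R = sets M" "space R = space M" by (auto simp: R_def)
  have R: "emeasure R A = (\<integral>\<^sup>+y. ennreal (G y + 1) * indicator A (\<pi> y) \<partial>N)" if [measurable]: "A \<in> sets M" for A
  proof -
    have "emeasure R A = emeasure (density N (\<lambda>y. ennreal (G y + 1))) (\<pi> -` A \<inter> space N)"
      unfolding R_def by (subst emeasure_distr) auto
    also have "\<dots> = (\<integral>\<^sup>+y. ennreal (G y + 1) * indicator (\<pi> -` A \<inter> space N) y \<partial>N)"
      by (intro emeasure_density) auto
    also have "\<dots> = (\<integral>\<^sup>+y. ennreal (G y + 1) * indicator A (\<pi> y) \<partial>N)"
      by (intro nn_integral_cong) (auto simp: indicator_def)
    finally show ?thesis .
  qed
  have MA: "emeasure M A = (\<integral>\<^sup>+y. indicator A (\<pi> y) \<partial>N)" if [measurable]: "A \<in> sets M" for A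
  proof -
    have "emeasure M A = emeasure N (\<pi> -` A \<inter> space N)"
      by (subst \<pi>(2)[symmetric]) (auto intro: emeasure_distr)
    also have "\<dots> = (\<integral>\<^sup>+y. indicator (\<pi> -` A \<inter> space N) y \<partial>N)" by simp
    also have "\<dots> = (\<integral>\<^sup>+y. indicator A (\<pi> y) \<partial>N)"
      by (intro nn_integral_cong) (auto simp: indicator_def)
    finally show ?thesis .
  qed
  have R2: "emeasure R A \<le> 2 * emeasure M A" if [measurable]: "A \<in> sets M" for A
  proof -
    have "(\<integral>\<^sup>+y. ennreal (G y + 1) * indicator A (\<pi> y) \<partial>N) \<le> (\<integral>\<^sup>+y. 2 * indicator A (\<pi> y) \<partial>N)"
      using G1 by (intro nn_integral_mono mult_right_mono) (auto simp: ennreal_leI simp flip: ennreal_numeral)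
    then show ?thesis using R[OF that] MA[OF that] by (simp add: nn_integral_cmult)
  qed
  have "absolutely_continuous M R" unfolding absolutely_continuous_def
  proof
    fix A assume "A \<in> null_sets M"
    then have A: "A \<in> sets M" "emeasure M A = 0" by auto
    then have "emeasure R A \<le> 0" using R2[OF A(1)] by simp
    then show "A \<in> null_sets R" using A sR by auto
  qed
  then obtain h where h[measurable]: "h \<in> borel_measurable M" and hR: "density M h = R"
    using M.Radon_Nikodym[of R] sR by auto
  have hle: "AE x in M. h x < ennreal c" if c: "c > 2" for c :: real
  proof -
    define A where "A = {x \<in> space M. ennreal c \<le> h x}"
    have [measurable]: "A \<in> sets M" unfolding A_def by measurable
    have "ennreal c * emeasure M A = (\<integral>\<^sup>+x. ennreal c * indicator A x \<partial>M)" by (simp add: nn_integral_cmult)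
    also have "\<dots> \<le> (\<integral>\<^sup>+x. h x * indicator A x \<partial>M)"
      by (intro nn_integral_mono) (auto simp: A_def indicator_def)
    also have "\<dots> = emeasure R A" by (subst hR[symmetric]) (simp add: emeasure_density)
    also have "\<dots> \<le> 2 * emeasure M A" by (rule R2) simp
    finally have "ennreal (c * measure M A) \<le> ennreal (2 * measure M A)"
      using c by (simp add: M.emeasure_eq_measure ennreal_mult)
    then have "c * measure M A \<le> 2 * measure M A" by (simp add: ennreal_le_iff)
    then have "(c - 2) * measure M A \<le> 0" by (simp add: algebra_simps)
    then have "measure M A = 0" using c measure_nonneg[of M A] by (simp add: mult_le_0_iff)
    then have "A \<in> null_sets M" by (simp add: M.emeasure_eq_measure null_setsI)
    then have "AE x in M. x \<notin> A" by (rule AE_not_in)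
    then show ?thesis using AE_space by eventually_elim (auto simp: A_def not_le)
  qed
  \<comment> \<open>The argument for \<open>hle\<close> divides by c - 2 and needs c > 2; the bound
    2 itself is reached through countably many such c.\<close>
  have "AE x in M. \<forall>n::nat. h x < ennreal (2 + inverse (real (Suc n)))"
    unfolding AE_all_countable by (intro allI hle) simp
  then have h2: "AE x in M. h x \<le> 2"
  proof eventually_elim
    case (elim x)
    have "h x < top" using elim[rule_format, of 0] by (rule less_trans) simp
    then obtain r where r: "h x = ennreal r" "r \<ge> 0" by (cases "h x") auto
    have "r \<le> 2 + inverse (real (Suc n))" for n
      using elim[rule_format, of n] unfolding r(1) ennreal_less_iff[OF r(2)] by (rule less_imp_le)
    moreover have "(\<lambda>n. 2 + inverse (real (Suc n))) \<longlonglongrightarrow> 2 + 0"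
      by (intro tendsto_intros LIMSEQ_inverse_real_of_nat)
    ultimately have "r \<le> 2" using LIMSEQ_le_const by fastforce
    then show ?case using r by (simp add: ennreal_le_iff flip: ennreal_numeral)
  qed
  \<comment> \<open>Truncation changes h only on a null set and yields a bound at every point, so
    that \<open>s\<close> is bounded by 1 everywhere.\<close>
  define h' where "h' = (\<lambda>x. min 2 (enn2real (h x)))"
  have [measurable]: "h' \<in> borel_measurable M" unfolding h'_def by measurable
  have h'b: "0 \<le> h' x" "h' x \<le> 2" for x by (auto simp: h'_def)
  have "AE x in M. h x = ennreal (h' x)"
    using h2
  proof eventually_elim
    case (elim x)
    then have "h x < top" by (rule le_less_trans) simp
    then obtain r where r: "h x = ennreal r" "r \<ge> 0" by (cases "h x") auto
    then have "r \<le> 2" using elim by (simp add: ennreal_le_iff flip: ennreal_numeral)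
    then show ?case using r by (simp add: h'_def)
  qed
  then have hR': "density M (\<lambda>x. ennreal (h' x)) = R"
    unfolding hR[symmetric] by (intro density_cong) auto
  define s where "s = (\<lambda>x. h' x - 1)"
  have sB: "\<bar>s x\<bar> \<le> 1" for x using h'b[of x] unfolding s_def by linarith
  have "condexp N M \<pi> G s"
    unfolding condexp_def
  proof (intro conjI ballI)
    show "s \<in> bdd_meas M" using sB by (intro bdd_measI[where B=1]) (simp_all add: s_def)
    fix \<phi> assume \<phi>: "\<phi> \<in> bdd_meas M"
    have [measurable]: "\<phi> \<in> borel_measurable M" using \<phi> bdd_measD by auto
    have \<phi>\<pi>: "(\<lambda>y. \<phi> (\<pi> y)) \<in> bdd_meas N" by (rule bdd_meas_comp[OF \<phi> \<pi>(1)])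
    have hb: "h' \<in> bdd_meas M" using h'b by (intro bdd_measI[where B=2]) auto
    have i: "integrable N (\<lambda>y. \<phi> (\<pi> y) * G y)" "integrable N (\<lambda>y. \<phi> (\<pi> y))"
      "integrable M (\<lambda>x. \<phi> x * h' x)" "integrable M \<phi>"
      by (intro N.integrable_bdd_meas M.integrable_bdd_meas bdd_meas_mult \<phi> \<phi>\<pi> G(1) hb)+
    have "(\<integral>y. \<phi> (\<pi> y) * G y \<partial>N) + (\<integral>y. \<phi> (\<pi> y) \<partial>N) = (\<integral>y. (G y + 1) *\<^sub>R \<phi> (\<pi> y) \<partial>N)"
      using i by (simp add: algebra_simps flip: Bochner_Integration.integral_add)
    also have "\<dots> = (\<integral>y. \<phi> (\<pi> y) \<partial>density N (\<lambda>y. ennreal (G y + 1)))"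
      using G1 by (subst integral_density) auto
    also have "\<dots> = (\<integral>x. \<phi> x \<partial>R)" unfolding R_def by (subst integral_distr) auto
    also have "\<dots> = (\<integral>x. h' x *\<^sub>R \<phi> x \<partial>M)" unfolding hR'[symmetric]
      using h'b by (subst integral_density) auto
    also have "\<dots> = (\<integral>x. \<phi> x * s x \<partial>M) + (\<integral>x. \<phi> x \<partial>M)"
      using i by (simp add: s_def algebra_simps)
    also have "(\<integral>x. \<phi> x \<partial>M) = (\<integral>y. \<phi> (\<pi> y) \<partial>N)"
      using integral_distr[OF \<pi>(1), of \<phi>] \<pi>(2) by simp
    finally show "(\<integral>y. \<phi> (\<pi> y) * G y \<partial>N) = (\<integral>x. \<phi> x * s x \<partial>M)" by simp
  qed (rule G)
  then show ?thesis using sB that by blast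
qed

lemma condexpD:
  assumes "condexp N M \<pi> G s"
  shows "G \<in> bdd_meas N" "s \<in> bdd_meas M" "\<phi> \<in> bdd_meas M \<Longrightarrow> (\<integral>y. \<phi> (\<pi> y) * G y \<partial>N) = (\<integral>x. \<phi> x * s x \<partial>M)"
  using assms by (auto simp: condexp_def)

lemma condexp_sum:
  assumes "finite_measure N" "finite_measure M" "\<And>i. i \<in> I \<Longrightarrow> condexp N M \<pi> (G i) (s i)"
    and \<pi>: "\<pi> \<in> measurable N M"
  shows "condexp N M \<pi> (\<lambda>y. \<Sum>i\<in>I. G i y) (\<lambda>x. \<Sum>i\<in>I. s i x)"
  unfolding condexp_def
proof (intro conjI ballI bdd_meas_sum)
  interpret N: finite_measure N by fact
  interpret M: finite_measure M by fact
  note c = condexpD[OF assms(3)]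
  show "G i \<in> bdd_meas N" "s i \<in> bdd_meas M" if "i \<in> I" for i using c[OF that] by auto
  fix \<phi> assume \<phi>: "\<phi> \<in> bdd_meas M"
  have i: "integrable N (\<lambda>y. \<phi> (\<pi> y) * G i y)" "integrable M (\<lambda>x. \<phi> x * s i x)" if "i \<in> I" for i
    by (intro N.integrable_bdd_meas M.integrable_bdd_meas bdd_meas_mult \<phi> c[OF that] bdd_meas_comp[OF \<phi> \<pi>])+
  have "(\<integral>y. \<phi> (\<pi> y) * (\<Sum>i\<in>I. G i y) \<partial>N) = (\<Sum>i\<in>I. \<integral>y. \<phi> (\<pi> y) * G i y \<partial>N)"
    unfolding sum_distrib_left using i by (intro Bochner_Integration.integral_sum)
  also have "\<dots> = (\<Sum>i\<in>I. \<integral>x. \<phi> x * s i x \<partial>M)" using c(3)[OF _ \<phi>] by (intro sum.cong) auto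
  also have "\<dots> = (\<integral>x. \<phi> x * (\<Sum>i\<in>I. s i x) \<partial>M)"
    unfolding sum_distrib_left using i by (intro Bochner_Integration.integral_sum[symmetric])
  finally show "(\<integral>y. \<phi> (\<pi> y) * (\<Sum>i\<in>I. G i y) \<partial>N) = (\<integral>x. \<phi> x * (\<Sum>i\<in>I. s i x) \<partial>M)" .
qed

lemma condexp_mult:
  assumes "condexp N M \<pi> G s" "\<psi> \<in> bdd_meas M" "\<pi> \<in> measurable N M"
  shows "condexp N M \<pi> (\<lambda>y. \<psi> (\<pi> y) * G y) (\<lambda>x. \<psi> x * s x)"
  unfolding condexp_def
proof (intro conjI ballI bdd_meas_mult)
  note c = condexpD[OF assms(1)]
  show "G \<in> bdd_meas N" "s \<in> bdd_meas M" "\<psi> \<in> bdd_meas M" by (fact c assms)+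
  show "(\<lambda>y. \<psi> (\<pi> y)) \<in> bdd_meas N" by (rule bdd_meas_comp[OF assms(2,3)])
  fix \<phi> assume \<phi>: "\<phi> \<in> bdd_meas M"
  show "(\<integral>y. \<phi> (\<pi> y) * (\<psi> (\<pi> y) * G y) \<partial>N) = (\<integral>x. \<phi> x * (\<psi> x * s x) \<partial>M)"
    using c(3)[OF bdd_meas_mult[OF \<phi> assms(2)]] by (simp add: mult.assoc)
qed

lemma condexp_divide:
  assumes "condexp N M \<pi> G s" "\<pi> \<in> measurable N M"
  shows "condexp N M \<pi> (\<lambda>y. G y / c) (\<lambda>x. s x / c)"
  using condexp_mult[OF assms(1) bdd_meas_const[of "1/c"] assms(2)] by simp

text \<open>This fails for noninvertible \<^term>\<open>T\<close>: the test function has to be composed with the inverse of \<^term>\<open>T\<close>.\<close>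

lemma condexp_shift:
  assumes c: "condexp N M \<pi> G s" and S: "mpres N S" and T: "mpres M T"
    and inv: "T' \<in> measurable M M" "\<And>x. T' (T x) = x"
    and eq: "\<And>y. \<pi> (S y) = T (\<pi> y)" and \<pi>: "\<pi> \<in> measurable N M"
  shows "condexp N M \<pi> (\<lambda>y. G (S y)) (\<lambda>x. s (T x))"
  unfolding condexp_def
proof (intro conjI ballI)
  note c = condexpD[OF c]
  show "(\<lambda>y. G (S y)) \<in> bdd_meas N" "(\<lambda>x. s (T x)) \<in> bdd_meas M"
    by (intro bdd_meas_comp[OF c(1)] bdd_meas_comp[OF c(2)] mpres_measurable S T)+
  fix \<phi> assume \<phi>: "\<phi> \<in> bdd_meas M"
  have \<phi>': "(\<lambda>x. \<phi> (T' x)) \<in> bdd_meas M" by (rule bdd_meas_comp[OF \<phi> inv(1)])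
  have "(\<integral>y. \<phi> (\<pi> y) * G (S y) \<partial>N) = (\<integral>y. \<phi> (T' (\<pi> (S y))) * G (S y) \<partial>N)"
    by (simp add: eq inv)
  also have "\<dots> = (\<integral>y. \<phi> (T' (\<pi> y)) * G y \<partial>N)"
    by (rule mpres_integral[OF S, where f="\<lambda>y. \<phi> (T' (\<pi> y)) * G y"])
      (intro bdd_measD[OF bdd_meas_mult] bdd_meas_comp[OF \<phi>' \<pi>] c)
  also have "\<dots> = (\<integral>x. \<phi> (T' x) * s x \<partial>M)" by (rule c(3)[OF \<phi>'])
  also have "\<dots> = (\<integral>x. \<phi> (T' (T x)) * s (T x) \<partial>M)"
    by (rule mpres_integral[OF T, where f="\<lambda>x. \<phi> (T' x) * s x", symmetric])
      (intro bdd_measD[OF bdd_meas_mult] \<phi>' c)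
  finally show "(\<integral>y. \<phi> (\<pi> y) * G (S y) \<partial>N) = (\<integral>x. \<phi> x * s (T x) \<partial>M)" by (simp add: inv)
qed

text \<open>An index \<open>\<nu>\<close> chosen on M so that \<open>a\<close> is near its limsup
  becomes a function of \<pi> when lifted to N. It can therefore be taken through the conditional
  expectation: the integrals of \<open>a\<close> at \<open>\<nu>\<close> and of \<open>b\<close> at
  \<open>\<nu> \<circ> \<pi>\<close> agree. Convergence of \<open>b\<close> then makes the second
  integral approach that of its limit.\<close>

lemma condexp_limsup_le:
  assumes "prob_space M" "prob_space N" and \<pi>[measurable]: "\<pi> \<in> measurable N M"
    and c: "\<And>n. condexp N M \<pi> (b n) (a n)"
    and bB: "\<And>n y. \<bar>b n y\<bar> \<le> B" and aB: "\<And>n x. \<bar>a n x\<bar> \<le> B"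
    and conv: "AE y in N. convergent (\<lambda>n. b n y)"
  shows "(\<integral>x. rlimsup (\<lambda>n. a n x) \<partial>M) \<le> (\<integral>y. rlimsup (\<lambda>n. b n y) \<partial>N)"
proof (rule field_le_epsilon)
  interpret M: prob_space M by fact
  interpret N: prob_space N by fact
  have [measurable]: "a n \<in> borel_measurable M" "b n \<in> borel_measurable N" for n
    using condexpD[OF c[of n]] bdd_measD by auto
  fix e :: real assume "e > 0"
  obtain \<nu> where \<nu>: "\<And>L. \<nu> L \<in> measurable M (count_space UNIV)" "\<And>L x. \<nu> L x \<ge> L"
    "\<And>L x. a (\<nu> L x) x > rlimsup (\<lambda>N. a N x) - e"
    by (rule limsup_selector[where a=a and M=M, OF _ aB \<open>e > 0\<close>]) (measurable, blast)
  note [measurable] = \<nu>(1)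
  have am[measurable]: "(\<lambda>x. a (\<nu> L x) x) \<in> borel_measurable M" for L
    by (rule measurable_compose_countable[where g="\<nu> L"]) auto
  have bm[measurable]: "(\<lambda>y. b (\<nu> L (\<pi> y)) y) \<in> borel_measurable N" for L
    by (rule measurable_compose_countable[where g="\<lambda>y. \<nu> L (\<pi> y)"]) auto
  have eq: "(\<integral>x. a (\<nu> L x) x \<partial>M) = (\<integral>y. b (\<nu> L (\<pi> y)) y \<partial>N)" for L
  proof -
    \<comment> \<open>The space is split by the value of \<open>\<nu> L\<close>. Finitely many
      values are covered by linearity and the pull-out rule; dominated convergence covers all of
      them, since a partial sum is either a single term or 0.\<close>
    define I where "I = (\<lambda>n x. indicator {x \<in> space M. \<nu> L x = n} x :: real)"
    have Ib: "I n \<in> bdd_meas M" for n unfolding I_def by (intro bdd_meas_indicator) measurable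
    have [measurable]: "I n \<in> borel_measurable M" for n using bdd_measD[OF Ib] .
    have sel: "(\<Sum>n<K. I n x * w n) = (if \<nu> L x < K then w (\<nu> L x) else 0)" if "x \<in> space M" for K x and w :: "nat \<Rightarrow> real"
    proof -
      have "(\<Sum>n<K. I n x * w n) = (\<Sum>n<K. if n = \<nu> L x then w n else 0)"
        using that by (intro sum.cong) (auto simp: I_def)
      then show ?thesis by simp
    qed
    have lim: "(\<lambda>K. if m < K then v else 0) \<longlonglongrightarrow> v" for m :: nat and v :: real
      by (intro tendsto_eventually eventually_sequentiallyI[of "Suc m"]) auto
    have B0: "B \<ge> 0" using aB[of 0 undefined] by linarith
    have "condexp N M \<pi> (\<lambda>y. \<Sum>n<K. I n (\<pi> y) * b n y) (\<lambda>x. \<Sum>n<K. I n x * a n x)" for K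
      using Ib by (intro condexp_sum condexp_mult c \<pi> M.finite_measure_axioms N.finite_measure_axioms)
    from condexpD(3)[OF this, of "\<lambda>_. 1"]
    have "(\<integral>x. (\<Sum>n<K. I n x * a n x) \<partial>M) = (\<integral>y. (\<Sum>n<K. I n (\<pi> y) * b n y) \<partial>N)" for K by simp
    moreover have "(\<lambda>K. \<integral>x. (\<Sum>n<K. I n x * a n x) \<partial>M) \<longlonglongrightarrow> (\<integral>x. a (\<nu> L x) x \<partial>M)"
      using B0 aB by (intro integral_dominated_convergence[where w="\<lambda>_. B"]) (auto simp: sel lim)
    moreover have "(\<lambda>K. \<integral>y. (\<Sum>n<K. I n (\<pi> y) * b n y) \<partial>N) \<longlonglongrightarrow> (\<integral>y. b (\<nu> L (\<pi> y)) y \<partial>N)"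
      using B0 bB measurable_space[OF \<pi>]
      by (intro integral_dominated_convergence[where w="\<lambda>_. B"]) (auto simp: sel lim)
    ultimately show ?thesis using LIMSEQ_unique by auto
  qed
  have "(\<lambda>L. \<integral>y. b (\<nu> L (\<pi> y)) y \<partial>N) \<longlonglongrightarrow> (\<integral>y. rlimsup (\<lambda>n. b n y) \<partial>N)"
    using \<nu>(2) by (intro N.random_index_limit[where B=B and \<nu>="\<lambda>L y. \<nu> L (\<pi> y)"] bB conv) auto
  then have lim: "(\<lambda>L. (\<integral>y. b (\<nu> L (\<pi> y)) y \<partial>N) + e) \<longlonglongrightarrow> (\<integral>y. rlimsup (\<lambda>n. b n y) \<partial>N) + e"
    by (intro tendsto_intros)
  have "(\<integral>x. rlimsup (\<lambda>n. a n x) \<partial>M) \<le> (\<integral>y. b (\<nu> L (\<pi> y)) y \<partial>N) + e" for L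
  proof -
    have i: "integrable M (\<lambda>x. rlimsup (\<lambda>n. a n x))" "integrable M (\<lambda>x. a (\<nu> L x) x)"
      by (rule M.integrable_bdd_meas, rule bdd_measI[where B=B], measurable, (rule rlimsup_ereal(2) aB)+)+
    have "(\<integral>x. rlimsup (\<lambda>n. a n x) \<partial>M) \<le> (\<integral>x. a (\<nu> L x) x + e \<partial>M)"
      using i \<nu>(3)[of _ L] by (intro integral_mono) (auto simp: less_diff_eq diff_less_eq intro: less_imp_le)
    also have "\<dots> = (\<integral>x. a (\<nu> L x) x \<partial>M) + e" using i by (simp add: M.prob_space)
    finally show ?thesis by (simp add: eq)
  qed
  then show "(\<integral>x. rlimsup (\<lambda>n. a n x) \<partial>M) \<le> (\<integral>y. rlimsup (\<lambda>n. b n y) \<partial>N) + e"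
    using LIMSEQ_le_const[OF lim] by blast
qed

text \<open>For convergent \<open>b\<close> the limsups of \<open>b\<close> and \<open>- b\<close>
  cancel, so the bounds for \<open>a\<close> and \<open>- a\<close> add up to at most 0. Convergence
  is thereby carried from an extension down to its factor.\<close>

lemma condexp_AE_convergent:
  assumes MN: "prob_space M" "prob_space N" and \<pi>: "\<pi> \<in> measurable N M"
    and c: "\<And>n. condexp N M \<pi> (b n) (a n)"
    and bB: "\<And>n y. \<bar>b n y\<bar> \<le> B" and aB: "\<And>n x. \<bar>a n x\<bar> \<le> B"
    and conv: "AE y in N. convergent (\<lambda>n. b n y)"
  shows "AE x in M. convergent (\<lambda>n. a n x)"
proof -
  interpret M: prob_space M by fact
  have [measurable]: "a n \<in> borel_measurable M" "b n \<in> borel_measurable N" for n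
    using condexpD[OF c[of n]] bdd_measD by auto
  have c': "condexp N M \<pi> (\<lambda>y. - b n y) (\<lambda>x. - a n x)" for n
    using condexp_divide[OF c[of n] \<pi>, of "-1"] by simp
  have conv': "AE y in N. convergent (\<lambda>n. - b n y)" using conv by (simp add: convergent_minus_iff[symmetric])
  show ?thesis
  proof (rule M.AE_convergent_integral_rlimsup[OF _ aB])
    have "(\<integral>x. rlimsup (\<lambda>n. - a n x) \<partial>M) \<le> (\<integral>y. rlimsup (\<lambda>n. - b n y) \<partial>N)"
      using condexp_limsup_le[OF MN \<pi> c' _ _ conv', of B] aB bB by simp
    also have "\<dots> = (\<integral>y. - rlimsup (\<lambda>n. b n y) \<partial>N)"
      using AE_rlimsup_uminus[OF bB conv] by (intro integral_cong_AE) auto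
    finally show "(\<integral>x. rlimsup (\<lambda>n. a n x) \<partial>M) + (\<integral>x. rlimsup (\<lambda>n. - a n x) \<partial>M) \<le> 0"
      using condexp_limsup_le[OF MN \<pi> c bB aB conv] by simp
  qed simp
qed

text \<open>First f is rounded down to multiples of 1/n, with uniform error 1/n. Then the finitely
  many level sets are replaced by clopen sets, at an L^1 cost weighted by the values
  \<open>c j\<close>.\<close>

lemma clopen_step_dense:
  assumes M: "prob_space M" "sets M = sets borel" and f: "f \<in> bdd_meas M" and "e > 0"
  obtains I :: "int set" and c E where "finite I" "\<And>j. j \<in> I \<Longrightarrow> E j \<in> clopens"
    "(\<integral>x. \<bar>f x - (\<Sum>j\<in>I. c j * indicator (E j) x)\<bar> \<partial>M) < e"
proof -
  interpret prob_space M by fact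
  have [measurable]: "f \<in> borel_measurable M" using f bdd_measD by auto
  obtain B where B: "B \<ge> 0" "\<And>x. \<bar>f x\<bar> \<le> B" using bdd_meas_bound[OF f] by metis
  obtain n :: nat where n: "n > 0" "inverse (real n) < e / 2"
    using reals_Archimedean2[of "2 / e"] \<open>e > 0\<close> by (metis ex_inverse_of_nat_less half_gt_zero)
  define I where "I = {- \<lceil>real n * B\<rceil> - 1 .. \<lceil>real n * B\<rceil>}"
  define c where "c = (\<lambda>j::int. real_of_int j / real n)"
  define A where "A = (\<lambda>j. {x \<in> space M. \<lfloor>real n * f x\<rfloor> = j})"
  have [measurable]: "A j \<in> sets M" for j unfolding A_def by measurable
  define g where "g = (\<lambda>x. \<Sum>j\<in>I. c j * indicator (A j) x)"
  have fin: "finite I" by (simp add: I_def)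
  have fg: "\<bar>f x - g x\<bar> \<le> inverse (real n)" if x: "x \<in> space M" for x
  proof -
    have "- (real n * B) \<le> real n * f x" "real n * f x \<le> real n * B"
      using B(2)[of x] n mult_left_mono[of "- B" "f x" "real n"] mult_left_mono[of "f x" B "real n"]
      by (auto simp: abs_le_iff minus_le_iff)
    then have "\<lfloor>real n * f x\<rfloor> \<in> I" unfolding I_def by (auto; linarith)
    moreover have "g x = (\<Sum>j\<in>I. if j = \<lfloor>real n * f x\<rfloor> then c j else 0)"
      unfolding g_def using x by (intro sum.cong) (auto simp: A_def)
    ultimately have "g x = c \<lfloor>real n * f x\<rfloor>" using fin by simp
    then have "f x - g x = (real n * f x - real_of_int \<lfloor>real n * f x\<rfloor>) / real n"
      using n by (simp add: c_def diff_divide_distrib)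
    moreover have "0 \<le> real n * f x - real_of_int \<lfloor>real n * f x\<rfloor>" "real n * f x - real_of_int \<lfloor>real n * f x\<rfloor> \<le> 1"
      by linarith+
    ultimately show ?thesis using n by (simp only: inverse_eq_divide abs_divide abs_of_nat abs_of_nonneg) (intro divide_right_mono, auto)
  qed
  \<comment> \<open>Chosen so that the weighted sum of the errors is at most e / 2; the added 1
    keeps the denominator positive.\<close>
  define \<eta> where "\<eta> = e / (2 * (1 + (\<Sum>j\<in>I. \<bar>c j\<bar>)))"
  have s0: "0 \<le> (\<Sum>j\<in>I. \<bar>c j\<bar>)" by (intro sum_nonneg) auto
  then have s1: "0 < 1 + (\<Sum>j\<in>I. \<bar>c j\<bar>)" by linarith
  then have "\<eta> > 0" using \<open>e > 0\<close> unfolding \<eta>_def by (intro divide_pos_pos mult_pos_pos) auto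
  have "\<forall>j. \<exists>E. E \<in> clopens \<and> measure M ((A j - E) \<union> (E - A j)) < \<eta>"
  proof
    fix j
    have "A j \<in> sets borel" using M(2) by (auto simp flip: M(2))
    then show "\<exists>E. E \<in> clopens \<and> measure M ((A j - E) \<union> (E - A j)) < \<eta>"
      using clopen_approx[OF finite_measure_axioms M(2) _ \<open>\<eta> > 0\<close>] by blast
  qed
  then obtain E where E: "\<forall>j. E j \<in> clopens \<and> measure M ((A j - E j) \<union> (E j - A j)) < \<eta>"
    by (rule choice[THEN exE])
  have [measurable]: "E j \<in> sets M" for j using E clopens_borel M(2) by auto
  define h where "h = (\<lambda>x. \<Sum>j\<in>I. c j * indicator (E j) x)"
  define D where "D = (\<lambda>j. (A j - E j) \<union> (E j - A j))"
  have [measurable]: "D j \<in> sets M" for j unfolding D_def by measurable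
  have gh: "\<bar>g x - h x\<bar> \<le> (\<Sum>j\<in>I. \<bar>c j\<bar> * indicator (D j) x)" for x
  proof -
    have "g x - h x = (\<Sum>j\<in>I. c j * (indicator (A j) x - indicator (E j) x))"
      unfolding g_def h_def by (simp add: sum_subtractf algebra_simps)
    also have "\<bar>\<dots>\<bar> \<le> (\<Sum>j\<in>I. \<bar>c j * (indicator (A j) x - indicator (E j) x)\<bar>)" by (rule sum_abs)
    also have "\<dots> \<le> (\<Sum>j\<in>I. \<bar>c j\<bar> * indicator (D j) x)"
      by (intro sum_mono) (auto simp: D_def indicator_def abs_mult)
    finally show ?thesis .
  qed
  have b: "g \<in> bdd_meas M" "h \<in> bdd_meas M" "(\<lambda>x. \<Sum>j\<in>I. \<bar>c j\<bar> * indicator (D j) x) \<in> bdd_meas M"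
    unfolding g_def h_def by (intro bdd_meas_sum bdd_meas_cmult bdd_meas_indicator; simp)+
  have i: "integrable M (\<lambda>x. \<bar>f x - h x\<bar>)"
    "integrable M (\<lambda>x. inverse (real n) + (\<Sum>j\<in>I. \<bar>c j\<bar> * indicator (D j) x))"
    by (intro integrable_bdd_meas bdd_meas_abs bdd_meas_diff bdd_meas_add bdd_meas_const f b)+
  have "(\<integral>x. \<bar>f x - h x\<bar> \<partial>M) \<le> (\<integral>x. inverse (real n) + (\<Sum>j\<in>I. \<bar>c j\<bar> * indicator (D j) x) \<partial>M)"
  proof (rule integral_mono[OF i])
    fix x assume "x \<in> space M"
    then show "\<bar>f x - h x\<bar> \<le> inverse (real n) + (\<Sum>j\<in>I. \<bar>c j\<bar> * indicator (D j) x)"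
      using fg[of x] gh[of x] by linarith
  qed
  also have "\<dots> = inverse (real n) + (\<integral>x. (\<Sum>j\<in>I. \<bar>c j\<bar> * indicator (D j) x) \<partial>M)"
    using integrable_bdd_meas[OF b(3)] by (simp add: prob_space)
  also have "(\<integral>x. (\<Sum>j\<in>I. \<bar>c j\<bar> * indicator (D j) x) \<partial>M) = (\<Sum>j\<in>I. \<bar>c j\<bar> * measure M (D j))"
    by (subst Bochner_Integration.integral_sum)
      (auto intro!: integrable_bdd_meas bdd_meas_cmult bdd_meas_indicator)
  also have "\<dots> \<le> (\<Sum>j\<in>I. \<bar>c j\<bar> * \<eta>)"
    using E by (intro sum_mono mult_left_mono) (auto simp: D_def less_imp_le)
  also have "\<dots> \<le> e / 2"
  proof -
    define S where "S = 1 + (\<Sum>j\<in>I. \<bar>c j\<bar>)"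
    have "S > 0" using s1 by (simp add: S_def)
    have "(\<Sum>j\<in>I. \<bar>c j\<bar> * \<eta>) \<le> S * \<eta>"
      unfolding sum_distrib_right[symmetric] using \<open>\<eta> > 0\<close> by (intro mult_right_mono) (auto simp: S_def)
    also have "\<dots> = e / 2" using \<open>S > 0\<close> unfolding \<eta>_def S_def[symmetric] by simp
    finally show ?thesis .
  qed
  finally have "(\<integral>x. \<bar>f x - h x\<bar> \<partial>M) < e" using n by simp
  then show ?thesis using that[of I E c] fin E unfolding h_def by blast
qed

section \<open>Empirical joinings\<close>

definition eavg :: "(nat \<Rightarrow> 'a \<Rightarrow> 'a) \<Rightarrow> nat \<Rightarrow> nat \<Rightarrow> (nat \<Rightarrow> 'a \<Rightarrow> real) \<Rightarrow> 'a \<Rightarrow> real" where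
  "eavg T d N \<Phi> x = (\<Sum>n<N. mavg T d N (\<Phi> n) x) / real N"

text \<open>The number k of functions is separate from the dimension d of the box: the induction
  lowers k while the averaging over all d transformations stays intact.\<close>

definition davg :: "(nat \<Rightarrow> 'a \<Rightarrow> 'a) \<Rightarrow> nat \<Rightarrow> nat \<Rightarrow> (nat \<Rightarrow> 'a \<Rightarrow> real) \<Rightarrow> nat \<Rightarrow> 'a \<Rightarrow> real" where
  "davg T d k f N = eavg T d N (\<lambda>n y. \<Prod>i<k. f i ((T i ^^ n) y))"

lemma funpow_commute:
  assumes "\<And>x. S (T x) = T (S x)" shows "S ((T ^^ n) x) = (T ^^ n) (S x)"
  by (induction n) (auto simp: assms)

lemma mavg_comp:
  assumes "\<And>j x. j < d \<Longrightarrow> S (T j x) = T j (S x)"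
  shows "mavg T d N (\<lambda>y. g (S y)) x = mavg T d N g (S x)"
  using assms
proof (induction d arbitrary: x)
  case (Suc d)
  have "S ((T d ^^ n) x) = (T d ^^ n) (S x)" for n x using Suc.prems by (intro funpow_commute) auto
  then show ?case using Suc by (simp add: cavg_def)
qed simp

text \<open>Direction j telescopes within its own Cesaro average, and commutation carries
  \<open>T j\<close> through the averages outside it.\<close>

lemma mavg_shift:
  assumes g: "\<And>x. \<bar>g x\<bar> \<le> B" and "j < d"
    and comm: "\<And>i j x. i < d \<Longrightarrow> j < d \<Longrightarrow> T i (T j x) = T j (T i x)"
  shows "\<bar>mavg T d N g (T j x) - mavg T d N g x\<bar> \<le> 2 * B / real N"
  using assms(2,3)
proof (induction d arbitrary: x)
  case (Suc d)
  show ?case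
  proof (cases "j = d")
    case True
    then show ?thesis using cavg_shift[OF mavg_bound[OF g], where T="T d"] by simp
  next
    case False
    then have "j < d" using Suc by auto
    have "T j ((T d ^^ n) x) = (T d ^^ n) (T j x)" for n using Suc.prems by (intro funpow_commute) auto
    then have "mavg T (Suc d) N g (T j x) - mavg T (Suc d) N g x =
        (\<Sum>n<N. mavg T d N g (T j ((T d ^^ n) x)) - mavg T d N g ((T d ^^ n) x)) / real N"
      by (simp add: cavg_def sum_subtractf diff_divide_distrib)
    also have "\<bar>\<dots>\<bar> \<le> 2 * B / real N"
      by (rule mean_bound) (use Suc \<open>j < d\<close> in auto)
    finally show ?thesis .
  qed
qed simp

lemma eavg_bound: "(\<And>n x. \<bar>\<Phi> n x\<bar> \<le> B) \<Longrightarrow> \<bar>eavg T d N \<Phi> x\<bar> \<le> B"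
  unfolding eavg_def by (intro mean_bound mavg_bound)

lemma eavg_add: "eavg T d N (\<lambda>n x. \<Phi> n x + \<Psi> n x) x = eavg T d N \<Phi> x + eavg T d N \<Psi> x"
  by (simp add: eavg_def mavg_add sum.distrib add_divide_distrib)

lemma eavg_cmult: "eavg T d N (\<lambda>n x. c * \<Phi> n x) x = c * eavg T d N \<Phi> x"
  by (simp add: eavg_def mavg_cmult sum_distrib_left)

lemma eavg_mono: "(\<And>n x. \<Phi> n x \<le> \<Psi> n x) \<Longrightarrow> eavg T d N \<Phi> x \<le> eavg T d N \<Psi> x"
  unfolding eavg_def by (intro divide_right_mono sum_mono mavg_mono) auto

lemma mavg_const: "N \<ge> 1 \<Longrightarrow> mavg T d N (\<lambda>x. c) = (\<lambda>x. c)"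
  by (induction d) (auto simp: cavg_def)

lemma eavg_const: "N \<ge> 1 \<Longrightarrow> eavg T d N (\<lambda>n x. c) x = c"
  by (simp add: eavg_def mavg_const)

lemma bdd_meas_eavg:
  "(\<And>i. i < d \<Longrightarrow> mpres M (T i)) \<Longrightarrow> (\<And>n. \<Phi> n \<in> bdd_meas M) \<Longrightarrow> eavg T d N \<Phi> \<in> bdd_meas M"
  unfolding eavg_def by (intro bdd_meas_divide bdd_meas_sum bdd_meas_mavg)

text \<open>Pairing arranges the bits in countably many rows, so one sequence encodes a sequence of
  points. Joinings thus live on the same type as the original system, and the induction hypothesis
  can be applied to them.\<close>

definition pr :: "nat \<Rightarrow> (nat \<Rightarrow> bool) \<Rightarrow> nat \<Rightarrow> bool" where
  "pr i y = (\<lambda>a. y (prod_encode (i, a)))"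

definition join :: "(nat \<Rightarrow> nat \<Rightarrow> bool) \<Rightarrow> nat \<Rightarrow> bool" where
  "join x = (\<lambda>p. case prod_decode p of (i, a) \<Rightarrow> x i a)"

lemma pr_join [simp]: "pr i (join x) = x i"
  by (simp add: pr_def join_def)

lemma join_pr [simp]: "join (\<lambda>i. pr i y) = y"
proof
  fix p show "join (\<lambda>i. pr i y) p = y p"
    by (cases "prod_decode p") (metis join_def pr_def old.prod.case prod_decode_inverse)
qed

lemma continuous_pr: "continuous_on UNIV (pr i)"
  unfolding pr_def by (intro continuous_on_coordinatewise_then_product) simp

lemma continuous_join:
  assumes "\<And>i. continuous_on UNIV (\<lambda>y. x y i)" shows "continuous_on UNIV (\<lambda>y. join (x y))"
proof (rule continuous_on_coordinatewise_then_product)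
  fix p
  show "continuous_on UNIV (\<lambda>y. join (x y) p)"
    unfolding join_def
    by (cases "prod_decode p") (simp add: continuous_on_product_then_coordinatewise[OF assms])
qed

text \<open>The Cantor space is identified with a countable power of itself. Only the coordinates up to \<^term>\<open>k\<close>
  matter: later ones move like coordinate \<^term>\<open>k\<close>, which is what \<^term>\<open>min i k\<close> achieves.\<close>

definition ext :: "(nat \<Rightarrow> (nat \<Rightarrow> bool) \<Rightarrow> nat \<Rightarrow> bool) \<Rightarrow> nat \<Rightarrow> nat \<Rightarrow> (nat \<Rightarrow> bool) \<Rightarrow> nat \<Rightarrow> bool" where
  "ext T k j y = join (\<lambda>i. T (if j = k then min i k else j) (pr i y))"

text \<open>The point whose rows up to k are the n-th iterates of y under the different
  transformations; averaging its law over n and the box gives the empirical measures.\<close>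

definition orb :: "(nat \<Rightarrow> (nat \<Rightarrow> bool) \<Rightarrow> nat \<Rightarrow> bool) \<Rightarrow> nat \<Rightarrow> nat \<Rightarrow> (nat \<Rightarrow> bool) \<Rightarrow> nat \<Rightarrow> bool" where
  "orb T k n y = join (\<lambda>i. (T (min i k) ^^ n) y)"

text \<open>Continuity makes preimages of clopen sets clopen, so that invariance can be tested in
  limits known only on clopen sets. Continuity of the inverses supplies the measurable inverses
  required by \<open>condexp_shift\<close>.\<close>

locale cantor_system = prob_space M for M :: "(nat \<Rightarrow> bool) measure" +
  fixes d :: nat and T :: "nat \<Rightarrow> (nat \<Rightarrow> bool) \<Rightarrow> nat \<Rightarrow> bool"
  assumes sets_M [measurable_cong, simp]: "sets M = sets borel"
    and mp: "i < d \<Longrightarrow> mpres M (T i)"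
    and cont: "i < d \<Longrightarrow> continuous_on UNIV (T i)"
    and bij: "i < d \<Longrightarrow> bij (T i)"
    and cont_inv: "i < d \<Longrightarrow> continuous_on UNIV (inv (T i))"
    and comm: "i < d \<Longrightarrow> j < d \<Longrightarrow> T i (T j x) = T j (T i x)"
begin

lemma space_M [simp]: "space M = UNIV"
  using sets_eq_imp_space_eq[OF sets_M] by simp

lemma measurable_continuous: "continuous_on UNIV f \<Longrightarrow> f \<in> measurable M borel"
  using borel_measurable_continuous_onI measurable_cong_sets[OF sets_M refl] by blast

text \<open>Each \<open>ext T k j\<close> applies one transformation in every row, so bijectivity,
  continuity and commutation hold row by row. Only invariance depends on the measure, and clopen
  sets suffice to decide it.\<close>

lemma ext_system:
  assumes "k < d" and N: "prob_space N" "sets N = sets borel"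
    and inv: "\<And>j E. j < d \<Longrightarrow> E \<in> clopens \<Longrightarrow> measure N (ext T k j -` E) = measure N E"
  shows "cantor_system N d (ext T k)"
proof -
  interpret N: prob_space N by fact
  define c where "c = (\<lambda>j i. if j = k then min i k else j)"
  have c: "c j i < d" if "j < d" for i j using that \<open>k < d\<close> by (auto simp: c_def)
  have e: "ext T k j = (\<lambda>y. join (\<lambda>i. T (c j i) (pr i y)))" for j by (auto simp: ext_def c_def)
  define e' where "e' = (\<lambda>j y. join (\<lambda>i. inv (T (c j i)) (pr i y)))"
  have cpr: "continuous_on UNIV (\<lambda>y. f (pr i y))" if "continuous_on UNIV f" for f :: "(nat \<Rightarrow> bool) \<Rightarrow> (nat \<Rightarrow> bool)" and i
    using continuous_on_compose2[OF that continuous_pr] by blast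
  have ce: "continuous_on UNIV (ext T k j)" if "j < d" for j
    unfolding e by (intro continuous_join cpr cont c that)
  have sp: "space N = UNIV" using sets_eq_imp_space_eq[OF N(2)] by simp
  show ?thesis
  proof
    fix j assume j: "j < d"
    have "ext T k j (e' j y) = y" "e' j (ext T k j y) = y" for y
      unfolding e e'_def using bij[OF c[OF j]] by (auto simp: bij_is_surj surj_f_inv_f bij_is_inj)
    then have *: "ext T k j \<circ> e' j = id" "e' j \<circ> ext T k j = id" by auto
    then show "bij (ext T k j)" using o_bij by blast
    have "inv (ext T k j) = e' j" using * inv_unique_comp by blast
    then show "continuous_on UNIV (inv (ext T k j))"
      unfolding e'_def by (simp add: continuous_join cpr cont_inv c j)
    show "continuous_on UNIV (ext T k j)" by (rule ce[OF j])
    have m: "ext T k j \<in> measurable N N"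
      using borel_measurable_continuous_onI[OF ce[OF j]] measurable_cong_sets[OF N(2) N(2)] by blast
    have "distr N N (ext T k j) = N"
    proof (rule measure_eqI_clopens)
      show "finite_measure (distr N N (ext T k j))" using N.prob_space_distr[OF m] prob_space.finite_measure by blast
      show "measure (distr N N (ext T k j)) E = measure N E" if "E \<in> clopens" for E
        using measure_distr[OF m, of E] clopens_borel[OF that] inv[OF j that] N(2) sp by simp
    qed (use N in \<open>auto simp: N.finite_measure_axioms\<close>)
    then show "mpres N (ext T k j)" using m by (simp add: mpres_def)
  next
    fix i j y assume "i < d" "j < d"
    then show "ext T k i (ext T k j y) = ext T k j (ext T k i y)"
      unfolding e using comm c by simp
  qed (use N in auto)
qed

end

context cantor_system
begin

lemma measurable_pr: "pr i \<in> measurable borel borel"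
  by (intro borel_measurable_continuous_onI continuous_pr)

lemma measurable_orb:
  assumes "k < d" shows "orb T k n \<in> measurable M borel"
proof -
  have "continuous_on UNIV (T i ^^ n)" if "i < d" for i
  proof (induction n)
    case (Suc n)
    then show ?case using continuous_on_compose2[OF cont[OF that] Suc] by (simp add: comp_def)
  qed (simp add: id_def)
  moreover have "orb T k n = (\<lambda>y. join (\<lambda>i. (T (min i k) ^^ n) y))" by (auto simp: orb_def)
  ultimately have "continuous_on UNIV (orb T k n)" using assms by (auto intro!: continuous_join)
  then show ?thesis by (rule measurable_continuous)
qed

lemma orb_comp_ne:
  assumes "j < d" "k < d" "j \<noteq> k"
  shows "ext T k j (orb T k n y) = orb T k n (T j y)"
proof -
  have "T j ((T (min i k) ^^ n) y) = (T (min i k) ^^ n) (T j y)" for i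
    using assms by (intro funpow_commute comm) auto
  then show ?thesis using assms by (simp add: ext_def orb_def)
qed

lemma orb_comp_eq: "ext T k k (orb T k n y) = orb T k (Suc n) y"
  by (simp add: ext_def orb_def)

text \<open>Two mechanisms give the same error: for j \<noteq> k the extension moves the base point
  in direction j of the box, while for j = k it advances the time n by one.\<close>

lemma eavg_orb_shift:
  assumes "j < d" "k < d" and B: "\<And>y. \<bar>\<Psi> y\<bar> \<le> B"
  shows "\<bar>eavg T d N (\<lambda>n y. \<Psi> (ext T k j (orb T k n y))) x - eavg T d N (\<lambda>n y. \<Psi> (orb T k n y)) x\<bar> \<le> 2 * B / real N"
proof (cases "j = k")
  case True
  define a where "a = (\<lambda>n. mavg T d N (\<lambda>y. \<Psi> (orb T k n y)) x)"
  have a: "\<bar>a n\<bar> \<le> B" for n unfolding a_def by (intro mavg_bound B)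
  have "eavg T d N (\<lambda>n y. \<Psi> (ext T k j (orb T k n y))) x - eavg T d N (\<lambda>n y. \<Psi> (orb T k n y)) x
      = (\<Sum>n<N. a (Suc n) - a n) / real N"
    unfolding eavg_def True orb_comp_eq a_def by (simp add: sum_subtractf diff_divide_distrib)
  also have "\<dots> = (a N - a 0) / real N" by (simp only: sum_lessThan_telescope)
  finally show ?thesis using a[of 0] a[of N] by (simp add: divide_right_mono)
next
  case False
  define \<phi> where "\<phi> = (\<lambda>n y. \<Psi> (orb T k n y))"
  have "mavg T d N (\<lambda>y. \<phi> n (T j y)) x = mavg T d N (\<phi> n) (T j x)" for n
    using \<open>j < d\<close> by (intro mavg_comp comm)
  then have "eavg T d N (\<lambda>n y. \<Psi> (ext T k j (orb T k n y))) x - eavg T d N (\<lambda>n y. \<Psi> (orb T k n y)) x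
      = (\<Sum>n<N. mavg T d N (\<phi> n) (T j x) - mavg T d N (\<phi> n) x) / real N"
    unfolding eavg_def orb_comp_ne[OF assms(1,2) False] \<phi>_def by (simp add: sum_subtractf diff_divide_distrib)
  also have "\<bar>\<dots>\<bar> \<le> 2 * B / real N"
    using B \<open>j < d\<close> comm by (intro mean_bound mavg_shift) (auto simp: \<phi>_def)
  finally show ?thesis .
qed

text \<open>A function of one coordinate sees a single transformation, so its average collapses to
  an iterated Cesaro average, for which the pointwise theorem is available.\<close>

lemma eavg_single:
  assumes "i < d"
  shows "eavg T d N (\<lambda>n y. g ((T i ^^ n) y)) x = cavg (T i) N (mavg T d N g) x"
proof -
  have "mavg T d N (\<lambda>y. g ((T i ^^ n) y)) x = mavg T d N g ((T i ^^ n) x)" for n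
    using assms by (intro mavg_comp funpow_commute[symmetric] comm)
  then show ?thesis by (simp add: eavg_def cavg_def)
qed

lemma davg_orb: "davg T d (Suc k) F N x = eavg T d N (\<lambda>n y. \<Prod>i<Suc k. F i (pr i (orb T k n y))) x"
proof -
  have "(\<Prod>i<Suc k. F i ((T i ^^ n) y)) = (\<Prod>i<Suc k. F i (pr i (orb T k n y)))" for n y
    by (intro prod.cong refl) (simp add: orb_def min_def)
  then show ?thesis by (simp only: davg_def)
qed

lemma bdd_meas_davg:
  assumes "k \<le> d" "\<And>i. i < k \<Longrightarrow> F i \<in> bdd_meas M"
  shows "davg T d k F N \<in> bdd_meas M"
  unfolding davg_def
proof (intro bdd_meas_eavg mp bdd_meas_prod)
  fix n i assume "i \<in> {..<k}"
  then have "i < k" "i < d" using assms by auto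
  then show "(\<lambda>y. F i ((T i ^^ n) y)) \<in> bdd_meas M"
    using bdd_meas_comp[OF assms(2) mpres_measurable[OF mpres_pow[OF mp]]] by blast
qed

text \<open>The subsequence is chosen for clopen sets only, yet works for all tensor products of
  bounded measurable functions, because one-coordinate averages converge for every such function and
  control the approximation errors.\<close>

theorem empirical_joining:
  assumes k: "k < d" and \<nu>: "\<And>L. \<nu> L \<in> measurable M (count_space UNIV)" "\<And>L x. \<nu> L x \<ge> L" "\<And>L x. \<nu> L x \<ge> (1::nat)"
  obtains N r where "strict_mono r" "cantor_system N d (ext T k)"
    "\<And>i. i \<le> k \<Longrightarrow> distr N M (pr i) = M"
    "\<And>F. (\<And>i. i \<le> k \<Longrightarrow> F i \<in> bdd_meas M) \<Longrightarrow>
       (\<lambda>j. \<integral>x. davg T d (Suc k) F (\<nu> (r j) x) x \<partial>M) \<longlonglongrightarrow> (\<integral>y. (\<Prod>i<Suc k. F i (pr i y)) \<partial>N)"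
proof -
  define e where "e = (\<lambda>L \<Psi> x. eavg T d (\<nu> L x) (\<lambda>n y. \<Psi> (orb T k n y)) x)"
  define q where "q = (\<lambda>L \<Psi>. \<integral>x. e L \<Psi> x \<partial>M)"
  note [measurable] = \<nu>(1)
  have eb: "e L \<Psi> \<in> bdd_meas M" if \<Psi>: "\<Psi> \<in> bdd_meas borel" for L \<Psi>
  proof -
    obtain B where B: "B \<ge> 0" "\<And>x. \<bar>\<Psi> x\<bar> \<le> B" using bdd_meas_bound[OF \<Psi>] by metis
    have "eavg T d N (\<lambda>n y. \<Psi> (orb T k n y)) \<in> bdd_meas M" for N
      using k by (intro bdd_meas_eavg mp bdd_meas_comp[OF \<Psi>] measurable_orb)
    then have [measurable]: "eavg T d N (\<lambda>n y. \<Psi> (orb T k n y)) \<in> borel_measurable M" for N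
      by (rule bdd_measD)
    show ?thesis
    proof (rule bdd_measI)
      show "e L \<Psi> \<in> borel_measurable M" unfolding e_def
        by (rule measurable_compose_countable[where g="\<nu> L"]) auto
      show "\<bar>e L \<Psi> x\<bar> \<le> B" for x unfolding e_def by (intro eavg_bound B)
    qed
  qed
  note ei = integrable_bdd_meas[OF eb]
  have prU: "prob UNIV = 1" using prob_space by simp
  have q_add: "q L (\<lambda>y. \<Psi> y + \<Theta> y) = q L \<Psi> + q L \<Theta>" if "\<Psi> \<in> bdd_meas borel" "\<Theta> \<in> bdd_meas borel" for L \<Psi> \<Theta>
    unfolding q_def using ei[OF that(1)] ei[OF that(2)]
    by (subst Bochner_Integration.integral_add[symmetric]) (auto simp: e_def eavg_add)
  have q_cmult: "q L (\<lambda>y. c * \<Psi> y) = c * q L \<Psi>" for L c \<Psi>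
    unfolding q_def e_def by (simp add: eavg_cmult)
  have q_mono: "q L \<Psi> \<le> q L \<Theta>" if "\<Psi> \<in> bdd_meas borel" "\<Theta> \<in> bdd_meas borel" "\<And>y. \<Psi> y \<le> \<Theta> y" for L \<Psi> \<Theta>
    unfolding q_def using ei that by (intro integral_mono) (auto simp: e_def intro: eavg_mono)
  have q_const: "q L (\<lambda>y. c) = c" for L c
    unfolding q_def e_def using \<nu>(3) by (simp add: eavg_const prU)
  have ind: "indicator E \<in> bdd_meas borel" if "E \<in> clopens" for E
    using that by (intro bdd_meas_indicator clopens_borel)
  obtain r N where r: "strict_mono r" and N: "prob_space N" "sets N = sets borel"
    and lim: "\<And>E. E \<in> clopens \<Longrightarrow> (\<lambda>j. q (r j) (indicator E)) \<longlonglongrightarrow> measure N E"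
  proof (rule clopen_content_compactness[where p="\<lambda>L E. q L (indicator E)"])
    show "0 \<le> q L (indicator E)" if "E \<in> clopens" for L E
      using q_mono[OF bdd_meas_const[of 0] ind[OF that], of L] q_const[of L 0] by simp
    have "(indicator UNIV :: _ \<Rightarrow> real) = (\<lambda>y. 1)" by auto
    then show "q L (indicator UNIV) = 1" for L using q_const[of L 1] by simp
    show "q L (indicator (E \<union> F)) = q L (indicator E) + q L (indicator F)"
      if "E \<in> clopens" "F \<in> clopens" "E \<inter> F = {}" for L E F
    proof -
      have "(indicator (E \<union> F) :: _ \<Rightarrow> real) = (\<lambda>y. indicator E y + indicator F y)"
        using that(3) by (intro ext) (auto simp: indicator_def)
      then show ?thesis using q_add[OF ind ind] that by simp
    qed
  qed blast
  interpret N: prob_space N by fact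
  have spN: "space N = UNIV" using sets_eq_imp_space_eq[OF N(2)] by simp
  have bN: "\<Psi> \<in> bdd_meas N \<longleftrightarrow> \<Psi> \<in> bdd_meas borel" for \<Psi>
    using measurable_cong_sets[OF N(2) refl] by (auto simp: bdd_meas_def)
  have bM: "\<Psi> \<in> bdd_meas M \<longleftrightarrow> \<Psi> \<in> bdd_meas borel" for \<Psi>
    using measurable_cong_sets[OF sets_M refl] by (auto simp: bdd_meas_def)
  have r_null: "(\<lambda>j. C / real (r j)) \<longlonglongrightarrow> 0" for C
    using LIMSEQ_subseq_LIMSEQ[OF lim_const_over_n[of C] r] by (simp add: comp_def)
  have sys: "cantor_system N d (ext T k)"
  proof (rule ext_system[OF k N])
    fix j E assume j: "j < d" and E: "E \<in> clopens"
    have "continuous_on UNIV (ext T k j)"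
    proof -
      have "ext T k j = (\<lambda>y. join (\<lambda>i. T (if j = k then min i k else j) (pr i y)))" by (auto simp: ext_def)
      moreover have "continuous_on UNIV (\<lambda>y. T (if j = k then min i k else j) (pr i y))" for i
        using continuous_on_compose2[OF cont continuous_pr] j k by auto
      ultimately show ?thesis by (simp add: continuous_join)
    qed
    then have E': "ext T k j -` E \<in> clopens" using E by (rule clopens_vimage)
    \<comment> \<open>The random index enters only through \<open>\<nu> L x \<ge> L\<close>, which
      bounds the telescoping error at \<open>\<nu> L x\<close> by 2 / L uniformly in x.\<close>
    have "\<bar>q L (indicator (ext T k j -` E)) - q L (indicator E)\<bar> \<le> 2 / real L" if "L > 0" for L
    proof -
      have "\<bar>e L (indicator (ext T k j -` E)) x - e L (indicator E) x\<bar> \<le> 2 / real L" for x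
      proof -
        have "\<bar>e L (indicator (ext T k j -` E)) x - e L (indicator E) x\<bar> \<le> 2 * 1 / real (\<nu> L x)"
          using eavg_orb_shift[OF j k, where \<Psi>="indicator E" and B=1 and N="\<nu> L x" and x=x]
          by (simp add: e_def indicator_def)
        also have "\<dots> \<le> 2 / real L" using \<nu>(2)[of L x] that by (simp add: frac_le)
        finally show ?thesis .
      qed
      then have "\<bar>\<integral>x. e L (indicator (ext T k j -` E)) x - e L (indicator E) x \<partial>M\<bar> \<le> (\<integral>x. 2 / real L \<partial>M)"
        using ei[OF ind[OF E]] ei[OF ind[OF E']]
        by (intro order_trans[OF integral_abs_bound] integral_mono) auto
      then show ?thesis unfolding q_def using ei[OF ind[OF E]] ei[OF ind[OF E']] by (simp add: prU)
    qed
    note dl = this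
    have "norm (q (r j') (indicator (ext T k j -` E)) - q (r j') (indicator E)) \<le> 2 / real (r j')" if "j' \<ge> 1" for j'
      unfolding real_norm_def using seq_suble[OF r, of j'] that by (intro dl) simp
    then have "\<forall>\<^sub>F j' in sequentially. norm (q (r j') (indicator (ext T k j -` E)) - q (r j') (indicator E)) \<le> 2 / real (r j')"
      by (rule eventually_sequentiallyI)
    then have "(\<lambda>j'. q (r j') (indicator (ext T k j -` E)) - q (r j') (indicator E)) \<longlonglongrightarrow> 0"
      by (rule Lim_null_comparison[OF _ r_null])
    moreover have "(\<lambda>j'. q (r j') (indicator (ext T k j -` E)) - q (r j') (indicator E))
        \<longlonglongrightarrow> measure N (ext T k j -` E) - measure N E"
      by (intro tendsto_diff lim E E')
    ultimately show "measure N (ext T k j -` E) = measure N E"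
      using LIMSEQ_unique by fastforce
  qed
  \<comment> \<open>After reduction to an iterated average, the integral at each fixed positive
    index is that of g, hence so is the limit along the random index. Clopen approximation plays no
    part here, so g may be any bounded measurable function.\<close>
  have marg: "(\<lambda>j. q (r j) (\<lambda>y. g (pr i y))) \<longlonglongrightarrow> (\<integral>x. g x \<partial>M)" if i: "i \<le> k" and g: "g \<in> bdd_meas M" for i g
  proof -
    obtain B where B: "B \<ge> 0" "\<And>x. \<bar>g x\<bar> \<le> B" using bdd_meas_bound[OF g] by metis
    have "i < d" using i k by simp
    have "(\<lambda>L. \<integral>x. cavg (T i) (\<nu> L x) (mavg T d (\<nu> L x) g) x \<partial>M) \<longlonglongrightarrow> (\<integral>x. g x \<partial>M)"
    proof (rule integral_random_index[where a="\<lambda>N x. cavg (T i) N (mavg T d N g) x"])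
      have mb: "mavg T d N g \<in> bdd_meas M" for N using mp g by (intro bdd_meas_mavg)
      show "(\<lambda>x. cavg (T i) N (mavg T d N g) x) \<in> borel_measurable M" for N
        using bdd_measD[OF bdd_meas_cavg[OF mp[OF \<open>i < d\<close>] mb]] .
      show "\<bar>cavg (T i) N (mavg T d N g) x\<bar> \<le> B" for N x by (intro cavg_bound mavg_bound B)
      show "AE x in M. convergent (\<lambda>N. cavg (T i) N (mavg T d N g) x)"
        using mp \<open>i < d\<close> g bdd_measD[OF mb]
        by (intro AE_convergent_cavg_seq[where B=B] AE_convergent_mavg mavg_bound B) auto
      show "(\<integral>x. cavg (T i) N (mavg T d N g) x \<partial>M) = (\<integral>x. g x \<partial>M)" if "N \<ge> 1" for N
        using integral_cavg[OF mp[OF \<open>i < d\<close>] mb that] integral_mavg[OF mp g that] by simp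
    qed (use \<nu> in auto)
    moreover have "q L (\<lambda>y. g (pr i y)) = (\<integral>x. cavg (T i) (\<nu> L x) (mavg T d (\<nu> L x) g) x \<partial>M)" for L
      unfolding q_def e_def using i by (simp add: orb_def eavg_single[OF \<open>i < d\<close>, symmetric] min_def)
    ultimately have "(\<lambda>L. q L (\<lambda>y. g (pr i y))) \<longlonglongrightarrow> (\<integral>x. g x \<partial>M)" by simp
    then show ?thesis using LIMSEQ_subseq_LIMSEQ[OF _ r] by (simp add: comp_def)
  qed
  have prN: "pr i \<in> measurable N M" for i
    using measurable_pr measurable_cong_sets[OF N(2) sets_M] by blast
  have distr: "distr N M (pr i) = M" if i: "i \<le> k" for i
  proof (rule measure_eqI_clopens)
    show "finite_measure (distr N M (pr i))" using N.prob_space_distr[OF prN] prob_space.finite_measure by blast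
    fix E assume E: "E \<in> clopens"
    have E': "pr i -` E \<in> clopens" by (rule clopens_vimage[OF continuous_pr E])
    have "(\<lambda>j. q (r j) (\<lambda>y. indicator E (pr i y))) \<longlonglongrightarrow> (\<integral>x. indicator E x \<partial>M)"
      using ind[OF E] by (intro marg[OF i]) (simp add: bM)
    moreover have "(\<lambda>y. indicator E (pr i y) :: real) = indicator (pr i -` E)" by (auto simp: indicator_def)
    ultimately have "(\<lambda>j. q (r j) (indicator (pr i -` E))) \<longlonglongrightarrow> measure M E"
      using clopens_borel[OF E] by simp
    with lim[OF E'] have "measure N (pr i -` E) = measure M E" by (rule LIMSEQ_unique)
    then show "measure (distr N M (pr i)) E = measure M E"
      using measure_distr[OF prN, of E] clopens_borel[OF E] spN by simp
  qed (simp_all add: finite_measure_axioms)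
  define Conv where "Conv = (\<lambda>\<Psi>. \<Psi> \<in> bdd_meas borel \<and> (\<lambda>j. q (r j) \<Psi>) \<longlonglongrightarrow> (\<integral>y. \<Psi> y \<partial>N))"
  have Ni: "integrable N \<Psi>" if "\<Psi> \<in> bdd_meas borel" for \<Psi>
    using that by (intro N.integrable_bdd_meas) (simp add: bN)
  have Conv_sum: "Conv (\<lambda>y. \<Sum>j\<in>I. c j * \<Psi> j y)" if "\<And>j. j \<in> I \<Longrightarrow> Conv (\<Psi> j)"
    for I :: "int set" and c :: "int \<Rightarrow> real" and \<Psi>
    using that
  proof (induction I rule: infinite_finite_induct)
    case (insert j I)
    then have 1: "\<Psi> j \<in> bdd_meas borel" "(\<lambda>i. q (r i) (\<Psi> j)) \<longlonglongrightarrow> (\<integral>y. \<Psi> j y \<partial>N)"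
      and 2: "(\<lambda>y. \<Sum>j\<in>I. c j * \<Psi> j y) \<in> bdd_meas borel"
        "(\<lambda>i. q (r i) (\<lambda>y. \<Sum>j\<in>I. c j * \<Psi> j y)) \<longlonglongrightarrow> (\<integral>y. (\<Sum>j\<in>I. c j * \<Psi> j y) \<partial>N)"
      by (auto simp: Conv_def)
    have 3: "(\<lambda>y. c j * \<Psi> j y) \<in> bdd_meas borel" by (intro bdd_meas_cmult 1)
    have "(\<lambda>i. c j * q (r i) (\<Psi> j) + q (r i) (\<lambda>y. \<Sum>j\<in>I. c j * \<Psi> j y))
        \<longlonglongrightarrow> c j * (\<integral>y. \<Psi> j y \<partial>N) + (\<integral>y. (\<Sum>j\<in>I. c j * \<Psi> j y) \<partial>N)"
      by (intro tendsto_intros 1 2)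
    then show ?case
      using insert.hyps Ni[OF 2(1)] Ni[OF 3] bdd_meas_add[OF 3 2(1)]
      by (simp add: Conv_def q_add[OF 3 2(1)] q_cmult)
  qed (simp_all add: Conv_def q_const)
  \<comment> \<open>The bound \<Theta> must itself have convergent averages: a small N-integral by
    itself would not make \<open>q (r j) \<Theta>\<close> small.\<close>
  have Conv_approx: "Conv \<Psi>" if \<Psi>: "\<Psi> \<in> bdd_meas borel"
    and ap: "\<And>\<epsilon>. \<epsilon> > 0 \<Longrightarrow> \<exists>\<Psi>' \<Theta>. Conv \<Psi>' \<and> Conv \<Theta> \<and> (\<forall>y. \<bar>\<Psi> y - \<Psi>' y\<bar> \<le> \<Theta> y) \<and> (\<integral>y. \<Theta> y \<partial>N) < \<epsilon>" for \<Psi>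
    unfolding Conv_def
  proof (intro conjI \<Psi> LIMSEQ_I)
    fix \<epsilon> :: real assume "\<epsilon> > 0"
    then obtain \<Psi>' \<Theta> where C: "Conv \<Psi>'" "Conv \<Theta>" "\<And>y. \<bar>\<Psi> y - \<Psi>' y\<bar> \<le> \<Theta> y" "(\<integral>y. \<Theta> y \<partial>N) < \<epsilon> / 3"
      using ap[of "\<epsilon> / 3"] by auto
    then have b: "\<Psi>' \<in> bdd_meas borel" "\<Theta> \<in> bdd_meas borel"
      and l: "(\<lambda>j. q (r j) \<Psi>') \<longlonglongrightarrow> (\<integral>y. \<Psi>' y \<partial>N)" "(\<lambda>j. q (r j) \<Theta>) \<longlonglongrightarrow> (\<integral>y. \<Theta> y \<partial>N)"
      by (auto simp: Conv_def)
    have le: "\<Psi> y \<le> \<Psi>' y + \<Theta> y" "\<Psi>' y \<le> \<Psi> y + \<Theta> y" for y using C(3)[of y] by linarith+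
    have "q L \<Psi> \<le> q L \<Psi>' + q L \<Theta>" "q L \<Psi>' \<le> q L \<Psi> + q L \<Theta>" for L
      unfolding q_add[OF b, symmetric] q_add[OF \<Psi> b(2), symmetric]
      by (intro q_mono bdd_meas_add \<Psi> b le)+
    moreover have "(\<integral>y. \<Psi> y \<partial>N) \<le> (\<integral>y. \<Psi>' y \<partial>N) + (\<integral>y. \<Theta> y \<partial>N)" "(\<integral>y. \<Psi>' y \<partial>N) \<le> (\<integral>y. \<Psi> y \<partial>N) + (\<integral>y. \<Theta> y \<partial>N)"
      using Ni[OF \<Psi>] Ni[OF b(1)] Ni[OF b(2)] le
      by (simp_all flip: Bochner_Integration.integral_add) (intro integral_mono; simp)+
    moreover have "\<forall>\<^sub>F j in sequentially. q (r j) \<Theta> < \<epsilon> / 3" by (rule order_tendstoD(2)[OF l(2) C(4)])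
    moreover have "\<forall>\<^sub>F j in sequentially. dist (q (r j) \<Psi>') (\<integral>y. \<Psi>' y \<partial>N) < \<epsilon> / 3"
      by (rule tendstoD[OF l(1)]) (use \<open>\<epsilon> > 0\<close> in simp)
    ultimately have "\<forall>\<^sub>F j in sequentially. norm (q (r j) \<Psi> - (\<integral>y. \<Psi> y \<partial>N)) < \<epsilon>"
      using C(4)
    proof -
      assume h: "\<And>L. q L \<Psi> \<le> q L \<Psi>' + q L \<Theta>" "\<And>L. q L \<Psi>' \<le> q L \<Psi> + q L \<Theta>"
        "(\<integral>y. \<Psi> y \<partial>N) \<le> (\<integral>y. \<Psi>' y \<partial>N) + (\<integral>y. \<Theta> y \<partial>N)" "(\<integral>y. \<Psi>' y \<partial>N) \<le> (\<integral>y. \<Psi> y \<partial>N) + (\<integral>y. \<Theta> y \<partial>N)"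
        and ev: "\<forall>\<^sub>F j in sequentially. q (r j) \<Theta> < \<epsilon> / 3"
          "\<forall>\<^sub>F j in sequentially. dist (q (r j) \<Psi>') (\<integral>y. \<Psi>' y \<partial>N) < \<epsilon> / 3"
      show ?thesis using ev
      proof eventually_elim
        case (elim j)
        then show ?case using h(1)[of "r j"] h(2)[of "r j"] h(3,4) C(4)
          unfolding dist_real_def real_norm_def abs_less_iff by linarith
      qed
    qed
    then show "\<exists>no. \<forall>n\<ge>no. norm (q (r n) \<Psi> - (\<integral>y. \<Psi> y \<partial>N)) < \<epsilon>" by (simp add: eventually_sequentially)
  qed
  have upd: "(\<Prod>i<Suc k. (F(m := w)) i (pr i y)) = w (pr m y) * (\<Prod>i\<in>{..<Suc k} - {m}. F i (pr i y))"
    if "m \<le> k" for F :: "nat \<Rightarrow> (nat \<Rightarrow> bool) \<Rightarrow> real" and m w y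
    using that by (subst prod.remove[of _ m]) (auto intro!: prod.cong)
  have tensor_b: "(\<lambda>y. \<Prod>i<Suc k. F i (pr i y)) \<in> bdd_meas borel" if "\<And>i. i \<le> k \<Longrightarrow> F i \<in> bdd_meas M" for F
  proof (rule bdd_meas_prod)
    fix i assume "i \<in> {..<Suc k}"
    then have "F i \<in> bdd_meas borel" using that[of i] by (simp add: bM)
    then show "(\<lambda>y. F i (pr i y)) \<in> bdd_meas borel" by (rule bdd_meas_comp[OF _ measurable_pr])
  qed
  \<comment> \<open>Induction on the number m of leading slots that carry arbitrary functions, the
    remaining ones carrying clopen indicators. For m = 0 the product is the indicator of a clopen
    set.\<close>
  have tensor: "m \<le> Suc k \<Longrightarrow> (\<And>i. i < m \<Longrightarrow> F i \<in> bdd_meas M) \<Longrightarrow>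
      (\<And>i. m \<le> i \<Longrightarrow> i \<le> k \<Longrightarrow> \<exists>E\<in>clopens. F i = indicator E) \<Longrightarrow>
      Conv (\<lambda>y. \<Prod>i<Suc k. F i (pr i y))" for m F
  proof (induction m arbitrary: F)
    case 0
    then have "\<forall>i. \<exists>E. i \<le> k \<longrightarrow> E \<in> clopens \<and> F i = indicator E" by blast
    then obtain E where E: "\<forall>i. i \<le> k \<longrightarrow> E i \<in> clopens \<and> F i = indicator (E i)"
      by (rule choice[THEN exE])
    define D where "D = (\<Inter>i\<in>{..k}. pr i -` E i)"
    have "(\<Inter>i\<in>I. pr i -` E i) \<in> clopens" if "finite I" "I \<subseteq> {..k}" for I
      using that E by (induction I) (auto intro!: clopens_closed clopens_vimage continuous_pr)
    then have D: "D \<in> clopens" unfolding D_def by auto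
    have "(\<Prod>i<Suc k. F i (pr i y)) = indicator D y" for y
    proof -
      have "(\<Prod>i<Suc k. F i (pr i y)) = (\<Prod>i<Suc k. indicator (E i) (pr i y))"
        using E by (intro prod.cong) auto
      also have "\<dots> = indicator D y"
        by (auto simp: D_def indicator_def lessThan_Suc_atMost)
      finally show ?thesis .
    qed
    then have *: "(\<lambda>y. \<Prod>i<Suc k. F i (pr i y)) = indicator D" by auto
    show ?case unfolding Conv_def * using ind[OF D] lim[OF D] clopens_borel[OF D] N(2) by simp
  next
    case (Suc m)
    then have m: "m \<le> k" "m \<le> Suc k" by auto
    have Fb: "F i \<in> bdd_meas M" if "i \<le> k" for i
      using Suc.prems(2)[of i] Suc.prems(3)[of i] that ind by (cases "i < Suc m") (auto simp: bM)
    then have "\<forall>i. \<exists>B. i \<le> k \<longrightarrow> (\<forall>x. \<bar>F i x\<bar> \<le> B)" unfolding bdd_meas_def by blast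
    then obtain b where b: "\<forall>i. i \<le> k \<longrightarrow> (\<forall>x. \<bar>F i x\<bar> \<le> b i)" by (rule choice[THEN exE])
    define C where "C = (\<Prod>i\<in>{..<Suc k} - {m}. \<bar>b i\<bar>)"
    have C: "\<bar>\<Prod>i\<in>{..<Suc k} - {m}. F i (pr i y)\<bar> \<le> C" for y
      unfolding C_def abs_prod using b by (intro prod_mono) (auto intro: order_trans[OF _ abs_ge_self])
    have C0: "C \<ge> 0" unfolding C_def by (intro prod_nonneg) auto
    show ?case
    proof (rule Conv_approx)
      show "(\<lambda>y. \<Prod>i<Suc k. F i (pr i y)) \<in> bdd_meas borel" by (rule tensor_b[OF Fb])
      fix \<epsilon> :: real assume "\<epsilon> > 0"
      then have e0: "\<epsilon> / (C + 1) > 0" using C0 by simp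
      obtain I c E where I: "finite (I :: int set)" "\<And>j. j \<in> I \<Longrightarrow> E j \<in> clopens"
        "(\<integral>x. \<bar>F m x - (\<Sum>j\<in>I. c j * indicator (E j) x)\<bar> \<partial>M) < \<epsilon> / (C + 1)"
        by (rule clopen_step_dense[OF prob_space_axioms sets_M Fb[OF m(1)] e0]) (rule that)
      define g where "g = (\<lambda>x. \<Sum>j\<in>I. c j * indicator (E j) x :: real)"
      have g: "g \<in> bdd_meas M" unfolding g_def using I ind
        by (intro bdd_meas_sum bdd_meas_cmult) (simp add: bM)
      define w where "w = (\<lambda>x. \<bar>F m x - g x\<bar>)"
      \<comment> \<open>C bounds the product over the other slots, so this dominates the error of
        replacing \<open>F m\<close> by g. It is a function of row m alone: \<open>marg\<close>
        gives its convergence, and the marginal of N turns its integral into one over M.\<close>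
      define h where "h = (\<lambda>x. C * w x)"
      have h: "h \<in> bdd_meas M" unfolding h_def w_def
        by (rule bdd_meas_cmult[OF bdd_meas_abs[OF bdd_meas_diff[OF Fb[OF m(1)] g]]])
      have hN: "(\<integral>y. h (pr m y) \<partial>N) = (\<integral>x. h x \<partial>M)"
        using integral_distr[OF prN[of m], of h] bdd_measD[OF h] distr[OF m(1)] by simp
      have 1: "Conv (\<lambda>y. h (pr m y))"
        unfolding Conv_def hN using marg[OF m(1) h] bdd_meas_comp[OF _ measurable_pr, of h m] h by (simp add: bM)
      have 2: "Conv (\<lambda>y. \<Prod>i<Suc k. (F(m := g)) i (pr i y))"
      proof -
        have "Conv (\<lambda>y. \<Sum>j\<in>I. c j * (\<Prod>i<Suc k. (F(m := indicator (E j))) i (pr i y)))"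
          using Suc.prems I by (intro Conv_sum Suc.IH m) (auto simp: Suc_le_eq)
        also have "(\<lambda>y. \<Sum>j\<in>I. c j * (\<Prod>i<Suc k. (F(m := indicator (E j))) i (pr i y)))
            = (\<lambda>y. \<Prod>i<Suc k. (F(m := g)) i (pr i y))"
          unfolding upd[OF m(1)] by (simp add: g_def sum_distrib_right mult.assoc)
        finally show ?thesis .
      qed
      have 3: "\<bar>(\<Prod>i<Suc k. F i (pr i y)) - (\<Prod>i<Suc k. (F(m := g)) i (pr i y))\<bar> \<le> h (pr m y)" for y
      proof -
        have "(\<Prod>i<Suc k. F i (pr i y)) - (\<Prod>i<Suc k. (F(m := g)) i (pr i y))
            = (F m (pr m y) - g (pr m y)) * (\<Prod>i\<in>{..<Suc k} - {m}. F i (pr i y))"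
          using upd[OF m(1), of F "F m" y] upd[OF m(1), of F g y] by (simp add: left_diff_distrib)
        also have "\<bar>\<dots>\<bar> \<le> \<bar>F m (pr m y) - g (pr m y)\<bar> * C"
          unfolding abs_mult using C by (intro mult_left_mono) auto
        finally show ?thesis by (simp add: h_def w_def mult.commute)
      qed
      have wi: "integral\<^sup>L M w < \<epsilon> / (C + 1)" using I(3) unfolding w_def g_def .
      have w0: "0 \<le> integral\<^sup>L M w" by (rule Bochner_Integration.integral_nonneg) (simp add: w_def)
      have "integral\<^sup>L M h = C * integral\<^sup>L M w" unfolding h_def by (rule integral_mult_right_zero)
      moreover have "C * integral\<^sup>L M w \<le> (C + 1) * integral\<^sup>L M w" using w0 by (rule mult_right_mono[rotated]) simp
      moreover have "(C + 1) * integral\<^sup>L M w < \<epsilon>"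
        using C0 wi by (subst mult.commute, subst pos_less_divide_eq[symmetric]) linarith+
      ultimately have 4: "(\<integral>y. h (pr m y) \<partial>N) < \<epsilon>" unfolding hN by linarith
      show "\<exists>\<Psi>' \<Theta>. Conv \<Psi>' \<and> Conv \<Theta> \<and>
          (\<forall>y. \<bar>(\<Prod>i<Suc k. F i (pr i y)) - \<Psi>' y\<bar> \<le> \<Theta> y) \<and> (\<integral>y. \<Theta> y \<partial>N) < \<epsilon>"
        by (rule exI[of _ "\<lambda>y. \<Prod>i<Suc k. (F(m := g)) i (pr i y)"], rule exI[of _ "\<lambda>y. h (pr m y)"],
            rule conjI[OF 2 conjI[OF 1 conjI[OF allI[OF 3] 4]]])
    qed
  qed
  have "(\<lambda>j. \<integral>x. davg T d (Suc k) F (\<nu> (r j) x) x \<partial>M) \<longlonglongrightarrow> (\<integral>y. (\<Prod>i<Suc k. F i (pr i y)) \<partial>N)"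
    if "\<And>i. i \<le> k \<Longrightarrow> F i \<in> bdd_meas M" for F
    using tensor[of "Suc k" F] that unfolding Conv_def q_def e_def davg_orb by simp
  with r sys distr show ?thesis by (rule that)
qed

end

section \<open>Induction on the number of functions\<close>

lemma condexp_funpow:
  assumes S: "mpres N S" and T: "mpres M T"
    and inv: "T' \<in> measurable M M" "\<And>x. T' (T x) = x"
    and eq: "\<And>y. \<pi> (S y) = T (\<pi> y)" and \<pi>: "\<pi> \<in> measurable N M"
    and c: "condexp N M \<pi> G s"
  shows "condexp N M \<pi> (\<lambda>y. G ((S ^^ n) y)) (\<lambda>x. s ((T ^^ n) x))"
proof (induction n)
  case (Suc n)
  show ?case
    using condexp_shift[OF Suc S T inv eq \<pi>] by (simp only: funpow_swap1 funpow.simps o_apply)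
qed (simp add: c)

lemma condexp_mavg:
  assumes NM: "finite_measure N" "finite_measure M"
    and S: "\<And>j. j < d \<Longrightarrow> mpres N (S j)" and T: "\<And>j. j < d \<Longrightarrow> mpres M (T j)"
    and inv: "\<And>j. j < d \<Longrightarrow> T' j \<in> measurable M M" "\<And>j x. j < d \<Longrightarrow> T' j (T j x) = x"
    and eq: "\<And>j y. j < d \<Longrightarrow> \<pi> (S j y) = T j (\<pi> y)" and \<pi>: "\<pi> \<in> measurable N M"
    and c: "condexp N M \<pi> G s"
  shows "condexp N M \<pi> (mavg S d n G) (mavg T d n s)"
  using S T inv eq
proof (induction d)
  case (Suc d)
  have "condexp N M \<pi> (mavg S d n G) (mavg T d n s)" using Suc by simp
  then have "condexp N M \<pi> (\<lambda>y. mavg S d n G ((S d ^^ i) y)) (\<lambda>x. mavg T d n s ((T d ^^ i) x))" for i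
    by (rule condexp_funpow[where T'="T' d", rotated -1]) (use Suc.prems \<pi> in auto)
  then show ?case unfolding mavg.simps cavg_def by (intro condexp_divide condexp_sum NM \<pi>)
qed (simp add: c)

lemma davg_upd:
  "davg T d (Suc k) (f(k := w)) N =
     eavg T d N (\<lambda>n y. (\<Prod>i<k. f i ((T i ^^ n) y)) * w ((T k ^^ n) y))"
proof -
  have "(\<Prod>i<k. (f(k := w)) i ((T i ^^ n) y)) = (\<Prod>i<k. f i ((T i ^^ n) y))" for n y
    by (intro prod.cong) auto
  then show ?thesis by (simp add: davg_def)
qed

lemma davg_upd_add:
  "davg T d (Suc k) (f(k := \<lambda>x. u x + w x)) N x =
     davg T d (Suc k) (f(k := u)) N x + davg T d (Suc k) (f(k := w)) N x"
  unfolding davg_upd by (simp add: distrib_left eavg_add)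

lemma davg_upd_cmult:
  "davg T d (Suc k) (f(k := \<lambda>x. c * w x)) N x = c * davg T d (Suc k) (f(k := w)) N x"
  unfolding davg_upd by (simp add: eavg_cmult mult.left_commute)

lemma davg_scale:
  "davg T d k (\<lambda>i x. c i * f i x) N x = (\<Prod>i<k. c i) * davg T d k f N x"
  unfolding davg_def by (simp add: prod.distrib eavg_cmult)

lemma davg_bound:
  assumes "\<And>i x. i < k \<Longrightarrow> \<bar>f i x\<bar> \<le> B i"
  shows "\<bar>davg T d k f N x\<bar> \<le> (\<Prod>i<k. B i)"
  unfolding davg_def using assms by (intro eavg_bound) (auto simp: abs_prod intro!: prod_mono)

lemma davg_bound1:
  assumes "\<And>i x. i < k \<Longrightarrow> \<bar>f i x\<bar> \<le> 1"
  shows "\<bar>davg T d k f N x\<bar> \<le> 1"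
  using davg_bound[of k f "\<lambda>_. 1"] assms by simp

lemma davg_upd_bound:
  assumes "\<And>i x. i < k \<Longrightarrow> \<bar>f i x\<bar> \<le> 1" "\<And>x. \<bar>w x\<bar> \<le> B"
  shows "\<bar>davg T d (Suc k) (f(k := w)) N x\<bar> \<le> B"
proof -
  have "\<bar>davg T d (Suc k) (f(k := w)) N x\<bar> \<le> (\<Prod>i<Suc k. if i = k then B else 1)"
    using assms by (intro davg_bound) (auto simp: less_Suc_eq)
  also have "(\<Prod>i<k. if i = k then B else 1) = (\<Prod>i<k. 1)" by (intro prod.cong) auto
  then have "(\<Prod>i<Suc k. if i = k then B else 1) = B" by simp
  finally show ?thesis .
qed

context cantor_system
begin

text \<open>The assumption \<open>small\<close> concerns only functions s whose own averages
  converge. The conditional expectation produced by the joining qualifies, its averages being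
  conditional expectations of averages of k functions on the joining.\<close>

lemma integral_limsup_davg_le:
  assumes k: "k < d"
    and IH: "\<And>N T' F. cantor_system N d T' \<Longrightarrow> (\<And>i. i < k \<Longrightarrow> F i \<in> bdd_meas N) \<Longrightarrow>
        AE y in N. convergent (\<lambda>n. davg T' d k F n y)"
    and f: "\<And>i. i < k \<Longrightarrow> f i \<in> bdd_meas M" "\<And>i x. i < k \<Longrightarrow> \<bar>f i x\<bar> \<le> 1"
    and u: "u \<in> bdd_meas M"
    and small: "\<And>s. s \<in> bdd_meas M \<Longrightarrow> (\<And>x. \<bar>s x\<bar> \<le> 1) \<Longrightarrow>
        AE x in M. convergent (\<lambda>n. davg T d (Suc k) (f(k := s)) n x) \<Longrightarrow> (\<integral>x. u x * s x \<partial>M) \<le> \<delta>"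
  shows "(\<integral>x. rlimsup (\<lambda>n. davg T d (Suc k) (f(k := u)) n x) \<partial>M) \<le> \<delta>"
proof (rule field_le_epsilon)
  fix e :: real assume "e > 0"
  obtain B where B: "\<And>x. \<bar>u x\<bar> \<le> B" using bdd_meas_bound[OF u] by metis
  define a where "a = davg T d (Suc k) (f(k := u))"
  have fu: "(f(k := u)) i \<in> bdd_meas M" if "i < Suc k" for i using that f(1)[of i] u by auto
  have am: "a n \<in> bdd_meas M" for n unfolding a_def using k by (intro bdd_meas_davg fu) auto
  have aB: "\<bar>a n x\<bar> \<le> B" for n x unfolding a_def by (intro davg_upd_bound f(2) B)
  have [measurable]: "a n \<in> borel_measurable M" for n using am by (rule bdd_measD)
  obtain \<nu> where \<nu>: "\<And>L. \<nu> L \<in> measurable M (count_space UNIV)" "\<And>L x. \<nu> L x \<ge> L" "\<And>L x. \<nu> L x \<ge> 1"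
    "\<And>L x. a (\<nu> L x) x > rlimsup (\<lambda>N. a N x) - e"
    by (rule limsup_selector[where a=a and M=M, OF _ aB \<open>e > 0\<close>]) (measurable, blast)
  obtain N r where r: "strict_mono r" and sys: "cantor_system N d (ext T k)"
    and distr: "\<And>i. i \<le> k \<Longrightarrow> distr N M (pr i) = M"
    and lim: "\<And>F. (\<And>i. i \<le> k \<Longrightarrow> F i \<in> bdd_meas M) \<Longrightarrow>
       (\<lambda>j. \<integral>x. davg T d (Suc k) F (\<nu> (r j) x) x \<partial>M) \<longlonglongrightarrow> (\<integral>y. (\<Prod>i<Suc k. F i (pr i y)) \<partial>N)"
  proof (rule empirical_joining[OF k \<nu>(1,2,3)], goal_cases)
    case (1 N r)
    show ?case by (rule 1(1)) (fact 1(2) 1(3) 1(4) 1(5))+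
  qed
  interpret Y: cantor_system N d "ext T k" by (rule sys)
  have prN: "pr i \<in> measurable N M" for i
    using measurable_pr measurable_cong_sets[OF Y.sets_M sets_M] by blast
  define G where "G = (\<lambda>y. \<Prod>i<k. f i (pr i y))"
  have G: "G \<in> bdd_meas N" unfolding G_def
  proof (rule bdd_meas_prod)
    fix i assume "i \<in> {..<k}"
    then show "(\<lambda>y. f i (pr i y)) \<in> bdd_meas N" using bdd_meas_comp[OF f(1) prN] by auto
  qed
  have G1: "\<bar>G y\<bar> \<le> 1" for y unfolding G_def abs_prod using f(2) by (intro prod_le_1) auto
  obtain s where s: "condexp N M (pr k) G s" "\<And>x. \<bar>s x\<bar> \<le> 1"
    by (rule condexp_exists[OF prob_space_axioms Y.prob_space_axioms prN distr[OF order_refl] G G1]) (rule that)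
  have "AE x in M. convergent (\<lambda>n. davg T d (Suc k) (f(k := s)) n x)"
  proof (rule condexp_AE_convergent[OF prob_space_axioms Y.prob_space_axioms prN[of k]])
    \<comment> \<open>The factor at \<open>pr k\<close> yields \<open>f i\<close> along the orbit of
      the base point, since \<open>pr k\<close> intertwines the extension with T. The factor at
      \<open>pr i\<close> is the contribution of \<open>f i\<close> to G.\<close>
    define F where "F = (\<lambda>i y. f i (pr k y) * f i (pr i y))"
    have Fb: "F i \<in> bdd_meas N" if "i < k" for i
      unfolding F_def by (rule bdd_meas_mult[OF bdd_meas_comp[OF f(1)[OF that] prN] bdd_meas_comp[OF f(1)[OF that] prN]])
    show "AE y in N. convergent (\<lambda>n. davg (ext T k) d k F n y)" by (rule IH[OF sys Fb])
    have "\<bar>F i y\<bar> \<le> 1" if "i < k" for i y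
      unfolding F_def abs_mult using f(2)[OF that] by (intro mult_le_one) auto
    then show "\<bar>davg (ext T k) d k F n y\<bar> \<le> 1" for n y by (intro davg_bound1)
    show "\<bar>davg T d (Suc k) (f(k := s)) n x\<bar> \<le> 1" for n x by (intro davg_upd_bound f(2) s(2))
    have prk: "pr k (ext T k j y) = T j (pr k y)" for j y by (simp add: ext_def)
    have pri: "pr i (ext T k k y) = T i (pr i y)" "pr i (ext T k i y) = T i (pr i y)" if "i < k" for i y
      using that by (simp_all add: ext_def min_def)
    have prkn: "pr k ((ext T k j ^^ n) y) = (T j ^^ n) (pr k y)" for j n y
      by (induction n) (simp_all add: prk)
    have prin: "pr i ((ext T k k ^^ n) y) = (T i ^^ n) (pr i y)" "pr i ((ext T k i ^^ n) y) = (T i ^^ n) (pr i y)"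
      if "i < k" for i n y
      by (induction n) (simp_all add: pri[OF that])
    have inv: "inv (T j) \<in> measurable M M" "inv (T j) (T j x) = x" if "j < d" for j x
      using measurable_continuous[OF cont_inv[OF that]] measurable_cong_sets[OF refl sets_M]
        bij_is_inj[OF bij[OF that]] by auto
    fix n
    have 1: "condexp N M (pr k)
        (\<lambda>y. (\<Prod>i<k. f i ((T i ^^ n) (pr k y))) * G ((ext T k k ^^ n) y))
        (\<lambda>x. (\<Prod>i<k. f i ((T i ^^ n) x)) * s ((T k ^^ n) x))" for n
    proof (rule condexp_mult[OF condexp_funpow[where T'="inv (T k)"]])
      show "(\<lambda>x. \<Prod>i<k. f i ((T i ^^ n) x)) \<in> bdd_meas M"
      proof (rule bdd_meas_prod)
        fix i assume "i \<in> {..<k}"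
        then have "i < k" "i < d" using k by auto
        then show "(\<lambda>y. f i ((T i ^^ n) y)) \<in> bdd_meas M"
          using bdd_meas_comp[OF f(1) mpres_measurable[OF mpres_pow[OF mp]]] by blast
      qed
    qed (use Y.mp mp inv k prN s prk in auto)
    \<comment> \<open>For i < k both \<open>ext T k k\<close> and \<open>ext T k i\<close> move row
      i by \<open>T i\<close>. Hence G along the single transformation k can be rewritten with
      transformation i in its i-th factor, leaving no separate factor for transformation k.\<close>
    have 2: "(\<Prod>i<k. F i ((ext T k i ^^ n) y)) = (\<Prod>i<k. f i ((T i ^^ n) (pr k y))) * G ((ext T k k ^^ n) y)" for n y
      unfolding F_def G_def prod.distrib prkn by (intro arg_cong2[where f="(*)"] prod.cong) (auto simp: prin)
    have "condexp N M (pr k)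
        (mavg (ext T k) d n (\<lambda>y. \<Prod>i<k. F i ((ext T k i ^^ m) y)))
        (mavg T d n (\<lambda>x. (\<Prod>i<k. f i ((T i ^^ m) x)) * s ((T k ^^ m) x)))" for m
      unfolding 2
      by (rule condexp_mavg[where T'="\<lambda>j. inv (T j)", OF Y.finite_measure_axioms finite_measure_axioms
            Y.mp mp inv prk prN 1])
    then show "condexp N M (pr k) (davg (ext T k) d k F n) (davg T d (Suc k) (f(k := s)) n)"
      unfolding davg_upd unfolding davg_def eavg_def
      by (intro condexp_divide condexp_sum prN Y.finite_measure_axioms finite_measure_axioms)
  qed
  then have us: "(\<integral>x. u x * s x \<partial>M) \<le> \<delta>" using condexpD(2)[OF s(1)] s(2) by (intro small)
  have "(\<Prod>i<k. (f(k := u)) i (pr i y)) = G y" for y unfolding G_def by (intro prod.cong) auto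
  then have tp: "(\<Prod>i<Suc k. (f(k := u)) i (pr i y)) = u (pr k y) * G y" for y by simp
  have "(\<lambda>j. \<integral>x. a (\<nu> (r j) x) x \<partial>M) \<longlonglongrightarrow> (\<integral>x. u x * s x \<partial>M)"
    using lim[of "f(k := u)", OF fu] unfolding tp condexpD(3)[OF s(1) u] a_def by (simp only: less_Suc_eq_le)
  then have l: "(\<lambda>j. (\<integral>x. a (\<nu> (r j) x) x \<partial>M) + e) \<longlonglongrightarrow> (\<integral>x. u x * s x \<partial>M) + e"
    by (intro tendsto_intros)
  \<comment> \<open>The selection property holds for every L, so the bound persists in the limit
    along r.\<close>
  have "(\<integral>x. rlimsup (\<lambda>n. a n x) \<partial>M) \<le> (\<integral>x. a (\<nu> L x) x \<partial>M) + e" for L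
  proof -
    note [measurable] = \<nu>(1)
    have [measurable]: "(\<lambda>x. a (\<nu> L x) x) \<in> borel_measurable M"
      by (rule measurable_compose_countable[where g="\<nu> L"]) auto
    have i: "integrable M (\<lambda>x. rlimsup (\<lambda>n. a n x))" "integrable M (\<lambda>x. a (\<nu> L x) x)"
      by (rule integrable_bdd_meas, rule bdd_measI[where B=B], measurable, (rule rlimsup_ereal(2) aB)+)+
    have "(\<integral>x. rlimsup (\<lambda>n. a n x) \<partial>M) \<le> (\<integral>x. a (\<nu> L x) x + e \<partial>M)"
      using i \<nu>(4)[of _ L] by (intro integral_mono) (auto simp: less_diff_eq diff_less_eq intro: less_imp_le)
    also have "\<dots> = (\<integral>x. a (\<nu> L x) x \<partial>M) + e" using i prob_space by simp
    finally show ?thesis .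
  qed
  then have "(\<integral>x. rlimsup (\<lambda>n. a n x) \<partial>M) \<le> (\<integral>x. u x * s x \<partial>M) + e"
    using LIMSEQ_le_const[OF l] by blast
  then show "(\<integral>x. rlimsup (\<lambda>n. davg T d (Suc k) (f(k := u)) n x) \<partial>M) \<le> \<delta> + e"
    using us unfolding a_def by linarith
qed

lemma AE_convergent_davg_step:
  assumes k: "k < d"
    and IH: "\<And>N T' F. cantor_system N d T' \<Longrightarrow> (\<And>i. i < k \<Longrightarrow> F i \<in> bdd_meas N) \<Longrightarrow>
        AE y in N. convergent (\<lambda>n. davg T' d k F n y)"
    and f: "\<And>i. i < k \<Longrightarrow> f i \<in> bdd_meas M" "\<And>i x. i < k \<Longrightarrow> \<bar>f i x\<bar> \<le> 1"
    and g: "g \<in> bdd_meas M"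
  shows "AE x in M. convergent (\<lambda>n. davg T d (Suc k) (f(k := g)) n x)"
proof -
  define a where "a = (\<lambda>w. davg T d (Suc k) (f(k := w)))"
  define V where "V = {w \<in> bdd_meas M. AE x in M. convergent (\<lambda>n. a w n x)}"
  have a_add: "a (\<lambda>x. u x + w x) n x = a u n x + a w n x" for u w n x unfolding a_def by (rule davg_upd_add)
  have a_cmult: "a (\<lambda>x. c * w x) n x = c * a w n x" for c w n x unfolding a_def by (rule davg_upd_cmult)
  have V_comb: "(\<lambda>x. u x + c * w x) \<in> V" if "u \<in> V" "w \<in> V" for u w c
  proof -
    have "AE x in M. convergent (\<lambda>n. a u n x)" "AE x in M. convergent (\<lambda>n. a w n x)" using that by (auto simp: V_def)
    then have "AE x in M. convergent (\<lambda>n. a (\<lambda>x. u x + c * w x) n x)"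
    proof eventually_elim
      case (elim x)
      then show ?case unfolding a_add a_cmult by (intro convergent_add convergent_mult convergent_const)
    qed
    then show ?thesis using that by (auto simp: V_def intro!: bdd_meas_add bdd_meas_cmult)
  qed
  have V0: "(\<lambda>x. 0) \<in> V" using a_cmult[of 0] by (simp add: V_def convergent_const)
  have am: "a w n \<in> bdd_meas M" if "w \<in> bdd_meas M" for w n
    unfolding a_def using k f(1) that by (intro bdd_meas_davg) (auto simp: less_Suc_eq)
  have aB: "\<bar>a w n x\<bar> \<le> B" if "\<And>x. \<bar>w x\<bar> \<le> B" for w n x B
    unfolding a_def by (intro davg_upd_bound f(2) that)
  have rl: "(\<lambda>x. rlimsup (\<lambda>n. a w n x)) \<in> bdd_meas M" if w: "w \<in> bdd_meas M" for w
  proof -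
    obtain B where B: "\<And>x. \<bar>w x\<bar> \<le> B" using bdd_meas_bound[OF w] by metis
    show ?thesis
      by (rule bdd_measI[where B=B, OF borel_measurable_rlimsup rlimsup_ereal(2)])
        (rule bdd_measD[OF am[OF w]], rule aB[OF B])
  qed
  define E where "E = (\<lambda>w. \<integral>x. (g x - w x)\<^sup>2 \<partial>M)"
  have E0: "E w \<ge> 0" for w unfolding E_def by (rule Bochner_Integration.integral_nonneg) simp
  define E' where "E' = (INF w\<in>V. E w)"
  have E': "E' \<le> E w" if "w \<in> V" for w
    unfolding E'_def using that E0 by (intro cINF_lower bdd_belowI2[where m=0])
  have main: "(\<integral>x. rlimsup (\<lambda>n. a g n x) \<partial>M) + (\<integral>x. rlimsup (\<lambda>n. - a g n x) \<partial>M) \<le> 0 + e" if "e > 0" for e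
  proof -
    define \<delta> where "\<delta> = e / 2"
    have \<delta>: "\<delta> > 0" "e = \<delta> + \<delta>" using that by (auto simp: \<delta>_def)
    \<comment> \<open>Passing from C to C + \<delta> s changes the squared distance by -2 \<delta>
      (u, s) + \<delta>^2 (s, s). With (s, s) \<le> 1, the margin \<delta>^2 turns near-minimality
      into (u, s) < \<delta>.\<close>
    have "\<exists>C\<in>V. E C < E' + \<delta>\<^sup>2"
    proof (rule ccontr)
      assume "\<not> ?thesis"
      then have "E' + \<delta>\<^sup>2 \<le> E'" unfolding E'_def using V0 by (intro cINF_greatest) (auto simp: not_less)
      then show False using \<delta> by simp
    qed
    then obtain C where C: "C \<in> V" "E C < E' + \<delta>\<^sup>2" by blast
    have Cb: "C \<in> bdd_meas M" using C by (simp add: V_def)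
    define u where "u = (\<lambda>x. g x - C x)"
    have u: "u \<in> bdd_meas M" unfolding u_def by (rule bdd_meas_diff[OF g Cb])
    have small: "(\<integral>x. u x * s x \<partial>M) \<le> \<delta>" if s: "s \<in> V" "\<And>x. \<bar>s x\<bar> \<le> 1" for s
    proof -
      have sb: "s \<in> bdd_meas M" using s by (simp add: V_def)
      have i: "integrable M (\<lambda>x. u x * u x)" "integrable M (\<lambda>x. u x * s x)" "integrable M (\<lambda>x. s x * s x)"
        by (intro integrable_bdd_meas bdd_meas_mult u sb)+
      have "(\<integral>x. s x * s x \<partial>M) \<le> (\<integral>x. 1 \<partial>M)"
        using i s(2) by (intro integral_mono) (auto simp: abs_le_square_iff[of _ 1, simplified] simp flip: power2_eq_square)
      then have ss: "(\<integral>x. s x * s x \<partial>M) \<le> 1" using prob_space by simp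
      have "E' \<le> E (\<lambda>x. C x + \<delta> * s x)" by (rule E'[OF V_comb[OF C(1) s(1)]])
      also have "\<dots> = (\<integral>x. u x * u x - 2 * \<delta> * (u x * s x) + \<delta>\<^sup>2 * (s x * s x) \<partial>M)"
        unfolding E_def u_def
        by (intro Bochner_Integration.integral_cong refl) (simp add: power2_eq_square algebra_simps)
      also have "\<dots> = E C - 2 * \<delta> * (\<integral>x. u x * s x \<partial>M) + \<delta>\<^sup>2 * (\<integral>x. s x * s x \<partial>M)"
        using i by (simp add: E_def u_def power2_eq_square)
      also have "\<dots> < (E' + \<delta>\<^sup>2) - 2 * \<delta> * (\<integral>x. u x * s x \<partial>M) + \<delta>\<^sup>2 * 1"
        using C(2) mult_left_mono[OF ss, of "\<delta>\<^sup>2"] by simp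
      finally have "2 * (\<delta> * (\<integral>x. u x * s x \<partial>M)) < 2 * (\<delta> * \<delta>)" by (simp add: power2_eq_square)
      then have "(\<integral>x. u x * s x \<partial>M) < \<delta>" using \<delta>(1) by simp
      then show ?thesis by simp
    qed
    have 1: "(\<integral>x. rlimsup (\<lambda>n. a u n x) \<partial>M) \<le> \<delta>"
      unfolding a_def by (rule integral_limsup_davg_le[OF k IH f u]) (auto intro: small simp: V_def a_def)
    have 2: "(\<integral>x. rlimsup (\<lambda>n. a (\<lambda>x. - u x) n x) \<partial>M) \<le> \<delta>"
      unfolding a_def
    proof (rule integral_limsup_davg_le[OF k IH f bdd_meas_uminus[OF u]])
      fix s assume s: "s \<in> bdd_meas M" "\<And>x. \<bar>s x\<bar> \<le> 1" "AE x in M. convergent (\<lambda>n. davg T d (Suc k) (f(k := s)) n x)"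
      then have "s \<in> V" by (simp add: V_def a_def)
      \<comment> \<open>Since V is symmetric, the one-sided bound \<open>small\<close> also serves
        for - u.\<close>
      from V_comb[OF V0 this, of "-1"] have "(\<lambda>x. - s x) \<in> V" by simp
      from small[OF this] show "(\<integral>x. - u x * s x \<partial>M) \<le> \<delta>" using s(2) by simp
    qed
    obtain B where B: "\<And>x. \<bar>C x\<bar> \<le> B" using bdd_meas_bound[OF Cb] by metis
    obtain D where D: "\<And>x. \<bar>u x\<bar> \<le> D" using bdd_meas_bound[OF u] by metis
    have um: "a (\<lambda>x. - w x) n x = - a w n x" for w n x using a_cmult[of "-1"] by simp
    have gs: "a g n x = a C n x + a u n x" for n x using a_add[of C u] by (simp add: u_def)
    have le1: "rlimsup (\<lambda>n. a g n x) \<le> rlimsup (\<lambda>n. a C n x) + rlimsup (\<lambda>n. a u n x)" for x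
      unfolding gs by (rule rlimsup_add_le[OF aB[OF B] aB[OF D]])
    have le2: "rlimsup (\<lambda>n. a (\<lambda>x. - g x) n x) \<le> rlimsup (\<lambda>n. a (\<lambda>x. - C x) n x) + rlimsup (\<lambda>n. a (\<lambda>x. - u x) n x)" for x
    proof -
      have "a (\<lambda>x. - g x) n x = a (\<lambda>x. - C x) n x + a (\<lambda>x. - u x) n x" for n x by (simp add: um gs)
      then show ?thesis using B D by (simp only:) (intro rlimsup_add_le[where B=B and C=D] aB; simp)
    qed
    note b = rl[THEN integrable_bdd_meas]
    note b' = b[OF g] b[OF Cb] b[OF u] b[OF bdd_meas_uminus[OF g]] b[OF bdd_meas_uminus[OF Cb]] b[OF bdd_meas_uminus[OF u]]
    have "(\<integral>x. rlimsup (\<lambda>n. a g n x) \<partial>M) \<le> (\<integral>x. rlimsup (\<lambda>n. a C n x) + rlimsup (\<lambda>n. a u n x) \<partial>M)"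
      using b' le1 by (intro integral_mono) auto
    also have "\<dots> = (\<integral>x. rlimsup (\<lambda>n. a C n x) \<partial>M) + (\<integral>x. rlimsup (\<lambda>n. a u n x) \<partial>M)"
      by (rule Bochner_Integration.integral_add[OF b'(2,3)])
    finally have 3: "(\<integral>x. rlimsup (\<lambda>n. a g n x) \<partial>M) \<le> (\<integral>x. rlimsup (\<lambda>n. a C n x) \<partial>M) + \<delta>" using 1 by linarith
    have "(\<integral>x. rlimsup (\<lambda>n. a (\<lambda>x. - g x) n x) \<partial>M)
        \<le> (\<integral>x. rlimsup (\<lambda>n. a (\<lambda>x. - C x) n x) + rlimsup (\<lambda>n. a (\<lambda>x. - u x) n x) \<partial>M)"
      using b' le2 by (intro integral_mono) auto
    also have "\<dots> = (\<integral>x. rlimsup (\<lambda>n. a (\<lambda>x. - C x) n x) \<partial>M) + (\<integral>x. rlimsup (\<lambda>n. a (\<lambda>x. - u x) n x) \<partial>M)"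
      by (rule Bochner_Integration.integral_add[OF b'(5,6)])
    finally have 4: "(\<integral>x. rlimsup (\<lambda>n. a (\<lambda>x. - g x) n x) \<partial>M) \<le> (\<integral>x. rlimsup (\<lambda>n. a (\<lambda>x. - C x) n x) \<partial>M) + \<delta>"
      using 2 by linarith
    \<comment> \<open>Convergence for C makes its two limsups cancel, leaving only the two errors
      \<delta>.\<close>
    have convC: "AE x in M. convergent (\<lambda>n. a C n x)" using C by (simp add: V_def)
    have "AE x in M. rlimsup (\<lambda>n. a (\<lambda>x. - C x) n x) = - rlimsup (\<lambda>n. a C n x)"
      unfolding um by (rule AE_rlimsup_uminus[OF aB[OF B] convC])
    then have "(\<integral>x. rlimsup (\<lambda>n. a (\<lambda>x. - C x) n x) \<partial>M) = (\<integral>x. - rlimsup (\<lambda>n. a C n x) \<partial>M)"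
      using b'(2,5) by (intro integral_cong_AE) (auto dest: borel_measurable_integrable)
    then show ?thesis using 3 4 unfolding um \<delta>(2) by simp
  qed
  obtain B where B: "\<And>x. \<bar>g x\<bar> \<le> B" using bdd_meas_bound[OF g] by metis
  have "AE x in M. convergent (\<lambda>n. a g n x)"
  proof (rule AE_convergent_integral_rlimsup)
    show "a g n \<in> borel_measurable M" for n by (rule bdd_measD[OF am[OF g]])
    show "\<bar>a g n x\<bar> \<le> B" for n x by (rule aB[OF B])
    show "(\<integral>x. rlimsup (\<lambda>n. a g n x) \<partial>M) + (\<integral>x. rlimsup (\<lambda>n. - a g n x) \<partial>M) \<le> 0"
      using main by (rule field_le_epsilon)
  qed
  then show ?thesis unfolding a_def .
qed

end

text \<open>The induction quantifies over M, T and f, because the step invokes its hypothesis on the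
  joining. Multilinearity permits rescaling all functions to bound 1.\<close>

theorem cantor_davg_AE_convergent:
  assumes "cantor_system M d T" "k \<le> d" "\<And>i. i < k \<Longrightarrow> f i \<in> bdd_meas M"
  shows "AE x in M. convergent (\<lambda>n. davg T d k f n x)"
  using assms
proof (induction k arbitrary: M T f)
  case 0
  have "(\<lambda>n. davg T d 0 f n x) \<longlonglongrightarrow> 1" for x
    unfolding davg_def by (intro tendsto_eventually eventually_sequentiallyI[of 1]) (simp add: eavg_const)
  then show ?case by (auto intro: convergentI)
next
  case (Suc k)
  interpret cantor_system M d T by fact
  have "\<forall>i. \<exists>b. i < Suc k \<longrightarrow> (\<forall>x. \<bar>f i x\<bar> \<le> b)" using Suc.prems(3) unfolding bdd_meas_def by blast
  then obtain b where b: "\<forall>i. i < Suc k \<longrightarrow> (\<forall>x. \<bar>f i x\<bar> \<le> b i)" by (rule choice[THEN exE])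
  define c where "c = (\<lambda>i. \<bar>b i\<bar> + 1)"
  have c: "c i > 0" for i by (simp add: c_def)
  define h where "h = (\<lambda>i x. f i x / c i)"
  have h: "h i \<in> bdd_meas M" if "i < Suc k" for i
    unfolding h_def by (rule bdd_meas_divide[OF Suc.prems(3)[OF that]])
  have h1: "\<bar>h i x\<bar> \<le> 1" if "i < Suc k" for i x
  proof -
    have "\<bar>f i x\<bar> \<le> c i" using b that unfolding c_def by (meson abs_ge_self le_add_same_cancel1 order_trans zero_le_one)
    then show ?thesis using c[of i] by (simp add: h_def)
  qed
  have "AE x in M. convergent (\<lambda>n. davg T d (Suc k) (h(k := h k)) n x)"
  proof (rule AE_convergent_davg_step)
    show "AE y in N. convergent (\<lambda>n. davg T' d k F n y)"
      if "cantor_system N d T'" "\<And>i. i < k \<Longrightarrow> F i \<in> bdd_meas N" for N T' F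
      using Suc.IH[OF that(1) _ that(2)] Suc.prems(2) by simp
  qed (use Suc.prems h h1 in auto)
  then have "AE x in M. convergent (\<lambda>n. (\<Prod>i<Suc k. c i) * davg T d (Suc k) h n x)"
    by eventually_elim (simp only: fun_upd_triv, intro convergent_mult convergent_const)
  moreover have "(\<lambda>i x. c i * h i x) = f" using c by (auto simp: h_def less_imp_neq[OF c, symmetric])
  ultimately show ?case by (simp only: davg_scale[symmetric])
qed

section \<open>Coding an arbitrary system into the Cantor space\<close>

lemma mavg_semiconj:
  assumes "\<And>j x. j < d \<Longrightarrow> \<Phi> (S j x) = T j (\<Phi> x)"
  shows "mavg T d N h (\<Phi> x) = mavg S d N (\<lambda>x. h (\<Phi> x)) x"
  using assms
proof (induction d arbitrary: x)
  case (Suc d)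
  have "(T d ^^ n) (\<Phi> x) = \<Phi> ((S d ^^ n) x)" for n
    by (induction n) (simp_all add: Suc.prems)
  then show ?case using Suc by (simp add: cavg_def)
qed simp

lemma davg_semiconj:
  assumes S: "\<And>j x. j < d \<Longrightarrow> \<Phi> (S j x) = T j (\<Phi> x)" and h: "\<And>i x. i < k \<Longrightarrow> h i (\<Phi> x) = g i x" and "k \<le> d"
  shows "davg T d k h N (\<Phi> x) = davg S d k g N x"
proof -
  have "(T i ^^ n) (\<Phi> x) = \<Phi> ((S i ^^ n) x)" if "i < d" for i n x
    by (induction n) (simp_all add: S that)
  then have "(\<Prod>i<k. h i ((T i ^^ n) (\<Phi> x))) = (\<Prod>i<k. g i ((S i ^^ n) x))" for n x
    using assms by (intro prod.cong) auto
  moreover have "mavg T d N F (\<Phi> x) = mavg S d N (\<lambda>x. F (\<Phi> x)) x" for F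
    by (rule mavg_semiconj) (rule S)
  ultimately show ?thesis unfolding davg_def eavg_def by simp
qed

text \<open>Recovers a real number from the bits telling which rationals lie below it. Clipping
  keeps the decoded value in [-B, B] even for bit patterns that are not cuts, so the decoded
  function is bounded on the whole Cantor space.\<close>

definition clip_sup :: "real \<Rightarrow> (rat \<Rightarrow> bool) \<Rightarrow> real" where
  "clip_sup B P = (SUP q. if P q then min B (max (- B) (of_rat q)) else - B)"

lemma clip_sup_cut:
  assumes "\<bar>y\<bar> \<le> B" shows "clip_sup B (\<lambda>q. of_rat q < y) = y"
  unfolding clip_sup_def
proof (rule antisym)
  show "(SUP q. if of_rat q < y then min B (max (- B) (of_rat q)) else - B) \<le> y"
    using assms by (intro cSUP_least) (auto simp: abs_le_iff)
  show "y \<le> (SUP q. if of_rat q < y then min B (max (- B) (of_rat q)) else - B)"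
  proof (rule dense_le)
    fix r assume "r < y"
    then obtain q where q: "r < of_rat q" "of_rat q < y" using of_rat_dense by blast
    have "of_rat q \<le> (if of_rat q < y then min B (max (- B) (of_rat q)) else - B)"
      using q assms by auto
    also have "\<dots> \<le> (SUP q. if of_rat q < y then min B (max (- B) (of_rat q)) else - B)"
      using assms by (intro cSUP_upper bdd_aboveI2[where M=B]) auto
    finally show "r \<le> (SUP q. if of_rat q < y then min B (max (- B) (of_rat q)) else - B)" using q by simp
  qed
qed

lemma clip_sup_bound:
  assumes "B \<ge> 0" shows "\<bar>clip_sup B P\<bar> \<le> B"
proof -
  have "(if P 0 then min B (max (- B) (of_rat 0)) else - B) \<le> clip_sup B P"
    unfolding clip_sup_def using assms by (intro cSUP_upper bdd_aboveI2[where M=B]) auto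
  moreover have "- B \<le> (if P 0 then min B (max (- B) (of_rat 0)) else - B)" using assms by auto
  moreover have "clip_sup B P \<le> B" unfolding clip_sup_def using assms by (intro cSUP_least) auto
  ultimately show ?thesis by (simp add: abs_le_iff)
qed

text \<open>The symbolic coding: a point \<^term>\<open>x\<close> is sent to the family of all bits
  \<^term>\<open>of_rat q < g i (U x)\<close>, where \<^term>\<open>U\<close> ranges over the (countable) group generated by the
  transformations; translation by a generator then permutes the coordinates.\<close>

lemma davg_AE_convergent:
  fixes S :: "nat \<Rightarrow> 'a \<Rightarrow> 'a"
  assumes M: "prob_space M"
    and mp: "\<And>i. i < d \<Longrightarrow> mpres M (S i)" and bij: "\<And>i. i < d \<Longrightarrow> bij (S i)"
    and inv: "\<And>i. i < d \<Longrightarrow> inv (S i) \<in> measurable M M"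
    and comm: "\<And>i j x. i < d \<Longrightarrow> j < d \<Longrightarrow> S i (S j x) = S j (S i x)"
    and g: "\<And>i. i < d \<Longrightarrow> g i \<in> bdd_meas M"
  shows "AE x in M. convergent (\<lambda>n. davg S d d g n x)"
proof -
  interpret prob_space M by fact
  have "\<forall>i. \<exists>b. i < d \<longrightarrow> b \<ge> 0 \<and> (\<forall>x. \<bar>g i x\<bar> \<le> b)" using g by (metis bdd_meas_bound)
  then obtain B where B: "\<forall>i. i < d \<longrightarrow> B i \<ge> 0 \<and> (\<forall>x. \<bar>g i x\<bar> \<le> B i)" by (rule choice[THEN exE])
  \<comment> \<open>Inverses are included so that translation by a generator is invertible on the
    index set.\<close>
  define gen where "gen = (\<lambda>p::bool \<times> nat. if fst p then S (snd p) else inv (S (snd p)))"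
  define ev where "ev = (\<lambda>w. foldr (\<lambda>p h. gen p \<circ> h) w id)"
  have ev_snoc: "ev (w @ [p]) = ev w \<circ> gen p" for w p
    unfolding ev_def by (induction w) (auto simp: comp_assoc)
  define W where "W = ev ` {w. set w \<subseteq> UNIV \<times> {..<d}}"
  have W_id: "id \<in> W" unfolding W_def by (rule image_eqI[where x="[]"]) (auto simp: ev_def)
  have W_gen: "U \<circ> gen p \<in> W" if "U \<in> W" "snd p < d" for U p
  proof -
    obtain w where w: "set w \<subseteq> UNIV \<times> {..<d}" "U = ev w" using \<open>U \<in> W\<close> by (auto simp: W_def)
    show ?thesis unfolding W_def
      using w that(2) by (intro image_eqI[where x="w @ [p]"]) (auto simp: ev_snoc mem_Times_iff)
  qed
  have W_S: "U \<circ> S j \<in> W" "U \<circ> inv (S j) \<in> W" if "U \<in> W" "j < d" for U j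
    using W_gen[OF that(1), of "(True, j)"] W_gen[OF that(1), of "(False, j)"] that(2) by (auto simp: gen_def)
  have W_meas: "U \<in> measurable M M" if "U \<in> W" for U
  proof -
    obtain w where w: "set w \<subseteq> UNIV \<times> {..<d}" "U = ev w" using \<open>U \<in> W\<close> by (auto simp: W_def)
    have "ev w \<in> measurable M M" using w(1)
    proof (induction w)
      case Nil
      then show ?case by (simp add: ev_def id_def)
    next
      case (Cons p w)
      then have "gen p \<in> measurable M M" using mpres_measurable[OF mp] inv by (auto simp: gen_def)
      moreover have "ev (p # w) = gen p \<circ> ev w" by (simp add: ev_def)
      ultimately show ?case using Cons measurable_comp[of "ev w" M M "gen p" M] by simp
    qed
    then show ?thesis using w by simp
  qed
  \<comment> \<open>Letting the first component run over all of \<open>nat\<close> keeps the index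
    set infinite even for d = 0, so it can be enumerated bijectively by \<open>nat\<close>. Bits
    with i \<ge> d are constantly false in \<Phi>.\<close>
  define Idx where "Idx = (UNIV :: nat set) \<times> (UNIV :: rat set) \<times> W"
  have "countable W" unfolding W_def by (intro countable_image) (rule countableI_type)
  then have cI: "countable Idx" unfolding Idx_def by (intro countable_SIGMA) auto
  have iI: "infinite Idx"
  proof
    assume "finite Idx"
    then have "finite (fst ` Idx)" by simp
    moreover have "fst ` Idx = UNIV" using W_id by (force simp: Idx_def)
    ultimately show False by simp
  qed
  define e where "e = from_nat_into Idx"
  define e' where "e' = to_nat_on Idx"
  have ee: "e' (e p) = p" for p unfolding e_def e'_def by (rule to_nat_on_from_nat_into_infinite[OF cI iI])
  have ee': "e (e' c) = c" if "c \<in> Idx" for c unfolding e_def e'_def by (rule from_nat_into_to_nat_on[OF cI that])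
  have eI: "e p \<in> Idx" for p unfolding e_def using iI by (intro from_nat_into) auto
  \<comment> \<open>Translation composes on the right: the bit of \<Phi> (S j x) at U is the bit of
    \<Phi> x at U \<circ> S j. This reverses the order of composition in \<tau>.\<close>
  define mv where "mv = (\<lambda>(V :: 'a \<Rightarrow> 'a) (c :: nat \<times> rat \<times> ('a \<Rightarrow> 'a)). (fst c, fst (snd c), snd (snd c) \<circ> V))"
  have mvI: "mv (S j) c \<in> Idx" "mv (inv (S j)) c \<in> Idx" if "c \<in> Idx" "j < d" for c j
    using that W_S by (auto simp: mv_def Idx_def)
  have mv_mv: "mv V (mv V' c) = mv (V' \<circ> V) c" for V V' c by (simp add: mv_def comp_assoc)
  have mv_id: "mv id c = c" for c by (simp add: mv_def)
  define \<tau> where "\<tau> = (\<lambda>V p. e' (mv V (e p)))"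
  have \<tau>: "\<tau> V (\<tau> V' p) = \<tau> (V' \<circ> V) p" if "\<And>c. c \<in> Idx \<Longrightarrow> mv V' c \<in> Idx" for V V' p
    unfolding \<tau>_def using ee'[OF that[OF eI]] by (simp add: mv_mv)
  have \<tau>_id: "\<tau> id p = p" for p by (simp add: \<tau>_def mv_id ee)
  define T where "T = (\<lambda>j (z :: nat \<Rightarrow> bool). z \<circ> \<tau> (S j))"
  define T' where "T' = (\<lambda>j (z :: nat \<Rightarrow> bool). z \<circ> \<tau> (inv (S j)))"
  define \<Phi> where "\<Phi> = (\<lambda>x p. of_rat (fst (snd (e p))) < g (fst (e p)) (snd (snd (e p)) x) \<and> fst (e p) < d)"
  have \<Phi>_bit: "\<Phi> x (e' (i, q, U)) \<longleftrightarrow> of_rat q < g i (U x) \<and> i < d" if "U \<in> W" for x i q U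
    unfolding \<Phi>_def using that by (subst (1 2 3 4) ee') (auto simp: Idx_def)
  have \<Phi>S: "\<Phi> (S j x) = T j (\<Phi> x)" if j: "j < d" for j x
  proof
    fix p
    obtain i q U where c: "e p = (i, q, U)" "U \<in> W" using eI[of p] by (auto simp: Idx_def)
    have "T j (\<Phi> x) p = \<Phi> x (e' (i, q, U \<circ> S j))" by (simp add: T_def \<tau>_def mv_def c)
    also have "\<dots> = (of_rat q < g i (U (S j x)) \<and> i < d)" using \<Phi>_bit[OF W_S(1)[OF c(2) j]] by simp
    also have "\<dots> = \<Phi> (S j x) p" by (simp add: \<Phi>_def c)
    finally show "\<Phi> (S j x) p = T j (\<Phi> x) p" by simp
  qed
  have \<Phi>m[measurable]: "\<Phi> \<in> measurable M borel"
  proof (rule measurable_coordinatewise_then_product)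
    fix p
    obtain i q U where c: "e p = (i, q, U)" "U \<in> W" using eI[of p] by (auto simp: Idx_def)
    have *: "Measurable.pred M (\<lambda>x. of_rat q < g i (U x) \<and> i < d)"
    proof (cases "i < d")
      case True
      have [measurable]: "(\<lambda>x. g i (U x)) \<in> borel_measurable M"
        by (rule bdd_measD[OF bdd_meas_comp[OF g[OF True] W_meas[OF c(2)]]])
      show ?thesis by measurable
    qed simp
    have "(\<lambda>b::bool. b) \<in> measurable (count_space UNIV) borel" by simp
    from measurable_compose[OF * this] show "(\<lambda>x. \<Phi> x p) \<in> borel_measurable M" by (simp add: \<Phi>_def c)
  qed
  define N where "N = distr M borel \<Phi>"
  \<comment> \<open>Invertibility is a property of the permutations of the index set, so it holds on
    the whole Cantor space and not only on the image of \<Phi>.\<close>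
  have TT': "T j (T' j z) = z" "T' j (T j z) = z" if j: "j < d" for j z
  proof -
    have "S j \<circ> inv (S j) = id" "inv (S j) \<circ> S j = id"
      using bij[OF j] by (simp_all add: bij_is_surj bij_is_inj flip: surj_iff inj_iff)
    then have "\<tau> (inv (S j)) (\<tau> (S j) p) = p" "\<tau> (S j) (\<tau> (inv (S j)) p) = p" for p
      using \<tau>[OF mvI(1)[OF _ j], of "inv (S j)" p] \<tau>[OF mvI(2)[OF _ j], of "S j" p] by (simp_all add: \<tau>_id)
    then show "T j (T' j z) = z" "T' j (T j z) = z" by (auto simp: T_def T'_def)
  qed
  have contT: "continuous_on UNIV (\<lambda>z :: nat \<Rightarrow> bool. z \<circ> s)" for s
    unfolding comp_def by (intro continuous_on_coordinatewise_then_product) simp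
  have "cantor_system N d T"
  proof -
    have N: "prob_space N" unfolding N_def by (rule prob_space_distr[OF \<Phi>m])
    show ?thesis
    proof (intro cantor_system.intro cantor_system_axioms.intro N)
      show "sets N = sets borel" by (simp add: N_def)
      fix j assume j: "j < d"
      have "T j \<circ> T' j = id" "T' j \<circ> T j = id" using TT'[OF j] by auto
      then show "bij (T j)" "continuous_on UNIV (inv (T j))"
        using o_bij[of "T' j" "T j"] inv_unique_comp[of "T j" "T' j"] contT by (auto simp: T'_def)
      show ct: "continuous_on UNIV (T j)" unfolding T_def by (rule contT)
      have tm: "T j \<in> measurable borel borel" by (rule borel_measurable_continuous_onI[OF ct])
      have "distr N N (T j) = distr N borel (T j)" by (rule distr_cong) (simp_all add: N_def)
      also have "\<dots> = distr M borel (T j \<circ> \<Phi>)" unfolding N_def by (rule distr_distr[OF tm \<Phi>m])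
      also have "T j \<circ> \<Phi> = \<Phi> \<circ> S j" using \<Phi>S[OF j] by auto
      also have "distr M borel (\<Phi> \<circ> S j) = distr (distr M M (S j)) borel \<Phi>"
        using distr_distr[OF \<Phi>m mpres_measurable[OF mp[OF j]]] by simp
      also have "\<dots> = N" using mp[OF j] by (simp add: mpres_def N_def)
      finally show "mpres N (T j)" using tm by (simp add: mpres_def N_def)
    next
      fix i j z assume ij: "i < d" "j < d"
      have "S i \<circ> S j = S j \<circ> S i" using comm[OF ij] by auto
      then show "T i (T j z) = T j (T i z)"
        unfolding T_def using \<tau>[OF mvI(1)[OF _ ij(1)], of "S j"] \<tau>[OF mvI(1)[OF _ ij(2)], of "S i"] by (simp add: comp_def)
    qed
  qed
  \<comment> \<open>The bits at U = id form the rational cut of g i x, so decoding them gives back g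
    on the image of \<Phi>.\<close>
  define h where "h = (\<lambda>i z. clip_sup (B i) (\<lambda>q. z (e' (i, q, id))))"
  have hg: "h i (\<Phi> x) = g i x" if "i < d" for i x
    unfolding h_def using \<Phi>_bit[OF W_id] that B by (simp add: clip_sup_cut)
  have hb: "h i \<in> bdd_meas N" if i: "i < d" for i
  proof (rule bdd_measI[where B="B i"])
    show "\<bar>h i z\<bar> \<le> B i" for z unfolding h_def using B i by (intro clip_sup_bound) auto
    have [measurable]: "Measurable.pred borel (\<lambda>z. z p)" for p :: nat
    proof -
      have "{z \<in> space borel. z p} = (\<lambda>z. z p) -` {True}" by auto
      then show ?thesis using clopens_borel[OF clopen_coordinate[of p "{True}"]] by (simp add: pred_def)
    qed
    have "h i \<in> borel_measurable borel" unfolding h_def clip_sup_def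
      using B i by (intro borel_measurable_cSUP bdd_aboveI2[where M="B i"]) auto
    then show "h i \<in> borel_measurable N" by (simp add: N_def)
  qed
  have "AE z in N. convergent (\<lambda>n. davg T d d h n z)"
    by (rule cantor_davg_AE_convergent[OF \<open>cantor_system N d T\<close> order_refl hb])
  then have "AE x in M. convergent (\<lambda>n. davg T d d h n (\<Phi> x))"
    unfolding N_def by (rule AE_distrD[OF \<Phi>m])
  moreover have "davg T d d h n (\<Phi> x) = davg S d d g n x" for n x
    by (rule davg_semiconj[where d=d]) (simp_all add: \<Phi>S hg)
  ultimately show ?thesis by simp
qed

section \<open>From cube averages of complex functions to iterated averages of real ones\<close>

lemma compose_powers_cong:
  assumes "\<And>i. i \<in> {1..k} \<Longrightarrow> m i = m' i"
  shows "compose_powers T m k = compose_powers T m' k"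
  using assms by (induction k) auto

text \<open>Splitting off the last entry of the multi-index reproduces the recursion of
  \<open>mavg\<close>, since in both the last transformation acts first.\<close>

lemma sum_compose_powers:
  "(\<Sum>m\<in>{1..k} \<rightarrow>\<^sub>E {0..<N}. h (compose_powers T m k x)) = real N ^ k * mavg (\<lambda>i. T (Suc i)) k N h x"
proof (induction k arbitrary: x)
  case (Suc k)
  have set: "{1..Suc k} = insert (Suc k) {1..k}" by auto
  have inj: "inj_on (\<lambda>(n, m). m(Suc k := n)) ({0..<N} \<times> ({1..k} \<rightarrow>\<^sub>E {0..<N}))"
    by (rule inj_combinator) simp
  have "(\<Sum>m\<in>{1..Suc k} \<rightarrow>\<^sub>E {0..<N}. h (compose_powers T m (Suc k) x))
      = (\<Sum>(n, m)\<in>{0..<N} \<times> ({1..k} \<rightarrow>\<^sub>E {0..<N}). h (compose_powers T (m(Suc k := n)) (Suc k) x))"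
    unfolding set PiE_insert_eq using inj by (subst sum.reindex) (auto simp: case_prod_unfold)
  also have "\<dots> = (\<Sum>n\<in>{0..<N}. \<Sum>m\<in>{1..k} \<rightarrow>\<^sub>E {0..<N}. h (compose_powers T m k ((T (Suc k) ^^ n) x)))"
    unfolding sum.cartesian_product[symmetric]
  proof (intro sum.cong refl)
    fix n and m :: "nat \<Rightarrow> nat"
    have "compose_powers T (m(Suc k := n)) k = compose_powers T m k" by (rule compose_powers_cong) auto
    then show "h (compose_powers T (m(Suc k := n)) (Suc k) x) = h (compose_powers T m k ((T (Suc k) ^^ n) x))" by simp
  qed
  also have "\<dots> = real N ^ k * (\<Sum>n<N. mavg (\<lambda>i. T (Suc i)) k N h ((T (Suc k) ^^ n) x))"
    unfolding Suc sum_distrib_left[symmetric] by (simp add: atLeast0LessThan)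
  also have "\<dots> = real N ^ Suc k * mavg (\<lambda>i. T (Suc i)) (Suc k) N h x" by (simp add: cavg_def)
  finally show ?case .
qed simp

lemma cube_average_of_real:
  assumes "\<And>i x. i \<in> {1..d} \<Longrightarrow> f i x = of_real (g (i - 1) x)" "N \<ge> 1"
  shows "cube_average T f d N x = of_real (davg (\<lambda>i. T (Suc i)) d d g N x)"
proof -
  have p: "(\<Prod>i = 1..d. f i ((T i ^^ n) y)) = of_real (\<Prod>i<d. g i ((T (Suc i) ^^ n) y))" for n y
  proof -
    have "(\<Prod>i = 1..d. f i ((T i ^^ n) y)) = (\<Prod>i = 1..d. of_real (g (i - 1) ((T i ^^ n) y)))"
      using assms by (intro prod.cong) auto
    also have "\<dots> = (\<Prod>i<d. of_real (g i ((T (Suc i) ^^ n) y)))"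
      by (rule prod.reindex_bij_witness[where i=Suc and j="\<lambda>i. i - 1"]) auto
    finally show ?thesis by simp
  qed
  have "(\<Sum>m\<in>{1..d} \<rightarrow>\<^sub>E {0..<N}. \<Sum>n = 0..<N. \<Prod>i<d. g i ((T (Suc i) ^^ n) (compose_powers T m d x)))
      = real N ^ d * (\<Sum>n<N. mavg (\<lambda>i. T (Suc i)) d N (\<lambda>y. \<Prod>i<d. g i ((T (Suc i) ^^ n) y)) x)"
    unfolding sum.swap[of _ "{0..<N}"] sum_compose_powers[where h="\<lambda>y. \<Prod>i<d. g i ((T (Suc i) ^^ _) y)"]
      sum_distrib_left[symmetric] by (simp add: atLeast0LessThan)
  then have *: "real N ^ d * (\<Sum>n<N. mavg (\<lambda>i. T (Suc i)) d N (\<lambda>y. \<Prod>i<d. g i ((T (Suc i) ^^ n) y)) x) =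
    (\<Sum>m\<in>{1..d} \<rightarrow>\<^sub>E {0..<N}. \<Sum>n = 0..<N. \<Prod>i<d. g i ((T (Suc i) ^^ n) (compose_powers T m d x)))" by simp
  have "cube_average T f d N x = of_real (1 / real N ^ (d + 1) *
      (\<Sum>m\<in>{1..d} \<rightarrow>\<^sub>E {0..<N}. \<Sum>n = 0..<N. \<Prod>i<d. g i ((T (Suc i) ^^ n) (compose_powers T m d x))))"
    unfolding cube_average_def p by simp
  also have "\<dots> = of_real (davg (\<lambda>i. T (Suc i)) d d g N x)"
    unfolding *[symmetric] davg_def eavg_def using \<open>N \<ge> 1\<close> by (simp add: field_simps)
  finally show ?thesis .
qed

lemma cube_average_upd:
  assumes "i \<in> {1..d}"
  shows "cube_average T (f(i := \<lambda>x. u x + c * w x)) d N x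
    = cube_average T (f(i := u)) d N x + c * cube_average T (f(i := w)) d N x"
proof -
  have "(\<Prod>j = 1..d. (f(i := v)) j (y j)) = v (y i) * (\<Prod>j\<in>{1..d} - {i}. f j (y j))" for v y
  proof -
    have "(\<Prod>j\<in>{1..d} - {i}. (f(i := v)) j (y j)) = (\<Prod>j\<in>{1..d} - {i}. f j (y j))" by (intro prod.cong) auto
    then show ?thesis using assms by (subst prod.remove[of _ i]) auto
  qed
  note p = this
  show ?thesis unfolding cube_average_def p
    by (simp add: distrib_right distrib_left sum.distrib sum_distrib_left mult.assoc mult.left_commute)
qed

text \<open>The average is multilinear, so each function can be split into real and imaginary parts,
  one slot at a time.\<close>

lemma cube_average_AE_convergent_bounded:
  fixes T :: "nat \<Rightarrow> 'a \<Rightarrow> 'a" and f :: "nat \<Rightarrow> 'a \<Rightarrow> complex"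
  assumes M: "prob_space M"
    and mp: "\<And>i. i \<in> {1..d} \<Longrightarrow> mpres M (T i)" and bij: "\<And>i. i \<in> {1..d} \<Longrightarrow> bij (T i)"
    and inv: "\<And>i. i \<in> {1..d} \<Longrightarrow> inv (T i) \<in> measurable M M"
    and comm: "\<And>i j x. i \<in> {1..d} \<Longrightarrow> j \<in> {1..d} \<Longrightarrow> T i (T j x) = T j (T i x)"
    and f: "\<And>i. i \<in> {1..d} \<Longrightarrow> f i \<in> borel_measurable M" "\<And>i. i \<in> {1..d} \<Longrightarrow> \<exists>B. \<forall>x. norm (f i x) \<le> B"
  shows "AE x in M. convergent (\<lambda>N. cube_average T f d N x)"
proof -
  \<comment> \<open>Here k bounds the slots that may still be nonreal; for k = 0 all functions are
    real and the real theorem applies.\<close>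
  have "k \<le> d \<Longrightarrow> (\<And>i. i \<in> {1..d} \<Longrightarrow> f i \<in> borel_measurable M) \<Longrightarrow>
      (\<And>i. i \<in> {1..d} \<Longrightarrow> \<exists>B. \<forall>x. norm (f i x) \<le> B) \<Longrightarrow>
      (\<And>i x. i \<in> {1..d} \<Longrightarrow> i > k \<Longrightarrow> Im (f i x) = 0) \<Longrightarrow>
      AE x in M. convergent (\<lambda>N. cube_average T f d N x)" for k f
  proof (induction k arbitrary: f)
    case 0
    define g where "g = (\<lambda>i x. Re (f (Suc i) x))"
    have fg: "f i x = of_real (g (i - 1) x)" if "i \<in> {1..d}" for i x
      using 0(4)[OF that] that by (simp add: g_def complex_eq_iff)
    have "AE x in M. convergent (\<lambda>N. davg (\<lambda>i. T (Suc i)) d d g N x)"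
    proof (rule davg_AE_convergent[OF M])
      fix i assume "i < d"
      then have i: "Suc i \<in> {1..d}" by auto
      obtain B where B: "\<And>x. norm (f (Suc i) x) \<le> B" using 0(3)[OF i] by blast
      show "g i \<in> bdd_meas M"
      proof (rule bdd_measI)
        show "g i \<in> borel_measurable M" unfolding g_def using 0(2)[OF i] by measurable
        show "\<bar>g i x\<bar> \<le> B" for x unfolding g_def using abs_Re_le_cmod[of "f (Suc i) x"] B[of x] by linarith
      qed
      show "mpres M (T (Suc i))" "bij (T (Suc i))" "inv (T (Suc i)) \<in> measurable M M" using mp bij inv i by auto
      show "T (Suc i) (T (Suc j) x) = T (Suc j) (T (Suc i) x)" if "j < d" for j x using comm i that by auto
    qed
    then show ?case
    proof eventually_elim
      case (elim x)
      then obtain l where "(\<lambda>N. davg (\<lambda>i. T (Suc i)) d d g N x) \<longlonglongrightarrow> l" by (auto simp: convergent_def)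
      then have "(\<lambda>N. complex_of_real (davg (\<lambda>i. T (Suc i)) d d g N x)) \<longlonglongrightarrow> of_real l" by (rule tendsto_of_real)
      moreover have "\<forall>\<^sub>F N in sequentially. complex_of_real (davg (\<lambda>i. T (Suc i)) d d g N x) = cube_average T f d N x"
        using fg by (intro eventually_sequentiallyI[of 1] cube_average_of_real[symmetric])
      ultimately show ?case by (blast intro: convergentI Lim_transform_eventually)
    qed
  next
    case (Suc k)
    define i where "i = Suc k"
    have i: "i \<in> {1..d}" using Suc.prems(1) by (simp add: i_def)
    define R where "R = (\<lambda>x. complex_of_real (Re (f i x)))"
    define J where "J = (\<lambda>x. complex_of_real (Im (f i x)))"
    obtain B where B: "\<And>x. norm (f i x) \<le> B" using Suc.prems(3)[OF i] by blast
    have fi[measurable]: "f i \<in> borel_measurable M" by (rule Suc.prems(2)[OF i])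
    have conv: "AE x in M. convergent (\<lambda>N. cube_average T (f(i := v)) d N x)"
      if v: "v \<in> borel_measurable M" "\<And>x. norm (v x) \<le> B" "\<And>x. Im (v x) = 0" for v
    proof (rule Suc.IH)
      show "k \<le> d" using Suc.prems(1) by simp
      fix j assume j: "j \<in> {1..d}"
      show "(f(i := v)) j \<in> borel_measurable M" using v(1) Suc.prems(2)[OF j] by simp
      show "\<exists>B. \<forall>x. norm ((f(i := v)) j x) \<le> B" using v(2) Suc.prems(3)[OF j] by auto
      show "Im ((f(i := v)) j x) = 0" if "j > k" for x
        using v(3) Suc.prems(4)[OF j, of x] that by (auto simp: i_def)
    qed
    have "f(i := \<lambda>x. R x + \<i> * J x) = f" by (simp add: R_def J_def complex_eq_iff fun_eq_iff)
    then have split: "cube_average T f d N x = cube_average T (f(i := R)) d N x + \<i> * cube_average T (f(i := J)) d N x" for N x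
      using cube_average_upd[OF i, of T f R \<i> J N x] by simp
    have "AE x in M. convergent (\<lambda>N. cube_average T (f(i := R)) d N x)"
    proof (rule conv)
      show "R \<in> borel_measurable M" unfolding R_def by measurable
      show "norm (R x) \<le> B" for x unfolding R_def norm_of_real using abs_Re_le_cmod[of "f i x"] B[of x] by linarith
    qed (simp add: R_def)
    moreover have "AE x in M. convergent (\<lambda>N. cube_average T (f(i := J)) d N x)"
    proof (rule conv)
      show "J \<in> borel_measurable M" unfolding J_def by measurable
      show "norm (J x) \<le> B" for x unfolding J_def norm_of_real using abs_Im_le_cmod[of "f i x"] B[of x] by linarith
    qed (simp add: J_def)
    ultimately show ?case
      by eventually_elim (simp only: split, intro convergent_add convergent_mult convergent_const)
  qed
  from this[of d f] f show ?thesis by auto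
qed

section \<open>Reduction to everywhere bounded functions and bijections of the whole type\<close>

lemma mpres_compose_powers:
  assumes "\<And>i. i \<in> {1..k} \<Longrightarrow> mpres M (T i)" shows "mpres M (compose_powers T m k)"
  using assms
proof (induction k)
  case 0
  then show ?case using mpres_id by (simp add: id_def)
next
  case (Suc k)
  then show ?case unfolding compose_powers.simps by (intro mpres_comp mpres_pow) auto
qed

theorem theorem1p1:
  fixes M :: "'a measure" and d :: nat
    and T :: "nat \<Rightarrow> 'a \<Rightarrow> 'a" and f :: "nat \<Rightarrow> 'a \<Rightarrow> complex"
  assumes "ergodic_commuting_system M d T"
    and "\<And>i. i \<in> {1..d} \<Longrightarrow> f i \<in> L_infty M"
  shows "AE x in M. convergent (\<lambda>N. cube_average T f d N x)"
proof -
  interpret ergodic_commuting_system M d T by fact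
  \<comment> \<open>Extending by the identity off the space gives a bijection of the whole type, as
    the coding requires, without changing orbits inside the space.\<close>
  define S where "S = (\<lambda>i x. if x \<in> space M then T i x else x)"
  have Tm: "T i \<in> measurable M M" "distr M M (T i) = M" "bij_betw (T i) (space M) (space M)"
    "inv_into (space M) (T i) \<in> measurable M M" if "i \<in> {1..d}" for i
    using mpt[OF that] by (auto simp: invertible_mpt_def)
  have Tsp: "T i x \<in> space M" if "i \<in> {1..d}" "x \<in> space M" for i x
    using measurable_space[OF Tm(1)] that by blast
  have Sm: "mpres M (S i)" if "i \<in> {1..d}" for i
  proof -
    have "S i \<in> measurable M M" using Tm(1)[OF that] by (rule measurable_cong[THEN iffD1, rotated]) (simp add: S_def)
    moreover have "distr M M (S i) = distr M M (T i)" by (rule distr_cong) (auto simp: S_def)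
    ultimately show ?thesis using Tm(2)[OF that] by (simp add: mpres_def)
  qed
  define S' where "S' = (\<lambda>i x. if x \<in> space M then inv_into (space M) (T i) x else x)"
  have SS': "S i (S' i x) = x" "S' i (S i x) = x" if i: "i \<in> {1..d}" for i x
    using Tm(3)[OF i] Tsp[OF i] bij_betw_inv_into[OF Tm(3)[OF i]]
    by (auto simp: S_def S'_def bij_betw_inv_into_right bij_betw_inv_into_left dest: bij_betwE)
  have Sb: "bij (S i)" "inv (S i) = S' i" if "i \<in> {1..d}" for i
    using SS'[OF that] o_bij[of "S' i" "S i"] inv_unique_comp[of "S i" "S' i"] by (auto simp: fun_eq_iff)
  have S'm: "S' i \<in> measurable M M" if "i \<in> {1..d}" for i
    using Tm(4)[OF that] by (rule measurable_cong[THEN iffD1, rotated]) (simp add: S'_def)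
  have Spow: "(S i ^^ n) x = (T i ^^ n) x \<and> (T i ^^ n) x \<in> space M" if "i \<in> {1..d}" "x \<in> space M" for i n x
    using that by (induction n) (auto simp: S_def Tsp)
  have Scp: "compose_powers S m k x = compose_powers T m k x \<and> compose_powers T m k x \<in> space M"
    if "k \<le> d" "x \<in> space M" for m k x
    using that
  proof (induction k arbitrary: x)
    case (Suc k)
    then have "(S (Suc k) ^^ m (Suc k)) x = (T (Suc k) ^^ m (Suc k)) x" "(T (Suc k) ^^ m (Suc k)) x \<in> space M"
      using Spow[of "Suc k" x] by auto
    then show ?case using Suc by simp
  qed simp
  have "\<forall>i. \<exists>C. i \<in> {1..d} \<longrightarrow> (AE x in M. norm (f i x) \<le> C)" using assms(2) by (auto simp: L_infty_def)
  then obtain C where C: "\<forall>i. i \<in> {1..d} \<longrightarrow> (AE x in M. norm (f i x) \<le> C i)" by (rule choice[THEN exE])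
  define h where "h = (\<lambda>i x. if norm (f i x) \<le> C i then f i x else 0)"
  have hm: "h i \<in> borel_measurable M" if "i \<in> {1..d}" for i
  proof -
    have [measurable]: "f i \<in> borel_measurable M" using assms(2)[OF that] by (simp add: L_infty_def)
    show ?thesis unfolding h_def by measurable
  qed
  have conv: "AE x in M. convergent (\<lambda>N. cube_average S h d N x)"
  proof (rule cube_average_AE_convergent_bounded[OF prob_space_axioms])
    fix i assume i: "i \<in> {1..d}"
    show "mpres M (S i)" "bij (S i)" "inv (S i) \<in> measurable M M" "h i \<in> borel_measurable M"
      using Sm Sb S'm hm i by auto
    have "norm (h i x) \<le> \<bar>C i\<bar>" for x by (auto simp: h_def)
    then show "\<exists>B. \<forall>x. norm (h i x) \<le> B" by blast
    show "S i (S j x) = S j (S i x)" if "j \<in> {1..d}" for j x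
      using commute[OF i that] Tsp[OF i] Tsp[OF that] by (auto simp: S_def)
  qed
  \<comment> \<open>Measure preservation pulls the null set where f i and h i differ back along each
    orbit map; there are countably many of these, so one null set serves for all N.\<close>
  have "AE x in M. \<forall>m\<in>{1..d} \<rightarrow>\<^sub>E UNIV. \<forall>n. \<forall>i\<in>{1..d}. f i ((S i ^^ n) (compose_powers S m d x)) = h i ((S i ^^ n) (compose_powers S m d x))"
  proof -
    have "AE x in M. f i ((S i ^^ n) (compose_powers S m d x)) = h i ((S i ^^ n) (compose_powers S m d x))"
      if "i \<in> {1..d}" for i n m
    proof -
      have "AE x in M. f i x = h i x" using C that by (auto simp: h_def)
      moreover have "mpres M ((S i ^^ n) \<circ> compose_powers S m d)"
        using Sm that by (intro mpres_comp mpres_pow mpres_compose_powers) auto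
      ultimately show ?thesis using mpres_AE[of M "(S i ^^ n) \<circ> compose_powers S m d" "\<lambda>x. f i x = h i x"] by simp
    qed
    moreover have "countable ({1..d} \<rightarrow>\<^sub>E (UNIV :: nat set))" by (intro countable_PiE) auto
    ultimately show ?thesis by (simp add: AE_ball_countable AE_all_countable)
  qed
  with conv AE_space show ?thesis
  proof eventually_elim
    case (elim x)
    have "cube_average T f d N x = cube_average S h d N x" for N
      unfolding cube_average_def
    proof (intro arg_cong2[where f="(*)"] sum.cong prod.cong refl)
      fix m n i assume m: "m \<in> {1..d} \<rightarrow>\<^sub>E {0..<N}" and i: "i \<in> {1..d}"
      have "m \<in> {1..d} \<rightarrow>\<^sub>E UNIV" using m by (auto simp: PiE_def)
      then have "h i ((S i ^^ n) (compose_powers S m d x)) = f i ((S i ^^ n) (compose_powers S m d x))"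
        using elim(3) i by simp
      also have "\<dots> = f i ((T i ^^ n) (compose_powers T m d x))"
        using Scp[OF order_refl elim(2), of m] Spow[OF i] by simp
      finally show "f i ((T i ^^ n) (compose_powers T m d x)) = h i ((S i ^^ n) (compose_powers S m d x))" by simp
    qed
    then show ?case using elim(1) by simp
  qed
qed

end
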